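(* Let $Q$ be a ground quantum type and let $t$ be a closed well-formed term, $\vdash t:Q$. Then there exists a closed well-formed value $v$, $\vdash v:Q$, such that $\vdash t=v:Q$ is derivable in the equational theory.
   Context: **Syntax.** Ground quantum types: $Q::=I\mid Q\oplus Q\mid Q\otimes Q\mid\mathrm{qnat}$, with $\mathrm{qbit}:=I\oplus I$. Unitary types: $U(Q_1,Q_2)$. Let $x$ range over variables and $\alpha$ over complex scalars; all index sets are finite. Basis values: $b::=*\mid x\mid\mathrm{inl}\,b\mid\mathrm{inr}\,b\mid b\otimes b\mid 0\mid S\,b$ (a total order on them is fixed). Values: $v::=\sum_{i\in I}(\alpha_i\cdot b_i)$ with the $b_i$ in increasing order and all $\alpha_i\neq 0$. Expressions: $e::=*\mid x\mid\mathrm{inl}\,e\mid\mathrm{inr}\,e\mid e\otimes e\mid 0\mid S\,e\mid\sum_{i\in I}(\alpha_i\cdot e_i)$. Unitaries: $u::=\{b_1\mapsto e_1\mid\dots\mid b_n\mapsto e_n\}\mid u\otimes u\mid u\oplus u\mid u\circ u\mid u^*\mid\mathrm{ctrl}\,u$. Terms: $t::=*\mid x\mid\mathrm{inl}\,t\mid\mathrm{inr}\,t\mid t\otimes t\mid 0\mid S\,t\mid u\,t\mid\sum_{i\in I}(\alpha_i\cdot t_i)$. **Orthogonality** $\perp$ is the smallest symmetric relation on terms such that: $\mathrm{inl}\,t_1\perp\mathrm{inr}\,t_2$; $0\perp S\,t$; if $t_1\perp t_2$ then $S\,t_1\perp S\,t_2$, $\mathrm{inl}\,t_1\perp\mathrm{inl}\,t_2$,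 $\mathrm{inr}\,t_1\perp\mathrm{inr}\,t_2$, $u\,t_1\perp u\,t_2$, and, for all $t,t'$, $t\otimes t_1\perp t'\otimes t_2$ and $t_1\otimes t\perp t_2\otimes t'$; if $t\perp t_i$ for all $i\in I$ then $t\perp\sum_{i\in I}(\alpha_i\cdot t_i)$; if $t\perp t_i$ for all $i\in I$, $\alpha_\star=0$ and $t_\star=t$, then $t\perp\sum_{i\in I\cup\{\star\}}(\alpha_i\cdot t_i)$; if $t_i\perp t_j$ for all $i\ne j\in I$, $J,K\subseteq I$ and $\sum_{i\in J\cap K}\overline{\alpha_i}\beta_i=0$, then $\sum_{j\in J}(\alpha_j\cdot t_j)\perp\sum_{k\in K}(\beta_k\cdot t_k)$. **Orthonormal bases.** For a set $S$ of elements of the form $b\otimes b'$, $\pi_1(S),\pi_2(S)$ are the sets of first, resp. second, components, $S^1_b=\{b'\mid b\otimes b'\in S\}$ and $S^2_b=\{b'\mid b'\otimes b\in S\}$. $\mathrm{ONB}_Q$ is the smallest predicate on finite sets of basis values with: $\mathrm{ONB}_Q(\{x\})$; $\mathrm{ONB}_I(\{*\})$; if $\mathrm{ONB}_{Q_1}(S)$ and $\mathrm{ONB}_{Q_2}(T)$ then $\mathrm{ONB}_{Q_1\oplus Q_2}(\{\mathrm{inl}\,b\mid b\in S\}\cup\{\mathrm{inr}\,b\mid b\in T\})$; if $\mathrm{ONB}_{\mathrm{qnat}}(S)$ then $\mathrm{ONB}_{\mathrm{qnat}}(\{0\}\cup\{S\,b\mid b\in S\})$; $\mathrm{ONB}_{Q_1\otimes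 Q_2}(S)$ if $\mathrm{ONB}_{Q_2}(\pi_2(S))$ and $\mathrm{ONB}_{Q_1}(S^2_b)$ for all $b\in\pi_2(S)$; $\mathrm{ONB}_{Q_1\otimes Q_2}(S)$ if $\mathrm{ONB}_{Q_1}(\pi_1(S))$ and $\mathrm{ONB}_{Q_2}(S^1_b)$ for all $b\in\pi_1(S)$. $\mathrm{ONB}^e_Q$ is the predicate on finite sets of expressions generated by the same rules (for expressions) together with: if $\mathrm{ONB}^e_Q(S)$ and $(\alpha_{e,e'})_{(e,e')\in S\times S}$ is a unitary matrix then $\mathrm{ONB}^e_Q(\{\sum_{e'\in S}(\alpha_{e,e'}\cdot e')\mid e\in S\})$. **Typing** (contexts $\Gamma$ are finite sets of pairs $x:Q$, used strictly linearly; comma is disjoint union). $\vdash *:I$; $x:Q\vdash x:Q$; $\Gamma_1,\Gamma_2\vdash t_1\otimes t_2:Q_1\otimes Q_2$ if $\Gamma_i\vdash t_i:Q_i$; $\Gamma\vdash\mathrm{inl}\,t:Q_1\oplus Q_2$ if $\Gamma\vdash t:Q_1$; $\Gamma\vdash\mathrm{inr}\,t:Q_1\oplus Q_2$ if $\Gamma\vdash t:Q_2$; $\vdash 0:\mathrm{qnat}$; $\Gamma\vdash S\,t:\mathrm{qnat}$ if $\Gamma\vdash t:\mathrm{qnat}$; $\Gamma\vdash\sum_i(\alpha_i\cdot t_i):Q$ if $\Gamma\vdash t_i:Q$ for all $i$, $\sum_i|\alpha_i|^2=1$ and $t_i\perp t_j$ for $i\neq j$; $\Gamma\vdash u\,t:Q_2$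 if $\Vdash u:U(Q_1,Q_2)$ and $\Gamma\vdash t:Q_1$. Unitaries: $\Vdash\{b_1\mapsto e_1\mid\dots\mid b_n\mapsto e_n\}:U(Q_1,Q_2)$ if there are $\Gamma_i$ with $\Gamma_i\vdash b_i:Q_1$, $\Gamma_i\vdash e_i:Q_2$, $\mathrm{ONB}_{Q_1}(\{b_1,\dots,b_n\})$ and $\mathrm{ONB}^e_{Q_2}(\{e_1,\dots,e_n\})$ (the $b_i$ pairwise distinct, the $e_i$ pairwise distinct); $u^*:U(Q_2,Q_1)$ if $u:U(Q_1,Q_2)$; $u_2\circ u_1:U(Q_1,Q_3)$ if $u_1:U(Q_1,Q_2)$, $u_2:U(Q_2,Q_3)$; $u_1\otimes u_2:U(Q_1\otimes Q_3,Q_2\otimes Q_4)$ and $u_1\oplus u_2:U(Q_1\oplus Q_3,Q_2\oplus Q_4)$ if $u_1:U(Q_1,Q_2)$, $u_2:U(Q_3,Q_4)$; $\mathrm{ctrl}\,u:U(\mathrm{qbit}\otimes Q,\mathrm{qbit}\otimes Q)$ if $u:U(Q,Q)$. **Matching and substitution.** A valuation $\sigma$ is a finite partial map from variables to expressions; $\sigma(t)$ is $t$ with each variable replaced by its image (and $\sigma(u\,t)=u\,\sigma(t)$). $\mathrm{match}(\sigma,b,b')$ for basis values: $\mathrm{match}(\emptyset,*,* )$; $\mathrm{match}(\{x\mapsto b'\},x,b')$; $\mathrm{match}(\emptyset,0,0)$; $\mathrm{match}(\sigma,b,b')$ implies $\mathrm{match}(\sigma,\mathrm{inl}\,b,\mathrm{inl}\,b')$,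 $\mathrm{match}(\sigma,\mathrm{inr}\,b,\mathrm{inr}\,b')$, $\mathrm{match}(\sigma,S\,b,S\,b')$; $\mathrm{match}(\sigma_1,b_1,b_1')$, $\mathrm{match}(\sigma_2,b_2,b_2')$ with disjoint supports imply $\mathrm{match}(\sigma_1\cup\sigma_2,b_1\otimes b_2,b_1'\otimes b_2')$. **Equational theory.** Judgements $\Gamma\vdash t_1=t_2:Q$ generated by reflexivity (for well-formed terms), symmetry, transitivity and the following. Linear algebra (left-hand sides or their displayed components assumed well-formed): $\sum_i(\alpha_i\cdot t_i)=\sum_i(\alpha_{\ell(i)}\cdot t_{\ell(i)})$ for $\ell$ a permutation of indices; $\sum_{i=1}^n(\alpha_i\cdot t_i)=\sum_{i=1}^{n-1}(\alpha_i\cdot t_i)$ if $\alpha_n=0$; $\sum_{i=1}^1(1\cdot t)=t$; $\sum_i(\alpha_i\cdot\sum_j(\beta_{ij}\cdot t_j))=\sum_j((\sum_i\alpha_i\beta_{ij})\cdot t_j)$; $\sum_i(\alpha_i\cdot\sum_j(\beta_{ij}\cdot t_{ij}))=\sum_{ij}(\alpha_i\beta_{ij}\cdot t_{ij})$ provided the right-hand side is well-formed; $C[\sum_i(\alpha_i\cdot t_i)]=\sum_i(\alpha_i\cdot C[t_i])$ for $C[-]$ one of $u\,-$, $\mathrm{inl}\,-$, $\mathrm{inr}\,-$, $S\,-$, $t\otimes-$, $-\otimes t$. Congruence: from $\Gamma\vdash t_1=t_2$ infer $C[t_1]=C[t_2]$ for the same $C$ (with $u$, $t$ well-formed, contexts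 joined for $\otimes$); from $\Gamma\vdash\sum_i(\alpha_i\cdot t_i):Q$ and $\Gamma\vdash t_i=t_i':Q$ for all $i$ infer $\Gamma\vdash\sum_i(\alpha_i\cdot t_i)=\sum_i(\alpha_i\cdot t'_i):Q$. Computation (all well-formed, $b,b',b_i$ basis values, closed except in the rule for $\circ$, $v$ a value): $\{b_1\mapsto e_1\mid\dots\mid b_n\mapsto e_n\}\,b'=\sigma(e_i)$ if $\mathrm{match}(\sigma,b_i,b')$; from $\vdash u\,b=v$ infer $\vdash u^*\,v=b$; $(u_2\circ u_1)\,b=u_2\,(u_1\,b)$; $(u_1\otimes u_2)\,(b_1\otimes b_2)=(u_1\,b_1)\otimes(u_2\,b_2)$; $(u_1\oplus u_2)(\mathrm{inl}\,b)=\mathrm{inl}\,(u_1\,b)$; $(u_1\oplus u_2)(\mathrm{inr}\,b)=\mathrm{inr}\,(u_2\,b)$; $(\mathrm{ctrl}\,u)((\mathrm{inl}\,* )\otimes b)=(\mathrm{inl}\,* )\otimes b$; $(\mathrm{ctrl}\,u)((\mathrm{inr}\,* )\otimes b)=(\mathrm{inr}\,* )\otimes(u\,b)$. *)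

theory Defs
  imports Complex_Main "HOL-Combinatorics.Permutations"
begin

section \<open>Syntax\<close>

datatype qty = QUnit | QSum qty qty | QTens qty qty | QNat

abbreviation qbit :: qty where "qbit \<equiv> QSum QUnit QUnit"

type_synonym var = nat

datatype bval =
    BUnit | BVar var | BInl bval | BInr bval | BTens bval bval | BZero | BSuc bval

text \<open>A formal sum over a finite index set is the list of its weighted summands. Reordering the list
  gives a different piece of syntax, identified with the original one only by the equational theory.\<close>

datatype expr =
    EUnit | EVar var | EInl expr | EInr expr | ETens expr expr | EZero | ESuc expr
  | ESum "(complex \<times> expr) list"

datatype uni =
    Clauses "(bval \<times> expr) list"
  | UTens uni uni | UPlus uni uni | UComp uni uni | UStar uni | UCtrl uni

datatype trm =
    TUnit | TVar var | TInl trm | TInr trm | TTens trm trm | TZero | TSuc trm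
  | TApp uni trm | TSum "(complex \<times> trm) list"

primrec expr_of_bval :: "bval \<Rightarrow> expr" where
  "expr_of_bval BUnit = EUnit"
| "expr_of_bval (BVar x) = EVar x"
| "expr_of_bval (BInl b) = EInl (expr_of_bval b)"
| "expr_of_bval (BInr b) = EInr (expr_of_bval b)"
| "expr_of_bval (BTens b b') = ETens (expr_of_bval b) (expr_of_bval b')"
| "expr_of_bval BZero = EZero"
| "expr_of_bval (BSuc b) = ESuc (expr_of_bval b)"

primrec trm_of_expr :: "expr \<Rightarrow> trm" where
  "trm_of_expr EUnit = TUnit"
| "trm_of_expr (EVar x) = TVar x"
| "trm_of_expr (EInl e) = TInl (trm_of_expr e)"
| "trm_of_expr (EInr e) = TInr (trm_of_expr e)"
| "trm_of_expr (ETens e e') = TTens (trm_of_expr e) (trm_of_expr e')"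
| "trm_of_expr EZero = TZero"
| "trm_of_expr (ESuc e) = TSuc (trm_of_expr e)"
| "trm_of_expr (ESum ps) = TSum (map (map_prod id trm_of_expr) ps)"

definition trm_of_bval :: "bval \<Rightarrow> trm" where
  "trm_of_bval b = trm_of_expr (expr_of_bval b)"

text \<open>The fixed total order on basis values is the parameter \<open>ord\<close> (a reflexive linear order).
  A value is always a formal sum: a bare basis value is not one, but its one-summand sum is.
  The basis values are listed in strictly increasing order, hence without repetition.\<close>

definition is_value :: "bval rel \<Rightarrow> trm \<Rightarrow> bool" where
  "is_value ord v \<longleftrightarrow>
     (\<exists>ps. v = TSum (map (map_prod id trm_of_bval) ps)
         \<and> sorted_wrt (\<lambda>b b'. (b, b') \<in> ord \<and> b \<noteq> b') (map snd ps)
         \<and> (\<forall>p\<in>set ps. fst p \<noteq> 0))"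


section \<open>Orthogonality\<close>

inductive orth :: "trm \<Rightarrow> trm \<Rightarrow> bool" where
  orth_sym: "orth t1 t2 \<Longrightarrow> orth t2 t1"
| orth_inl_inr: "orth (TInl t1) (TInr t2)"
| orth_zero_suc: "orth TZero (TSuc t)"
| orth_suc: "orth t1 t2 \<Longrightarrow> orth (TSuc t1) (TSuc t2)"
| orth_inl: "orth t1 t2 \<Longrightarrow> orth (TInl t1) (TInl t2)"
| orth_inr: "orth t1 t2 \<Longrightarrow> orth (TInr t1) (TInr t2)"
| orth_app: "orth t1 t2 \<Longrightarrow> orth (TApp u t1) (TApp u t2)"
| orth_tens_right: "orth t1 t2 \<Longrightarrow> orth (TTens t t1) (TTens t' t2)"
| orth_tens_left: "orth t1 t2 \<Longrightarrow> orth (TTens t1 t) (TTens t2 t')"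
| orth_sum: "\<forall>p\<in>set ps. orth t (snd p) \<Longrightarrow> orth t (TSum ps)"
| orth_sum_null:
    "\<forall>p\<in>set (ps @ qs). orth t (snd p) \<Longrightarrow> orth t (TSum (ps @ (0, t) # qs))"
| orth_sum_sum:
    "\<lbrakk>finite (I :: nat set); \<forall>i\<in>I. \<forall>j\<in>I. i \<noteq> j \<longrightarrow> orth (t i) (t j);
      distinct js; set js \<subseteq> I; distinct ks; set ks \<subseteq> I;
      (\<Sum>i\<in>set js \<inter> set ks. cnj (\<alpha> i) * \<beta> i) = 0\<rbrakk>
     \<Longrightarrow> orth (TSum (map (\<lambda>j. (\<alpha> j, t j)) js)) (TSum (map (\<lambda>k. (\<beta> k, t k)) ks))"


section \<open>Orthonormal bases\<close>

text \<open>The argument \<open>tens\<close> is the tensor constructor, of basis values or of expressions.\<close>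

definition pi1 :: "('a \<Rightarrow> 'a \<Rightarrow> 'a) \<Rightarrow> 'a set \<Rightarrow> 'a set" where
  "pi1 tens S = {b. \<exists>b'. tens b b' \<in> S}"

definition pi2 :: "('a \<Rightarrow> 'a \<Rightarrow> 'a) \<Rightarrow> 'a set \<Rightarrow> 'a set" where
  "pi2 tens S = {b'. \<exists>b. tens b b' \<in> S}"

definition slice1 :: "('a \<Rightarrow> 'a \<Rightarrow> 'a) \<Rightarrow> 'a set \<Rightarrow> 'a \<Rightarrow> 'a set" where
  "slice1 tens S b = {b'. tens b b' \<in> S}"

definition slice2 :: "('a \<Rightarrow> 'a \<Rightarrow> 'a) \<Rightarrow> 'a set \<Rightarrow> 'a \<Rightarrow> 'a set" where
  "slice2 tens S b = {b'. tens b' b \<in> S}"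

definition unitary_on :: "'a set \<Rightarrow> ('a \<Rightarrow> 'a \<Rightarrow> complex) \<Rightarrow> bool" where
  "unitary_on S \<alpha> \<longleftrightarrow>
     (\<forall>e\<in>S. \<forall>e'\<in>S. (\<Sum>f\<in>S. \<alpha> e f * cnj (\<alpha> e' f)) = (if e = e' then 1 else 0)) \<and>
     (\<forall>e\<in>S. \<forall>e'\<in>S. (\<Sum>f\<in>S. cnj (\<alpha> f e) * \<alpha> f e') = (if e = e' then 1 else 0))"

text \<open>Every set satisfying \<open>ONB\<close> or \<open>ONBe\<close> is finite, so no rule asks for finiteness.\<close>

inductive ONB :: "qty \<Rightarrow> bval set \<Rightarrow> bool" where
  ONB_var: "ONB Q {BVar x}"
| ONB_unit: "ONB QUnit {BUnit}"
| ONB_sum: "\<lbrakk>ONB Q1 S; ONB Q2 T\<rbrakk> \<Longrightarrow> ONB (QSum Q1 Q2) (BInl ` S \<union> BInr ` T)"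
| ONB_nat: "ONB QNat S \<Longrightarrow> ONB QNat ({BZero} \<union> BSuc ` S)"
| ONB_tens2:
    "\<lbrakk>\<forall>s\<in>S. \<exists>b b'. s = BTens b b'; ONB Q2 (pi2 BTens S);
      \<forall>b\<in>pi2 BTens S. ONB Q1 (slice2 BTens S b)\<rbrakk> \<Longrightarrow> ONB (QTens Q1 Q2) S"
| ONB_tens1:
    "\<lbrakk>\<forall>s\<in>S. \<exists>b b'. s = BTens b b'; ONB Q1 (pi1 BTens S);
      \<forall>b\<in>pi1 BTens S. ONB Q2 (slice1 BTens S b)\<rbrakk> \<Longrightarrow> ONB (QTens Q1 Q2) S"

text \<open>In the last rule \<open>enum e\<close> lists the index set \<open>S\<close> of the sum attached to \<open>e\<close>; each of these
  sums may be written in its own order.\<close>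

inductive ONBe :: "qty \<Rightarrow> expr set \<Rightarrow> bool" where
  ONBe_var: "ONBe Q {EVar x}"
| ONBe_unit: "ONBe QUnit {EUnit}"
| ONBe_sum: "\<lbrakk>ONBe Q1 S; ONBe Q2 T\<rbrakk> \<Longrightarrow> ONBe (QSum Q1 Q2) (EInl ` S \<union> EInr ` T)"
| ONBe_nat: "ONBe QNat S \<Longrightarrow> ONBe QNat ({EZero} \<union> ESuc ` S)"
| ONBe_tens2:
    "\<lbrakk>\<forall>s\<in>S. \<exists>e e'. s = ETens e e'; ONBe Q2 (pi2 ETens S);
      \<forall>e\<in>pi2 ETens S. ONBe Q1 (slice2 ETens S e)\<rbrakk> \<Longrightarrow> ONBe (QTens Q1 Q2) S"
| ONBe_tens1:
    "\<lbrakk>\<forall>s\<in>S. \<exists>e e'. s = ETens e e'; ONBe Q1 (pi1 ETens S);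
      \<forall>e\<in>pi1 ETens S. ONBe Q2 (slice1 ETens S e)\<rbrakk> \<Longrightarrow> ONBe (QTens Q1 Q2) S"
| ONBe_unitary:
    "\<lbrakk>ONBe Q S; unitary_on S \<alpha>; \<forall>e\<in>S. distinct (enum e) \<and> set (enum e) = S\<rbrakk>
     \<Longrightarrow> ONBe Q ((\<lambda>e. ESum (map (\<lambda>e'. (\<alpha> e e', e')) (enum e))) ` S)"


section \<open>Typing\<close>

text \<open>A context assigns at most one type to a variable, and contexts are joined only when they share
  no variable. The typing rules produce only contexts with finite domain.\<close>

type_synonym ctx = "var \<rightharpoonup> qty"

inductive wt :: "ctx \<Rightarrow> trm \<Rightarrow> qty \<Rightarrow> bool"
  and wtu :: "uni \<Rightarrow> qty \<Rightarrow> qty \<Rightarrow> bool" where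
  wt_unit: "wt Map.empty TUnit QUnit"
| wt_var: "wt [x \<mapsto> Q] (TVar x) Q"
| wt_tens:
    "\<lbrakk>wt \<Gamma>1 t1 Q1; wt \<Gamma>2 t2 Q2; dom \<Gamma>1 \<inter> dom \<Gamma>2 = {}\<rbrakk>
     \<Longrightarrow> wt (\<Gamma>1 ++ \<Gamma>2) (TTens t1 t2) (QTens Q1 Q2)"
| wt_inl: "wt \<Gamma> t Q1 \<Longrightarrow> wt \<Gamma> (TInl t) (QSum Q1 Q2)"
| wt_inr: "wt \<Gamma> t Q2 \<Longrightarrow> wt \<Gamma> (TInr t) (QSum Q1 Q2)"
| wt_zero: "wt Map.empty TZero QNat"
| wt_suc: "wt \<Gamma> t QNat \<Longrightarrow> wt \<Gamma> (TSuc t) QNat"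
| wt_sum:
    "\<lbrakk>\<forall>p\<in>set ps. wt \<Gamma> (snd p) Q; (\<Sum>p\<leftarrow>ps. (cmod (fst p))\<^sup>2) = 1;
      \<forall>i<length ps. \<forall>j<length ps. i \<noteq> j \<longrightarrow> orth (snd (ps ! i)) (snd (ps ! j))\<rbrakk>
     \<Longrightarrow> wt \<Gamma> (TSum ps) Q"
| wt_app: "\<lbrakk>wtu u Q1 Q2; wt \<Gamma> t Q1\<rbrakk> \<Longrightarrow> wt \<Gamma> (TApp u t) Q2"
| wtu_clauses:
    "\<lbrakk>\<forall>c\<in>set cs. \<exists>\<Gamma>. wt \<Gamma> (trm_of_bval (fst c)) Q1 \<and> wt \<Gamma> (trm_of_expr (snd c)) Q2;
      distinct (map fst cs); distinct (map snd cs);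
      ONB Q1 (set (map fst cs)); ONBe Q2 (set (map snd cs))\<rbrakk>
     \<Longrightarrow> wtu (Clauses cs) Q1 Q2"
| wtu_star: "wtu u Q1 Q2 \<Longrightarrow> wtu (UStar u) Q2 Q1"
| wtu_comp: "\<lbrakk>wtu u1 Q1 Q2; wtu u2 Q2 Q3\<rbrakk> \<Longrightarrow> wtu (UComp u2 u1) Q1 Q3"
| wtu_tens:
    "\<lbrakk>wtu u1 Q1 Q2; wtu u2 Q3 Q4\<rbrakk> \<Longrightarrow> wtu (UTens u1 u2) (QTens Q1 Q3) (QTens Q2 Q4)"
| wtu_plus:
    "\<lbrakk>wtu u1 Q1 Q2; wtu u2 Q3 Q4\<rbrakk> \<Longrightarrow> wtu (UPlus u1 u2) (QSum Q1 Q3) (QSum Q2 Q4)"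
| wtu_ctrl: "wtu u Q Q \<Longrightarrow> wtu (UCtrl u) (QTens qbit Q) (QTens qbit Q)"


section \<open>Matching and substitution\<close>

type_synonym valuation = "var \<rightharpoonup> expr"

primrec subst :: "valuation \<Rightarrow> trm \<Rightarrow> trm" where
  "subst \<sigma> TUnit = TUnit"
| "subst \<sigma> (TVar x) = (case \<sigma> x of None \<Rightarrow> TVar x | Some e \<Rightarrow> trm_of_expr e)"
| "subst \<sigma> (TInl t) = TInl (subst \<sigma> t)"
| "subst \<sigma> (TInr t) = TInr (subst \<sigma> t)"
| "subst \<sigma> (TTens t t') = TTens (subst \<sigma> t) (subst \<sigma> t')"
| "subst \<sigma> TZero = TZero"
| "subst \<sigma> (TSuc t) = TSuc (subst \<sigma> t)"
| "subst \<sigma> (TApp u t) = TApp u (subst \<sigma> t)"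
| "subst \<sigma> (TSum ps) = TSum (map (map_prod id (subst \<sigma>)) ps)"

inductive matches :: "valuation \<Rightarrow> bval \<Rightarrow> bval \<Rightarrow> bool" where
  matches_unit: "matches Map.empty BUnit BUnit"
| matches_var: "matches [x \<mapsto> expr_of_bval b'] (BVar x) b'"
| matches_zero: "matches Map.empty BZero BZero"
| matches_inl: "matches \<sigma> b b' \<Longrightarrow> matches \<sigma> (BInl b) (BInl b')"
| matches_inr: "matches \<sigma> b b' \<Longrightarrow> matches \<sigma> (BInr b) (BInr b')"
| matches_suc: "matches \<sigma> b b' \<Longrightarrow> matches \<sigma> (BSuc b) (BSuc b')"
| matches_tens:
    "\<lbrakk>matches \<sigma>1 b1 b1'; matches \<sigma>2 b2 b2'; dom \<sigma>1 \<inter> dom \<sigma>2 = {}\<rbrakk>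
     \<Longrightarrow> matches (\<sigma>1 ++ \<sigma>2) (BTens b1 b2) (BTens b1' b2')"


section \<open>Equational theory\<close>

definition lin_contexts :: "(trm \<Rightarrow> trm) set" where
  "lin_contexts =
     range TApp \<union> {TInl, TInr, TSuc} \<union> range TTens \<union> range (\<lambda>t s. TTens s t)"

inductive teq :: "bval rel \<Rightarrow> ctx \<Rightarrow> trm \<Rightarrow> trm \<Rightarrow> qty \<Rightarrow> bool" for ord :: "bval rel" where
  teq_refl: "wt \<Gamma> t Q \<Longrightarrow> teq ord \<Gamma> t t Q"
| teq_sym: "teq ord \<Gamma> t1 t2 Q \<Longrightarrow> teq ord \<Gamma> t2 t1 Q"
| teq_trans: "\<lbrakk>teq ord \<Gamma> t1 t2 Q; teq ord \<Gamma> t2 t3 Q\<rbrakk> \<Longrightarrow> teq ord \<Gamma> t1 t3 Q"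

\<comment> \<open>Linear algebra\<close>
| teq_perm:
    "\<lbrakk>wt \<Gamma> (TSum ps) Q; l permutes {..<length ps}\<rbrakk>
     \<Longrightarrow> teq ord \<Gamma> (TSum ps) (TSum (permute_list l ps)) Q"
| teq_drop_null:
    "wt \<Gamma> (TSum (ps @ [(0, t)])) Q \<Longrightarrow> teq ord \<Gamma> (TSum (ps @ [(0, t)])) (TSum ps) Q"
| teq_single: "wt \<Gamma> t Q \<Longrightarrow> teq ord \<Gamma> (TSum [(1, t)]) t Q"
| teq_sum_sum_shared:
    "wt \<Gamma> (TSum (map (\<lambda>i. (\<alpha> i, TSum (map (\<lambda>j. (\<beta> i j, t j)) [0..<m]))) [0..<n])) Q
     \<Longrightarrow> teq ord \<Gamma> (TSum (map (\<lambda>i. (\<alpha> i, TSum (map (\<lambda>j. (\<beta> i j, t j)) [0..<m]))) [0..<n]))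
                    (TSum (map (\<lambda>j. (\<Sum>i<n. \<alpha> i * \<beta> i j, t j)) [0..<m])) Q"
| teq_sum_sum_flat:
    "\<lbrakk>wt \<Gamma> (TSum (map (\<lambda>i. (\<alpha> i, TSum (map (\<lambda>j. (\<beta> i j, t i j)) [0..<m]))) [0..<n])) Q;
      wt \<Gamma> (TSum (concat (map (\<lambda>i. map (\<lambda>j. (\<alpha> i * \<beta> i j, t i j)) [0..<m]) [0..<n]))) Q\<rbrakk>
     \<Longrightarrow> teq ord \<Gamma> (TSum (map (\<lambda>i. (\<alpha> i, TSum (map (\<lambda>j. (\<beta> i j, t i j)) [0..<m]))) [0..<n]))
                    (TSum (concat (map (\<lambda>i. map (\<lambda>j. (\<alpha> i * \<beta> i j, t i j)) [0..<m]) [0..<n]))) Q"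
| teq_linear:
    "\<lbrakk>C \<in> lin_contexts; wt \<Gamma> (C (TSum ps)) Q\<rbrakk>
     \<Longrightarrow> teq ord \<Gamma> (C (TSum ps)) (TSum (map (map_prod id C) ps)) Q"

\<comment> \<open>Congruence\<close>
| teq_cong_app:
    "\<lbrakk>wtu u Q1 Q2; teq ord \<Gamma> t1 t2 Q1\<rbrakk> \<Longrightarrow> teq ord \<Gamma> (TApp u t1) (TApp u t2) Q2"
| teq_cong_inl: "teq ord \<Gamma> t1 t2 Q1 \<Longrightarrow> teq ord \<Gamma> (TInl t1) (TInl t2) (QSum Q1 Q2)"
| teq_cong_inr: "teq ord \<Gamma> t1 t2 Q2 \<Longrightarrow> teq ord \<Gamma> (TInr t1) (TInr t2) (QSum Q1 Q2)"
| teq_cong_suc: "teq ord \<Gamma> t1 t2 QNat \<Longrightarrow> teq ord \<Gamma> (TSuc t1) (TSuc t2) QNat"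
| teq_cong_tens_right:
    "\<lbrakk>wt \<Gamma>1 t Q1; teq ord \<Gamma>2 t1 t2 Q2; dom \<Gamma>1 \<inter> dom \<Gamma>2 = {}\<rbrakk>
     \<Longrightarrow> teq ord (\<Gamma>1 ++ \<Gamma>2) (TTens t t1) (TTens t t2) (QTens Q1 Q2)"
| teq_cong_tens_left:
    "\<lbrakk>teq ord \<Gamma>1 t1 t2 Q1; wt \<Gamma>2 t Q2; dom \<Gamma>1 \<inter> dom \<Gamma>2 = {}\<rbrakk>
     \<Longrightarrow> teq ord (\<Gamma>1 ++ \<Gamma>2) (TTens t1 t) (TTens t2 t) (QTens Q1 Q2)"
| teq_cong_sum:
    "\<lbrakk>wt \<Gamma> (TSum (map (\<lambda>i. (\<alpha> i, t i)) [0..<n])) Q; \<forall>i<n. teq ord \<Gamma> (t i) (t' i) Q\<rbrakk>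
     \<Longrightarrow> teq ord \<Gamma> (TSum (map (\<lambda>i. (\<alpha> i, t i)) [0..<n])) (TSum (map (\<lambda>i. (\<alpha> i, t' i)) [0..<n])) Q"

\<comment> \<open>Computation\<close>
| teq_clauses:
    "\<lbrakk>wtu (Clauses cs) Q1 Q2; wt Map.empty (trm_of_bval b') Q1; (b, e) \<in> set cs; matches \<sigma> b b'\<rbrakk>
     \<Longrightarrow> teq ord Map.empty (TApp (Clauses cs) (trm_of_bval b')) (subst \<sigma> (trm_of_expr e)) Q2"
| teq_star:
    "\<lbrakk>wtu u Q1 Q2; wt Map.empty (trm_of_bval b) Q1; is_value ord v; wt Map.empty v Q2;
      teq ord Map.empty (TApp u (trm_of_bval b)) v Q2\<rbrakk>
     \<Longrightarrow> teq ord Map.empty (TApp (UStar u) v) (trm_of_bval b) Q1"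
| teq_comp:
    "\<lbrakk>wtu u1 Q1 Q2; wtu u2 Q2 Q3; wt \<Gamma> (trm_of_bval b) Q1\<rbrakk>
     \<Longrightarrow> teq ord \<Gamma> (TApp (UComp u2 u1) (trm_of_bval b)) (TApp u2 (TApp u1 (trm_of_bval b))) Q3"
| teq_tens:
    "\<lbrakk>wtu u1 Q1 Q2; wtu u2 Q3 Q4; wt Map.empty (trm_of_bval b1) Q1; wt Map.empty (trm_of_bval b2) Q3\<rbrakk>
     \<Longrightarrow> teq ord Map.empty (TApp (UTens u1 u2) (TTens (trm_of_bval b1) (trm_of_bval b2)))
                    (TTens (TApp u1 (trm_of_bval b1)) (TApp u2 (trm_of_bval b2))) (QTens Q2 Q4)"
| teq_plus_inl:
    "\<lbrakk>wtu u1 Q1 Q2; wtu u2 Q3 Q4; wt Map.empty (trm_of_bval b) Q1\<rbrakk>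
     \<Longrightarrow> teq ord Map.empty (TApp (UPlus u1 u2) (TInl (trm_of_bval b)))
                    (TInl (TApp u1 (trm_of_bval b))) (QSum Q2 Q4)"
| teq_plus_inr:
    "\<lbrakk>wtu u1 Q1 Q2; wtu u2 Q3 Q4; wt Map.empty (trm_of_bval b) Q3\<rbrakk>
     \<Longrightarrow> teq ord Map.empty (TApp (UPlus u1 u2) (TInr (trm_of_bval b)))
                    (TInr (TApp u2 (trm_of_bval b))) (QSum Q2 Q4)"
| teq_ctrl_inl:
    "\<lbrakk>wtu u Q Q; wt Map.empty (trm_of_bval b) Q\<rbrakk>
     \<Longrightarrow> teq ord Map.empty (TApp (UCtrl u) (TTens (TInl TUnit) (trm_of_bval b)))
                    (TTens (TInl TUnit) (trm_of_bval b)) (QTens qbit Q)"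
| teq_ctrl_inr:
    "\<lbrakk>wtu u Q Q; wt Map.empty (trm_of_bval b) Q\<rbrakk>
     \<Longrightarrow> teq ord Map.empty (TApp (UCtrl u) (TTens (TInr TUnit) (trm_of_bval b)))
                    (TTens (TInr TUnit) (TApp u (trm_of_bval b))) (QTens qbit Q)"

end

theory Submission
  imports Defs "HOL-Library.Groups_Big_Fun"
begin

text \<open>Interpret a closed term as a finitely supported complex vector indexed by basis values, and a
  unitary by the matrix of its action on basis values. The syntactic orthogonality relation is sound
  for this interpretation, so well-typed terms denote unit vectors, and orthonormal bases of
  expressions denote orthonormal families spanning all finitely supported vectors; hence unitaries
  denote matrices with finitely supported, orthonormal rows and columns. The equational theory
  rewrites each term to the formal sum of basis values given by its vector: the sums that arise on
  the way are well formed because orthogonal combinations of distinct basis values are also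
  syntactically orthogonal. For \<open>u\<^sup>*\<close>, a basis value is first expanded along the columns of \<open>u\<close>,
  which are sent back to basis values by the rule for \<open>u\<^sup>*\<close>.\<close>

section \<open>Vectors over basis values\<close>

text \<open>The obstacle to evaluating a term step by step is typing. Each sum on the way must have
  pairwise syntactically orthogonal summands, and the rules of that relation follow the shape of
  terms and say nothing about the results of evaluation. Vectors bridge the gap: a vanishing inner
  product turns back into a derivation once both sides are spelled out over basis values. Three
  difficulties shape the statements. Clauses contain variables, so inner products are compared under
  two independent environments. An injection does not record the type of the other summand, so types
  are not unique, and matrices have to reflect types as well as preserve them. \<open>QNat\<close>
  is infinite-dimensional, and there orthonormal columns do not force orthonormal rows; this is why
  spanning is shown with finite combinations and why the adjoint is carried along in the induction
  on unitaries. Terms and unitaries depend on each other, but the right-hand sides of clauses apply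
  no unitary. Expressions can therefore be treated before unitaries, and unitaries before general
  terms.\<close>

type_synonym vec = "bval \<Rightarrow> complex"

definition supp :: "vec \<Rightarrow> bval set" where
  "supp f = {b. f b \<noteq> 0}"

definition ket :: "bval \<Rightarrow> vec" where
  "ket b = (\<lambda>c. if c = b then 1 else 0)"

definition inlv :: "vec \<Rightarrow> vec" where
  "inlv f = (\<lambda>b. case b of BInl c \<Rightarrow> f c | _ \<Rightarrow> 0)"

definition inrv :: "vec \<Rightarrow> vec" where
  "inrv f = (\<lambda>b. case b of BInr c \<Rightarrow> f c | _ \<Rightarrow> 0)"

definition sucv :: "vec \<Rightarrow> vec" where
  "sucv f = (\<lambda>b. case b of BSuc c \<Rightarrow> f c | _ \<Rightarrow> 0)"

definition tensv :: "vec \<Rightarrow> vec \<Rightarrow> vec" where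
  "tensv f g = (\<lambda>b. case b of BTens c d \<Rightarrow> f c * g d | _ \<Rightarrow> 0)"

text \<open>\<^const>\<open>Sum_any\<close> is \<open>0\<close> on a family of infinite support; on well-typed arguments all supports
  below are finite.\<close>

definition appv :: "(bval \<Rightarrow> vec) \<Rightarrow> vec \<Rightarrow> vec" where
  "appv M f = (\<lambda>c. Sum_any (\<lambda>b. f b * M b c))"

definition innr :: "vec \<Rightarrow> vec \<Rightarrow> complex" where
  "innr f g = Sum_any (\<lambda>b. cnj (f b) * g b)"

definition adj :: "(bval \<Rightarrow> vec) \<Rightarrow> bval \<Rightarrow> vec" where
  "adj M = (\<lambda>b c. cnj (M c b))"

lemma constructor_vectors_simps [simp]:
  "inlv f (BInl b) = f b" "inlv f (BInr b) = 0" "inlv f BUnit = 0" "inlv f (BVar x) = 0"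
  "inlv f (BTens b c) = 0" "inlv f BZero = 0" "inlv f (BSuc b) = 0"
  "inrv f (BInr b) = f b" "inrv f (BInl b) = 0" "inrv f BUnit = 0" "inrv f (BVar x) = 0"
  "inrv f (BTens b c) = 0" "inrv f BZero = 0" "inrv f (BSuc b) = 0"
  "sucv f (BSuc b) = f b" "sucv f (BInl b) = 0" "sucv f (BInr b) = 0" "sucv f BUnit = 0"
  "sucv f (BVar x) = 0" "sucv f (BTens b c) = 0" "sucv f BZero = 0"
  "tensv f g (BTens b c) = f b * g c" "tensv f g (BInl b) = 0" "tensv f g (BInr b) = 0"
  "tensv f g BUnit = 0" "tensv f g (BVar x) = 0" "tensv f g BZero = 0" "tensv f g (BSuc b) = 0"
  by (simp_all add: inlv_def inrv_def sucv_def tensv_def)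

lemma supp_ket [simp]: "supp (ket b) = {b}"
  by (auto simp: supp_def ket_def)

lemma supp_inlv [simp]: "supp (inlv f) = BInl ` supp f"
proof -
  have "b \<in> supp (inlv f) \<longleftrightarrow> b \<in> BInl ` supp f" for b
    by (cases b) (auto simp: supp_def)
  then show ?thesis by blast
qed

lemma supp_inrv [simp]: "supp (inrv f) = BInr ` supp f"
proof -
  have "b \<in> supp (inrv f) \<longleftrightarrow> b \<in> BInr ` supp f" for b
    by (cases b) (auto simp: supp_def)
  then show ?thesis by blast
qed

lemma supp_sucv [simp]: "supp (sucv f) = BSuc ` supp f"
proof -
  have "b \<in> supp (sucv f) \<longleftrightarrow> b \<in> BSuc ` supp f" for b
    by (cases b) (auto simp: supp_def)
  then show ?thesis by blast
qed

lemma supp_tensv [simp]: "supp (tensv f g) = (\<lambda>(c, d). BTens c d) ` (supp f \<times> supp g)"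
proof -
  have "b \<in> supp (tensv f g) \<longleftrightarrow> b \<in> (\<lambda>(c, d). BTens c d) ` (supp f \<times> supp g)" for b
    by (cases b) (auto simp: supp_def)
  then show ?thesis by blast
qed

lemma ket_constructor:
  "inlv (ket b) = ket (BInl b)" "inrv (ket b) = ket (BInr b)" "sucv (ket b) = ket (BSuc b)"
  "tensv (ket b) (ket c) = ket (BTens b c)"
proof -
  have "inlv (ket b) d = ket (BInl b) d" "inrv (ket b) d = ket (BInr b) d"
    "sucv (ket b) d = ket (BSuc b) d" "tensv (ket b) (ket c) d = ket (BTens b c) d" for d
    by (cases d; auto simp: ket_def)+
  then show "inlv (ket b) = ket (BInl b)" "inrv (ket b) = ket (BInr b)"
    "sucv (ket b) = ket (BSuc b)" "tensv (ket b) (ket c) = ket (BTens b c)"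
    by blast+
qed

lemma not_in_supp: "b \<notin> supp f \<longleftrightarrow> f b = 0"
  by (simp add: supp_def)

section \<open>Inner products of finitely supported vectors\<close>

lemma Sum_any_superset:
  assumes "finite A" "\<And>b. b \<notin> A \<Longrightarrow> g b = 0"
  shows "Sum_any g = sum g A"
  using assms by (intro Sum_any.expand_superset) auto

lemma innr_left:
  assumes "finite A" "supp f \<subseteq> A"
  shows "innr f g = (\<Sum>b\<in>A. cnj (f b) * g b)"
  unfolding innr_def using assms by (intro Sum_any_superset) (auto simp: supp_def)

lemma innr_right:
  assumes "finite A" "supp g \<subseteq> A"
  shows "innr f g = (\<Sum>b\<in>A. cnj (f b) * g b)"
  unfolding innr_def using assms by (intro Sum_any_superset) (auto simp: supp_def)

lemma appv_eq:
  assumes "finite A" "supp f \<subseteq> A"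
  shows "appv M f c = (\<Sum>b\<in>A. f b * M b c)"
  unfolding appv_def using assms by (intro Sum_any_superset) (auto simp: supp_def)

text \<open>No finiteness is required: the summands of both sides are nonzero at the same basis
  values, so the default value 0 of an infinite sum occurs on both sides or on neither.\<close>

lemma innr_commute: "innr g f = cnj (innr f g)"
proof -
  have s: "{b. cnj (f b) * g b \<noteq> 0} = {b. cnj (g b) * f b \<noteq> 0}"
    by auto
  show ?thesis
    unfolding innr_def Sum_any.expand_set s
    by (auto intro!: sum.cong simp: mult.commute)
qed

lemma innr_disjoint: "supp f \<inter> supp g = {} \<Longrightarrow> innr f g = 0"
proof -
  assume "supp f \<inter> supp g = {}"
  then have "(\<lambda>b. cnj (f b) * g b) = (\<lambda>_. 0)" by (fastforce simp: supp_def fun_eq_iff)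
  then show ?thesis unfolding innr_def by (simp only: Sum_any.neutral)
qed

lemma innr_ket: "innr (ket b) (ket c) = (if b = c then 1 else 0)"
  by (subst innr_left[of "{b}"]) (simp_all, simp add: ket_def)

lemma innr_ket_right: "innr f (ket c) = cnj (f c)"
  by (subst innr_right[of "{c}"]) (simp_all, simp add: ket_def)

lemma innr_inlv: "innr (inlv f) (inlv g) = innr f g" if "finite (supp f)"
proof -
  have "innr (inlv f) (inlv g) = (\<Sum>b\<in>BInl ` supp f. cnj (inlv f b) * inlv g b)"
    using that by (intro innr_left) auto
  also have "\<dots> = (\<Sum>b\<in>supp f. cnj (f b) * g b)"
    by (subst sum.reindex) (auto simp: inj_on_def)
  finally show ?thesis using innr_left[OF that subset_refl] by simp
qed

lemma innr_inrv: "innr (inrv f) (inrv g) = innr f g" if "finite (supp f)"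
proof -
  have "innr (inrv f) (inrv g) = (\<Sum>b\<in>BInr ` supp f. cnj (inrv f b) * inrv g b)"
    using that by (intro innr_left) auto
  also have "\<dots> = (\<Sum>b\<in>supp f. cnj (f b) * g b)"
    by (subst sum.reindex) (auto simp: inj_on_def)
  finally show ?thesis using innr_left[OF that subset_refl] by simp
qed

lemma innr_sucv: "innr (sucv f) (sucv g) = innr f g" if "finite (supp f)"
proof -
  have "innr (sucv f) (sucv g) = (\<Sum>b\<in>BSuc ` supp f. cnj (sucv f b) * sucv g b)"
    using that by (intro innr_left) auto
  also have "\<dots> = (\<Sum>b\<in>supp f. cnj (f b) * g b)"
    by (subst sum.reindex) (auto simp: inj_on_def)
  finally show ?thesis using innr_left[OF that subset_refl] by simp
qed

lemma innr_tensv: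
  assumes "finite (supp f)" "finite (supp g)"
  shows "innr (tensv f g) (tensv f' g') = innr f f' * innr g g'"
proof -
  have "innr (tensv f g) (tensv f' g') =
      (\<Sum>b\<in>(\<lambda>(c, d). BTens c d) ` (supp f \<times> supp g). cnj (tensv f g b) * tensv f' g' b)"
    using assms by (intro innr_left) auto
  also have "\<dots> = (\<Sum>(c, d)\<in>supp f \<times> supp g. (cnj (f c) * f' c) * (cnj (g d) * g' d))"
    by (subst sum.reindex) (auto simp: inj_on_def intro!: sum.cong)
  also have "\<dots> = (\<Sum>c\<in>supp f. cnj (f c) * f' c) * (\<Sum>d\<in>supp g. cnj (g d) * g' d)"
    by (simp add: sum_product sum.cartesian_product)
  finally show ?thesis
    using innr_left[OF assms(1) subset_refl] innr_left[OF assms(2) subset_refl] by simp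
qed

lemma supp_sum:
  "supp (\<lambda>b. \<Sum>i\<in>I. a i * f i b) \<subseteq> (\<Union>i\<in>I. supp (f i))"
proof
  fix b assume "b \<in> supp (\<lambda>b. \<Sum>i\<in>I. a i * f i b)"
  then have "(\<Sum>i\<in>I. a i * f i b) \<noteq> 0" by (simp add: supp_def)
  then obtain i where "i \<in> I" "a i * f i b \<noteq> 0" by (meson sum.neutral)
  then show "b \<in> (\<Union>i\<in>I. supp (f i))" by (auto simp: supp_def)
qed

lemma finite_supp_sum:
  "finite I \<Longrightarrow> (\<And>i. i \<in> I \<Longrightarrow> finite (supp (f i))) \<Longrightarrow>
    finite (supp (\<lambda>b. \<Sum>i\<in>I. a i * f i b))"
  by (rule finite_subset[OF supp_sum]) blast

lemma innr_sum_right: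
  assumes "finite J" "\<And>j. j \<in> J \<Longrightarrow> finite (supp (g j))"
  shows "innr f (\<lambda>b. \<Sum>j\<in>J. c j * g j b) = (\<Sum>j\<in>J. c j * innr f (g j))"
proof -
  let ?A = "\<Union>j\<in>J. supp (g j)"
  have A: "finite ?A" using assms by blast
  have "innr f (\<lambda>b. \<Sum>j\<in>J. c j * g j b) = (\<Sum>b\<in>?A. cnj (f b) * (\<Sum>j\<in>J. c j * g j b))"
    by (rule innr_right[OF A supp_sum])
  also have "\<dots> = (\<Sum>j\<in>J. c j * (\<Sum>b\<in>?A. cnj (f b) * g j b))"
    unfolding sum_distrib_left by (subst sum.swap) (simp add: mult_ac)
  also have "\<dots> = (\<Sum>j\<in>J. c j * innr f (g j))"
  proof (rule sum.cong[OF refl])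
    fix j assume "j \<in> J"
    then show "c j * (\<Sum>b\<in>?A. cnj (f b) * g j b) = c j * innr f (g j)"
      by (subst innr_right[OF A, of "g j"]) auto
  qed
  finally show ?thesis .
qed

lemma innr_sum_left:
  assumes "finite I" "\<And>i. i \<in> I \<Longrightarrow> finite (supp (f i))"
  shows "innr (\<lambda>b. \<Sum>i\<in>I. a i * f i b) g = (\<Sum>i\<in>I. cnj (a i) * innr (f i) g)"
  unfolding innr_commute[of _ g] by (subst innr_sum_right[OF assms]) (auto simp: innr_commute[of g])

lemma innr_sum_sum:
  assumes "finite I" "\<And>i. i \<in> I \<Longrightarrow> finite (supp (f i))"
    "finite J" "\<And>j. j \<in> J \<Longrightarrow> finite (supp (g j))"
  shows "innr (\<lambda>b. \<Sum>i\<in>I. a i * f i b) (\<lambda>b. \<Sum>j\<in>J. c j * g j b) =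
    (\<Sum>i\<in>I. \<Sum>j\<in>J. cnj (a i) * c j * innr (f i) (g j))"
proof -
  have "innr (\<lambda>b. \<Sum>i\<in>I. a i * f i b) (\<lambda>b. \<Sum>j\<in>J. c j * g j b) =
      (\<Sum>i\<in>I. cnj (a i) * innr (f i) (\<lambda>b. \<Sum>j\<in>J. c j * g j b))"
    by (rule innr_sum_left[OF assms(1,2)])
  also have "\<dots> = (\<Sum>i\<in>I. cnj (a i) * (\<Sum>j\<in>J. c j * innr (f i) (g j)))"
    by (simp add: innr_sum_right[OF assms(3,4)])
  finally show ?thesis by (simp add: sum_distrib_left mult.assoc)
qed

lemma supp_appv: "c \<in> supp (appv M f) \<Longrightarrow> \<exists>b. f b \<noteq> 0 \<and> M b c \<noteq> 0"
proof (rule ccontr)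
  assume "c \<in> supp (appv M f)" "\<nexists>b. f b \<noteq> 0 \<and> M b c \<noteq> 0"
  then have "(\<lambda>b. f b * M b c) = (\<lambda>_. 0)" by auto
  then have "appv M f c = 0" unfolding appv_def by (simp only: Sum_any.neutral)
  with \<open>c \<in> supp (appv M f)\<close> show False by (simp add: supp_def)
qed

lemma finite_supp_appv:
  assumes "finite (supp f)" "\<And>b. b \<in> supp f \<Longrightarrow> finite (supp (M b))"
  shows "finite (supp (appv M f))"
proof -
  have "supp (appv M f) \<subseteq> (\<Union>b\<in>supp f. supp (M b))"
    by (fastforce dest: supp_appv simp: not_in_supp[symmetric])
  then show ?thesis using assms finite_subset by blast
qed

section \<open>Finite linear combinations\<close>

inductive_set lspan :: "vec set \<Rightarrow> vec set" for V where
  lspan_zero: "(\<lambda>_. 0) \<in> lspan V"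
| lspan_add: "f \<in> lspan V \<Longrightarrow> v \<in> V \<Longrightarrow> (\<lambda>b. f b + c * v b) \<in> lspan V"

lemma lspan_base: "v \<in> V \<Longrightarrow> v \<in> lspan V"
  using lspan_add[OF lspan_zero, of v V 1] by simp

lemma lspan_plus:
  assumes "f \<in> lspan V" "g \<in> lspan V"
  shows "(\<lambda>b. f b + c * g b) \<in> lspan V"
  using assms(2)
proof induction
  case lspan_zero
  then show ?case using assms(1) by simp
next
  case (lspan_add g v d)
  from lspan.lspan_add[OF lspan_add(3,2), of "c * d"] show ?case
    by (simp add: algebra_simps)
qed

lemma lspan_sum:
  assumes "finite I" "\<And>i. i \<in> I \<Longrightarrow> f i \<in> lspan V"
  shows "(\<lambda>b. \<Sum>i\<in>I. c i * f i b) \<in> lspan V"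
  using assms
proof (induction I)
  case (insert i I)
  have "(\<lambda>b. (\<Sum>i\<in>I. c i * f i b) + c i * f i b) \<in> lspan V"
    using insert by (intro lspan_plus) auto
  moreover have "(\<lambda>b. \<Sum>i\<in>insert i I. c i * f i b) = (\<lambda>b. (\<Sum>i\<in>I. c i * f i b) + c i * f i b)"
    using insert.hyps by (auto simp: add.commute)
  ultimately show ?case by simp
qed (simp add: lspan_zero)

lemma lspan_trans:
  assumes "f \<in> lspan V" "\<And>v. v \<in> V \<Longrightarrow> v \<in> lspan W"
  shows "f \<in> lspan W"
  using assms(1) by induction (auto intro: lspan_zero lspan_plus assms(2))

lemma lspan_map:
  assumes "f \<in> lspan V" "\<And>f v c. h (\<lambda>b. f b + c * v b) = (\<lambda>b. h f b + c * h v b)"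
    "h (\<lambda>_. 0) = (\<lambda>_. 0)" "\<And>v. v \<in> V \<Longrightarrow> h v \<in> lspan W"
  shows "h f \<in> lspan W"
  using assms(1) by induction (auto simp: assms(2,3) intro: lspan_zero lspan_plus assms(4))

text \<open>Coefficients are wanted per basis value and not per vector, because
  \<open>isom_adj\<close> compares them with matrix entries. \<open>M\<close> may fail to be
  injective on \<open>B\<close>.\<close>

lemma lspan_image_sum:
  assumes "f \<in> lspan (M ` B)"
  shows "\<exists>A c. finite A \<and> A \<subseteq> B \<and> f = (\<lambda>x. \<Sum>b\<in>A. c b * M b x)"
  using assms
proof induction
  case lspan_zero
  show ?case by (rule exI[of _ "{}"]) auto
next
  case (lspan_add f v d)
  then obtain A c where A: "finite A" "A \<subseteq> B" "f = (\<lambda>x. \<Sum>b\<in>A. c b * M b x)" by blast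
  from lspan_add obtain b0 where b0: "b0 \<in> B" "v = M b0" by blast
  \<comment> \<open>If \<open>b0\<close> already lies in \<open>A\<close>, its old and new
    coefficients are added; otherwise the first summand is 0 there.\<close>
  let ?c = "\<lambda>b. (if b \<in> A then c b else 0) + (if b = b0 then d else 0)"
  have "(\<Sum>b\<in>insert b0 A. ?c b * M b x) = f x + d * v x" for x
  proof -
    have "(\<Sum>b\<in>insert b0 A. ?c b * M b x) =
        (\<Sum>b\<in>insert b0 A. if b \<in> A then c b * M b x else 0) +
        (\<Sum>b\<in>insert b0 A. if b = b0 then d * M b x else 0)"
      unfolding sum.distrib[symmetric] by (intro sum.cong) (auto simp: algebra_simps)
    moreover have "(\<Sum>b\<in>insert b0 A. if b = b0 then d * M b x else 0) = d * v x"
      using A b0 by (subst sum.delta) auto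
    moreover have "(\<Sum>b\<in>insert b0 A. if b \<in> A then c b * M b x else 0) = f x"
    proof -
      have "(\<Sum>b\<in>insert b0 A. if b \<in> A then c b * M b x else 0) = (\<Sum>b\<in>A. c b * M b x)"
        using A by (intro sum.mono_neutral_cong_right) auto
      then show ?thesis using A by simp
    qed
    ultimately show ?thesis by simp
  qed
  then have "(\<lambda>x. f x + d * v x) = (\<lambda>x. \<Sum>b\<in>insert b0 A. ?c b * M b x)" by simp
  then show ?case using A b0 by (intro exI[of _ "insert b0 A"] exI[of _ ?c]) auto
qed

text \<open>Cutting a vector down to \<open>A\<close> is linear, and each generator is either kept
  or sent to zero. This removes from an expansion the instances of expressions under environments of
  the wrong type.\<close>

lemma lspan_restrict:
  assumes "f \<in> lspan V" "\<And>v. v \<in> V \<Longrightarrow> supp v \<subseteq> A \<or> supp v \<inter> A = {}"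
  shows "(\<lambda>b. if b \<in> A then f b else 0) \<in> lspan {v \<in> V. supp v \<subseteq> A}"
  using assms(1)
proof (rule lspan_map[where h = "\<lambda>f b. if b \<in> A then f b else 0"])
  fix v assume v: "v \<in> V"
  show "(\<lambda>b. if b \<in> A then v b else 0) \<in> lspan {v \<in> V. supp v \<subseteq> A}"
  proof (cases "supp v \<subseteq> A")
    case True
    then have "(\<lambda>b. if b \<in> A then v b else 0) = v" by (fastforce simp: supp_def)
    then show ?thesis using v True by (simp add: lspan_base)
  next
    case False
    then have "(\<lambda>b. if b \<in> A then v b else 0) = (\<lambda>_. 0)"
      using assms(2)[OF v] by (fastforce simp: supp_def fun_eq_iff)
    then show ?thesis by (simp add: lspan_zero)
  qed
qed auto

section \<open>Denotation of terms\<close>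

primrec fv :: "trm \<Rightarrow> var set" where
  "fv TUnit = {}"
| "fv (TVar x) = {x}"
| "fv (TInl t) = fv t"
| "fv (TInr t) = fv t"
| "fv (TTens t s) = fv t \<union> fv s"
| "fv TZero = {}"
| "fv (TSuc t) = fv t"
| "fv (TApp u t) = fv t"
| "fv (TSum ps) = \<Union> (snd ` set (map (map_prod id fv) ps))"

text \<open>Only the unitaries applied in the term itself are collected. There is no descent into a
  unitary, since the expressions in its clauses apply none.\<close>

primrec unis :: "trm \<Rightarrow> uni set" where
  "unis TUnit = {}"
| "unis (TVar x) = {}"
| "unis (TInl t) = unis t"
| "unis (TInr t) = unis t"
| "unis (TTens t s) = unis t \<union> unis s"
| "unis TZero = {}"
| "unis (TSuc t) = unis t"
| "unis (TApp u t) = insert u (unis t)"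
| "unis (TSum ps) = \<Union> (snd ` set (map (map_prod id unis) ps))"

primrec subterms :: "trm \<Rightarrow> trm set" where
  "subterms TUnit = {TUnit}"
| "subterms (TVar x) = {TVar x}"
| "subterms (TInl t) = insert (TInl t) (subterms t)"
| "subterms (TInr t) = insert (TInr t) (subterms t)"
| "subterms (TTens t s) = insert (TTens t s) (subterms t \<union> subterms s)"
| "subterms TZero = {TZero}"
| "subterms (TSuc t) = insert (TSuc t) (subterms t)"
| "subterms (TApp u t) = insert (TApp u t) (subterms t)"
| "subterms (TSum ps) = insert (TSum ps) (\<Union> (snd ` set (map (map_prod id subterms) ps)))"

text \<open>The interpretation \<open>M\<close> of unitaries is a parameter: the interpretation of a set of clauses is
  defined from the denotation of expressions, before that of terms is available.\<close>

primrec tsem :: "(uni \<Rightarrow> bval \<Rightarrow> vec) \<Rightarrow> trm \<Rightarrow> (var \<Rightarrow> bval) \<Rightarrow> vec" where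
  "tsem M TUnit = (\<lambda>\<sigma>. ket BUnit)"
| "tsem M (TVar x) = (\<lambda>\<sigma>. ket (\<sigma> x))"
| "tsem M (TInl t) = (\<lambda>\<sigma>. inlv (tsem M t \<sigma>))"
| "tsem M (TInr t) = (\<lambda>\<sigma>. inrv (tsem M t \<sigma>))"
| "tsem M (TTens t s) = (\<lambda>\<sigma>. tensv (tsem M t \<sigma>) (tsem M s \<sigma>))"
| "tsem M TZero = (\<lambda>\<sigma>. ket BZero)"
| "tsem M (TSuc t) = (\<lambda>\<sigma>. sucv (tsem M t \<sigma>))"
| "tsem M (TApp u t) = (\<lambda>\<sigma>. appv (M u) (tsem M t \<sigma>))"
| "tsem M (TSum ps) = (\<lambda>\<sigma> b. \<Sum>p\<leftarrow>map (map_prod id (tsem M)) ps. fst p * snd p \<sigma> b)"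

text \<open>Primitive recursion through lists of pairs forces the \<open>map_prod\<close> form of
  the defining equations; these versions take their place in the simplifier.\<close>

lemma sum_simps [simp]:
  "fv (TSum ps) = (\<Union>p\<in>set ps. fv (snd p))"
  "unis (TSum ps) = (\<Union>p\<in>set ps. unis (snd p))"
  "subterms (TSum ps) = insert (TSum ps) (\<Union>p\<in>set ps. subterms (snd p))"
  "tsem M (TSum ps) = (\<lambda>\<sigma> b. \<Sum>p\<leftarrow>ps. fst p * tsem M (snd p) \<sigma> b)"
  by (auto simp: image_image map_prod_def comp_def split_def)

declare fv.simps(9) [simp del] unis.simps(9) [simp del] subterms.simps(9) [simp del]
  tsem.simps(9) [simp del]

lemma tsem_sum_nth:
  "tsem M (TSum ps) \<sigma> = (\<lambda>b. \<Sum>i<length ps. fst (ps ! i) * tsem M (snd (ps ! i)) \<sigma> b)"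
  by (auto simp: sum_list_sum_nth atLeast0LessThan)

lemma tsem_sum_distinct:
  "distinct xs \<Longrightarrow>
    tsem M (TSum (map (\<lambda>x. (a x, t x)) xs)) \<sigma> = (\<lambda>b. \<Sum>x\<in>set xs. a x * tsem M (t x) \<sigma> b)"
  by (auto simp: comp_def sum_list_distinct_conv_sum_set)

lemma self_in_subterms [simp]: "t \<in> subterms t"
  by (cases t) auto

lemma trm_induct [case_names TUnit TVar TInl TInr TTens TZero TSuc TApp TSum]:
  assumes "P TUnit" "\<And>x. P (TVar x)" "\<And>t. P t \<Longrightarrow> P (TInl t)" "\<And>t. P t \<Longrightarrow> P (TInr t)"
    "\<And>t s. P t \<Longrightarrow> P s \<Longrightarrow> P (TTens t s)" "P TZero" "\<And>t. P t \<Longrightarrow> P (TSuc t)"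
    "\<And>u t. P t \<Longrightarrow> P (TApp u t)" "\<And>ps. (\<And>p. p \<in> set ps \<Longrightarrow> P (snd p)) \<Longrightarrow> P (TSum ps)"
  shows "P t"
proof (induction t)
  case (TSum ps)
  show ?case by (rule assms(9), rule TSum) (auto simp: snds.simps)
qed (use assms in auto)

lemma expr_induct [case_names EUnit EVar EInl EInr ETens EZero ESuc ESum]:
  assumes "P EUnit" "\<And>x. P (EVar x)" "\<And>t. P t \<Longrightarrow> P (EInl t)" "\<And>t. P t \<Longrightarrow> P (EInr t)"
    "\<And>t s. P t \<Longrightarrow> P s \<Longrightarrow> P (ETens t s)" "P EZero" "\<And>t. P t \<Longrightarrow> P (ESuc t)"
    "\<And>ps. (\<And>p. p \<in> set ps \<Longrightarrow> P (snd p)) \<Longrightarrow> P (ESum ps)"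
  shows "P t"
proof (induction t)
  case (ESum ps)
  show ?case by (rule assms(8), rule ESum) (auto simp: snds.simps)
qed (use assms in auto)

text \<open>Expressions apply no unitary, so any interpretation of unitaries serves for them.\<close>

abbreviation esem :: "expr \<Rightarrow> (var \<Rightarrow> bval) \<Rightarrow> vec" where
  "esem e \<equiv> tsem (\<lambda>_ _ _. 0) (trm_of_expr e)"

lemma unis_expr [simp]: "unis (trm_of_expr e) = {}"
  by (induction e rule: expr_induct) auto

lemma tsem_no_unis: "unis t = {} \<Longrightarrow> tsem M t = tsem M' t"
  by (induction t rule: trm_induct) (auto intro!: ext arg_cong[of _ _ sum_list])

lemma tsem_cong_fv: "(\<And>x. x \<in> fv t \<Longrightarrow> \<sigma> x = \<sigma>' x) \<Longrightarrow> tsem M t \<sigma> = tsem M t \<sigma>'"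
proof (induction t rule: trm_induct)
  case (TSum ps)
  have "tsem M (snd p) \<sigma> = tsem M (snd p) \<sigma>'" if "p \<in> set ps" for p
    by (rule TSum.IH[OF that]) (use that TSum.prems in auto)
  then show ?case by (auto intro!: ext arg_cong[of _ _ sum_list] cong: map_cong)
qed auto

lemma trm_of_bval_simps [simp]:
  "trm_of_bval BUnit = TUnit" "trm_of_bval (BVar x) = TVar x"
  "trm_of_bval (BInl b) = TInl (trm_of_bval b)" "trm_of_bval (BInr b) = TInr (trm_of_bval b)"
  "trm_of_bval (BTens b c) = TTens (trm_of_bval b) (trm_of_bval c)"
  "trm_of_bval BZero = TZero" "trm_of_bval (BSuc b) = TSuc (trm_of_bval b)"
  by (simp_all add: trm_of_bval_def)

lemma unis_bval [simp]: "unis (trm_of_bval b) = {}"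
  by (simp add: trm_of_bval_def)

primrec binst :: "(var \<Rightarrow> bval) \<Rightarrow> bval \<Rightarrow> bval" where
  "binst \<sigma> BUnit = BUnit"
| "binst \<sigma> (BVar x) = \<sigma> x"
| "binst \<sigma> (BInl b) = BInl (binst \<sigma> b)"
| "binst \<sigma> (BInr b) = BInr (binst \<sigma> b)"
| "binst \<sigma> (BTens b c) = BTens (binst \<sigma> b) (binst \<sigma> c)"
| "binst \<sigma> BZero = BZero"
| "binst \<sigma> (BSuc b) = BSuc (binst \<sigma> b)"

lemma tsem_bval: "tsem M (trm_of_bval b) \<sigma> = ket (binst \<sigma> b)"
  by (induction b) (auto simp: ket_constructor)

lemma binst_eq_iff: "binst \<sigma> b = binst \<sigma>' b \<longleftrightarrow> (\<forall>x\<in>fv (trm_of_bval b). \<sigma> x = \<sigma>' x)"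
  by (induction b) auto

section \<open>Closed typed basis values, environments and isometries\<close>

primrec bt :: "bval \<Rightarrow> qty \<Rightarrow> bool" where
  "bt BUnit Q \<longleftrightarrow> Q = QUnit"
| "bt (BVar x) Q \<longleftrightarrow> False"
| "bt (BInl b) Q \<longleftrightarrow> (\<exists>Q1 Q2. Q = QSum Q1 Q2 \<and> bt b Q1)"
| "bt (BInr b) Q \<longleftrightarrow> (\<exists>Q1 Q2. Q = QSum Q1 Q2 \<and> bt b Q2)"
| "bt (BTens b c) Q \<longleftrightarrow> (\<exists>Q1 Q2. Q = QTens Q1 Q2 \<and> bt b Q1 \<and> bt c Q2)"
| "bt BZero Q \<longleftrightarrow> Q = QNat"
| "bt (BSuc b) Q \<longleftrightarrow> Q = QNat \<and> bt b QNat"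

inductive_cases wt_unitE: "wt \<Gamma> TUnit Q"
inductive_cases wt_varE: "wt \<Gamma> (TVar x) Q"
inductive_cases wt_inlE: "wt \<Gamma> (TInl t) Q"
inductive_cases wt_inrE: "wt \<Gamma> (TInr t) Q"
inductive_cases wt_tensE: "wt \<Gamma> (TTens s t) Q"
inductive_cases wt_zeroE: "wt \<Gamma> TZero Q"
inductive_cases wt_sucE: "wt \<Gamma> (TSuc t) Q"
inductive_cases wt_appE: "wt \<Gamma> (TApp u t) Q"
inductive_cases wt_sumE: "wt \<Gamma> (TSum ps) Q"

inductive_cases wtu_clausesE: "wtu (Clauses cs) Q1 Q2"
inductive_cases wtu_starE: "wtu (UStar u) Q1 Q2"
inductive_cases wtu_compE: "wtu (UComp u v) Q1 Q2"
inductive_cases wtu_tensE: "wtu (UTens u v) Q1 Q2"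
inductive_cases wtu_plusE: "wtu (UPlus u v) Q1 Q2"
inductive_cases wtu_ctrlE: "wtu (UCtrl u) Q1 Q2"

lemma map_add_empty_iff: "f ++ g = Map.empty \<longleftrightarrow> f = Map.empty \<and> g = Map.empty"
  by (auto simp: fun_eq_iff map_add_None)

lemma bt_imp_wt: "bt b Q \<Longrightarrow> wt Map.empty (trm_of_bval b) Q"
proof (induction b arbitrary: Q)
  case (BTens b c)
  then obtain Q1 Q2 where "Q = QTens Q1 Q2" "bt b Q1" "bt c Q2" by auto
  then show ?case using wt_tens[of Map.empty "trm_of_bval b" Q1 Map.empty "trm_of_bval c" Q2] BTens
    by simp
qed (auto intro: wt_wtu.intros)

lemma dom_eq_fv: "wt \<Gamma> t Q \<Longrightarrow> dom \<Gamma> = fv t"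
proof (induction t arbitrary: \<Gamma> Q rule: trm_induct)
  case (TTens t s)
  then show ?case by (elim wt_tensE) (simp add: sup_commute)
next
  case (TSum ps)
  \<comment> \<open>The squared moduli add up to 1, so a well-typed sum has at least one summand
    from which its context can be read off.\<close>
  from TSum.prems have *: "\<forall>p\<in>set ps. wt \<Gamma> (snd p) Q" "ps \<noteq> []" by (auto elim!: wt_sumE)
  then have "\<forall>p\<in>set ps. fv (snd p) = dom \<Gamma>" using TSum.IH by blast
  then have "fv (TSum ps) = (\<Union>p\<in>set ps. dom \<Gamma>)" by simp
  then show ?case using *(2) by simp
qed (force elim!: wt_unitE wt_varE wt_inlE wt_inrE wt_zeroE wt_sucE wt_appE)+

definition sat :: "ctx \<Rightarrow> (var \<Rightarrow> bval) \<Rightarrow> bool" where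
  "sat \<Gamma> \<sigma> \<longleftrightarrow> (\<forall>x Q. \<Gamma> x = Some Q \<longrightarrow> bt (\<sigma> x) Q)"

lemma sat_add: "dom \<Gamma>1 \<inter> dom \<Gamma>2 = {} \<Longrightarrow> sat (\<Gamma>1 ++ \<Gamma>2) \<sigma> \<longleftrightarrow> sat \<Gamma>1 \<sigma> \<and> sat \<Gamma>2 \<sigma>"
  unfolding sat_def by (auto simp: map_add_Some_iff) (metis domIff disjoint_iff option.discI)

lemma sat_empty [simp]: "sat Map.empty \<sigma>"
  by (simp add: sat_def)

text \<open>The first clause is required of untyped basis values too: a unitary may be typed in several
  ways, and this keeps its restrictions to different types from interfering.\<close>

definition isom :: "(bval \<Rightarrow> vec) \<Rightarrow> qty \<Rightarrow> qty \<Rightarrow> bool" where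
  "isom M Q1 Q2 \<longleftrightarrow>
     (\<forall>b c. M b c \<noteq> 0 \<longrightarrow> (bt b Q1 \<longleftrightarrow> bt c Q2)) \<and>
     (\<forall>b. bt b Q1 \<longrightarrow> finite (supp (M b))) \<and>
     (\<forall>b c. bt b Q1 \<longrightarrow> bt c Q1 \<longrightarrow> innr (M b) (M c) = (if b = c then 1 else 0))"

lemma isomD:
  assumes "isom M Q1 Q2"
  shows "M b c \<noteq> 0 \<Longrightarrow> bt b Q1 \<longleftrightarrow> bt c Q2"
    "bt b Q1 \<Longrightarrow> finite (supp (M b))"
    "bt b Q1 \<Longrightarrow> bt c Q1 \<Longrightarrow> innr (M b) (M c) = (if b = c then 1 else 0)"
  using assms unfolding isom_def by blast+

text \<open>The two vectors may be typed differently, as happens when one unitary is applied at two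
  types. A basis value of \<open>g\<close> outside \<open>Q1\<close> causes no trouble: since
  \<open>M\<close> reflects types, its column has support disjoint from every column used by
  \<open>f\<close>.\<close>

lemma innr_appv:
  assumes M: "isom M Q1 Q2" "isom M Q1' Q2'"
    and f: "finite (supp f)" "\<And>b. b \<in> supp f \<Longrightarrow> bt b Q1"
    and g: "finite (supp g)" "\<And>b. b \<in> supp g \<Longrightarrow> bt b Q1'"
  shows "innr (appv M f) (appv M g) = innr f g"
proof -
  have ip: "innr (M b) (M c) = (if b = c then 1 else 0)" if "b \<in> supp f" "c \<in> supp g" for b c
  proof (cases "bt c Q1")
    case True
    then show ?thesis using isomD(3)[OF M(1)] f(2)[OF that(1)] by blast
  next
    case False
    then have "supp (M b) \<inter> supp (M c) = {}" "b \<noteq> c"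
      using isomD(1)[OF M(1)] f(2)[OF that(1)] by (auto simp: supp_def)
    then show ?thesis by (simp add: innr_disjoint)
  qed
  have fg: "appv M f = (\<lambda>x. \<Sum>b\<in>supp f. f b * M b x)" "appv M g = (\<lambda>x. \<Sum>b\<in>supp g. g b * M b x)"
    by (auto simp: appv_eq[OF f(1) subset_refl] appv_eq[OF g(1) subset_refl])
  have "innr (appv M f) (appv M g) =
      (\<Sum>b\<in>supp f. \<Sum>c\<in>supp g. cnj (f b) * g c * innr (M b) (M c))"
    unfolding fg
    by (rule innr_sum_sum) (use f g isomD(2)[OF M(1)] isomD(2)[OF M(2)] in auto)
  also have "\<dots> = (\<Sum>b\<in>supp f. \<Sum>c\<in>supp g. if b = c then cnj (f b) * g c else 0)"
    by (intro sum.cong refl) (simp add: ip)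
  also have "\<dots> = (\<Sum>b\<in>supp f. cnj (f b) * g b)"
    using g(1) by (intro sum.cong) (auto simp: sum.delta' not_in_supp)
  finally show ?thesis using innr_left[OF f(1) subset_refl] by simp
qed

text \<open>With this hypothesis, results on terms are available while the matrices are still being
  constructed. It is vacuous for expressions, and after \<open>isom_semu\<close> it holds for every
  term.\<close>

definition good_unis :: "(uni \<Rightarrow> bval \<Rightarrow> vec) \<Rightarrow> trm \<Rightarrow> bool" where
  "good_unis M t \<longleftrightarrow> (\<forall>u\<in>unis t. \<forall>Q1 Q2. wtu u Q1 Q2 \<longrightarrow> isom (M u) Q1 Q2)"

lemma good_unis_simps [simp]:
  "good_unis M TUnit" "good_unis M (TVar x)" "good_unis M TZero"
  "good_unis M (TInl t) \<longleftrightarrow> good_unis M t" "good_unis M (TInr t) \<longleftrightarrow> good_unis M t"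
  "good_unis M (TSuc t) \<longleftrightarrow> good_unis M t"
  "good_unis M (TTens s t) \<longleftrightarrow> good_unis M s \<and> good_unis M t"
  "good_unis M (TSum ps) \<longleftrightarrow> (\<forall>p\<in>set ps. good_unis M (snd p))"
  "good_unis M (TApp u t) \<longleftrightarrow> (\<forall>Q1 Q2. wtu u Q1 Q2 \<longrightarrow> isom (M u) Q1 Q2) \<and> good_unis M t"
  "good_unis M (trm_of_expr e)" "good_unis M (trm_of_bval b)"
  unfolding good_unis_def by auto

text \<open>An equivalence is needed: an environment that violates the context must produce a vector
  living entirely outside the type. For clauses this is what makes the matrix reflect types. In a
  sum, any one summand that is nonzero at \<open>b\<close> decides the matter.\<close>

lemma tsem_typed:
  "\<lbrakk>wt \<Gamma> t Q; good_unis M t; tsem M t \<sigma> b \<noteq> 0\<rbrakk> \<Longrightarrow> bt b Q \<longleftrightarrow> sat \<Gamma> \<sigma>"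
proof (induction t arbitrary: \<Gamma> Q b rule: trm_induct)
  case TUnit
  then show ?case by (auto elim!: wt_unitE simp: ket_def split: if_splits)
next
  case (TVar x)
  then show ?case by (auto elim!: wt_varE simp: ket_def sat_def split: if_splits)
next
  case TZero
  then show ?case by (auto elim!: wt_zeroE simp: ket_def split: if_splits)
next
  case (TInl t)
  then show ?case by (elim wt_inlE; cases b) auto
next
  case (TInr t)
  then show ?case by (elim wt_inrE; cases b) auto
next
  case (TSuc t)
  then show ?case by (elim wt_sucE; cases b) auto
next
  case (TTens t s)
  from TTens.prems obtain \<Gamma>1 \<Gamma>2 Q1 Q2 where *: "\<Gamma> = \<Gamma>1 ++ \<Gamma>2" "Q = QTens Q1 Q2" "wt \<Gamma>1 t Q1"
    "wt \<Gamma>2 s Q2" "dom \<Gamma>1 \<inter> dom \<Gamma>2 = {}" by (auto elim!: wt_tensE)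
  with TTens show ?case by (cases b) (auto simp: sat_add)
next
  case (TApp u t)
  from TApp.prems obtain Q1 where *: "wtu u Q1 Q" "wt \<Gamma> t Q1" by (auto elim!: wt_appE)
  from TApp.prems obtain c where "tsem M t \<sigma> c \<noteq> 0" "M u c b \<noteq> 0"
    using supp_appv[of b "M u" "tsem M t \<sigma>"] by (auto simp: supp_def)
  with TApp * isomD(1)[of "M u" Q1 Q c b] show ?case by auto
next
  case (TSum ps)
  from TSum.prems(3) obtain p where p: "p \<in> set ps" "tsem M (snd p) \<sigma> b \<noteq> 0"
    unfolding tsem_sum_nth by (metis (mono_tags, lifting) lessThan_iff mult_zero_right nth_mem sum.neutral)
  moreover have "wt \<Gamma> (snd p) Q" using TSum.prems(1) p(1) by (auto elim: wt_sumE)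
  ultimately show ?case using TSum.IH TSum.prems(2) by simp
qed

text \<open>Orthogonality relates untyped terms, so its soundness can only ask for some typing of
  each side. Context and type are therefore hidden here.\<close>

definition inst :: "trm \<Rightarrow> (var \<Rightarrow> bval) \<Rightarrow> bool" where
  "inst t \<sigma> \<longleftrightarrow> (\<exists>\<Gamma> Q. wt \<Gamma> t Q \<and> sat \<Gamma> \<sigma>)"

lemma instI: "wt \<Gamma> t Q \<Longrightarrow> sat \<Gamma> \<sigma> \<Longrightarrow> inst t \<sigma>"
  unfolding inst_def by blast

lemma inst_sub:
  "inst (TInl t) \<sigma> \<Longrightarrow> inst t \<sigma>" "inst (TInr t) \<sigma> \<Longrightarrow> inst t \<sigma>" "inst (TSuc t) \<sigma> \<Longrightarrow> inst t \<sigma>"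
  "inst (TApp u t) \<sigma> \<Longrightarrow> inst t \<sigma>"
  "inst (TTens s t) \<sigma> \<Longrightarrow> inst s \<sigma>" "inst (TTens s t) \<sigma> \<Longrightarrow> inst t \<sigma>"
  "inst (TSum ps) \<sigma> \<Longrightarrow> p \<in> set ps \<Longrightarrow> inst (snd p) \<sigma>"
  unfolding inst_def
  by (auto elim!: wt_inlE wt_inrE wt_sucE wt_appE wt_tensE wt_sumE simp: sat_add; blast)+

lemma finite_supp_tsem:
  "\<lbrakk>inst t \<sigma>; good_unis M t\<rbrakk> \<Longrightarrow> finite (supp (tsem M t \<sigma>))"
proof (induction t rule: trm_induct)
  case (TApp u t)
  from TApp.prems obtain \<Gamma> Q1 Q where *: "wtu u Q1 Q" "wt \<Gamma> t Q1" "sat \<Gamma> \<sigma>"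
    by (auto simp: inst_def elim!: wt_appE)
  then have "finite (supp (M u b))" if "b \<in> supp (tsem M t \<sigma>)" for b
    using that TApp.prems tsem_typed[OF *(2), of M \<sigma> b] isomD(2)[of "M u" Q1 Q b]
    by (auto simp: supp_def)
  then show ?case using TApp * by (auto intro!: finite_supp_appv instI)
next
  case (TSum ps)
  then have "finite (supp (tsem M (snd (ps ! i)) \<sigma>))" if "i < length ps" for i
    using that inst_sub(7)[OF TSum.prems(1)] by simp
  then show ?case unfolding tsem_sum_nth by (intro finite_supp_sum) auto
qed (auto dest: inst_sub)

section \<open>Soundness of orthogonality\<close>

text \<open>The instances of an open term form an orthonormal family, indexed by the environments
  restricted to its free variables: the term denotes an isometry out of the space of
  environments.\<close>

definition isometric_term :: "(uni \<Rightarrow> bval \<Rightarrow> vec) \<Rightarrow> trm \<Rightarrow> bool" where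
  "isometric_term M t \<longleftrightarrow> (\<forall>\<sigma> \<sigma>'. inst t \<sigma> \<longrightarrow> inst t \<sigma>' \<longrightarrow>
     innr (tsem M t \<sigma>) (tsem M t \<sigma>') = (if \<forall>x\<in>fv t. \<sigma> x = \<sigma>' x then 1 else 0))"

lemma isoD:
  "isometric_term M t \<Longrightarrow> inst t \<sigma> \<Longrightarrow> inst t \<sigma>' \<Longrightarrow>
    innr (tsem M t \<sigma>) (tsem M t \<sigma>') = (if \<forall>x\<in>fv t. \<sigma> x = \<sigma>' x then 1 else 0)"
  by (simp add: isometric_term_def)

lemma inst_sum_fv: "inst (TSum ps) \<sigma> \<Longrightarrow> p \<in> set ps \<Longrightarrow> fv (snd p) = fv (TSum ps)"
  unfolding inst_def by (metis dom_eq_fv wt_sumE)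

lemma innr_appv_tsem:
  assumes "good_unis M (TApp u t)" "good_unis M (TApp u s)" "inst (TApp u t) \<sigma>" "inst (TApp u s) \<sigma>'"
  shows "innr (tsem M (TApp u t) \<sigma>) (tsem M (TApp u s) \<sigma>') = innr (tsem M t \<sigma>) (tsem M s \<sigma>')"
proof -
  from assms(3) obtain \<Gamma> Q1 Q2 where t: "wtu u Q1 Q2" "wt \<Gamma> t Q1" "sat \<Gamma> \<sigma>"
    by (auto simp: inst_def elim!: wt_appE)
  from assms(4) obtain \<Gamma>' Q1' Q2' where s: "wtu u Q1' Q2'" "wt \<Gamma>' s Q1'" "sat \<Gamma>' \<sigma>'"
    by (auto simp: inst_def elim!: wt_appE)
  have "innr (appv (M u) (tsem M t \<sigma>)) (appv (M u) (tsem M s \<sigma>')) = innr (tsem M t \<sigma>) (tsem M s \<sigma>')"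
  proof (rule innr_appv)
    show "isom (M u) Q1 Q2" "isom (M u) Q1' Q2'" using assms(1) t s by auto
    show "finite (supp (tsem M t \<sigma>))" "finite (supp (tsem M s \<sigma>'))"
      using assms t s by (auto intro!: finite_supp_tsem instI)
    show "bt b Q1" if "b \<in> supp (tsem M t \<sigma>)" for b
      using tsem_typed[OF t(2)] that assms(1) t(3) by (auto simp: supp_def)
    show "bt b Q1'" if "b \<in> supp (tsem M s \<sigma>')" for b
      using tsem_typed[OF s(2)] that assms(2) s(3) by (auto simp: supp_def)
  qed
  then show ?thesis by simp
qed

text \<open>Orthogonality of the terms is orthogonality of the vectors even under two different
  instantiations: either these agree on the free variables, or already each single term
  has orthogonal instances.\<close>

lemma orth_sound_aux:
  assumes "orth t1 t2"
    and "\<forall>s\<in>subterms t1 \<union> subterms t2. isometric_term M s" "good_unis M t1" "good_unis M t2"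
    and "inst t1 \<sigma>" "inst t2 \<sigma>'"
  shows "innr (tsem M t1 \<sigma>) (tsem M t2 \<sigma>') = 0"
  using assms
proof (induction arbitrary: \<sigma> \<sigma>')
  case (orth_sym t1 t2)
  then have "innr (tsem M t1 \<sigma>') (tsem M t2 \<sigma>) = 0" by (simp add: Un_commute)
  then show ?case using innr_commute[of "tsem M t2 \<sigma>" "tsem M t1 \<sigma>'"] by simp
next
  case (orth_inl_inr t1 t2)
  show ?case by (rule innr_disjoint) auto
next
  case (orth_zero_suc t)
  show ?case by (rule innr_disjoint) auto
next
  case (orth_suc t1 t2)
  then have "finite (supp (tsem M t1 \<sigma>))" by (auto intro: finite_supp_tsem inst_sub)
  with orth_suc show ?case by (auto simp: innr_sucv dest: inst_sub)
next
  case (orth_inl t1 t2)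
  then have "finite (supp (tsem M t1 \<sigma>))" by (auto intro: finite_supp_tsem inst_sub)
  with orth_inl show ?case by (auto simp: innr_inlv dest: inst_sub)
next
  case (orth_inr t1 t2)
  then have "finite (supp (tsem M t1 \<sigma>))" by (auto intro: finite_supp_tsem inst_sub)
  with orth_inr show ?case by (auto simp: innr_inrv dest: inst_sub)
next
  case (orth_app t1 t2 u)
  have "innr (tsem M t1 \<sigma>) (tsem M t2 \<sigma>') = 0"
    using orth_app by (intro orth_app.IH) (auto dest: inst_sub)
  then show ?case using innr_appv_tsem[of M u t1 t2 \<sigma> \<sigma>'] orth_app.prems by simp
next
  case (orth_tens_right t1 t2 t t')
  have "finite (supp (tsem M t \<sigma>))" "finite (supp (tsem M t1 \<sigma>))"
    using orth_tens_right.prems by (auto intro: finite_supp_tsem dest: inst_sub)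
  moreover have "innr (tsem M t1 \<sigma>) (tsem M t2 \<sigma>') = 0"
    using orth_tens_right by (intro orth_tens_right.IH) (auto dest: inst_sub)
  ultimately show ?case by (simp add: innr_tensv)
next
  case (orth_tens_left t1 t2 t t')
  have "finite (supp (tsem M t \<sigma>))" "finite (supp (tsem M t1 \<sigma>))"
    using orth_tens_left.prems by (auto intro: finite_supp_tsem dest: inst_sub)
  moreover have "innr (tsem M t1 \<sigma>) (tsem M t2 \<sigma>') = 0"
    using orth_tens_left by (intro orth_tens_left.IH) (auto dest: inst_sub)
  ultimately show ?case by (simp add: innr_tensv)
next
  case (orth_sum ps t)
  have i: "inst (snd (ps ! i)) \<sigma>'" if "i < length ps" for i
    using inst_sub(7)[OF orth_sum.prems(5)] that by simp
  have "innr (tsem M t \<sigma>) (tsem M (snd (ps ! i)) \<sigma>') = 0"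
    "finite (supp (tsem M (snd (ps ! i)) \<sigma>'))" if "i < length ps" for i
  proof -
    have p: "ps ! i \<in> set ps" using that by simp
    then have "\<forall>s\<in>subterms t \<union> subterms (snd (ps ! i)). isometric_term M s" "good_unis M (snd (ps ! i))"
      using orth_sum.prems by auto
    with orth_sum i[OF that] p show "innr (tsem M t \<sigma>) (tsem M (snd (ps ! i)) \<sigma>') = 0"
      "finite (supp (tsem M (snd (ps ! i)) \<sigma>'))"
      by (blast intro: finite_supp_tsem)+
  qed
  then show ?case unfolding tsem_sum_nth by (subst innr_sum_right) auto
next
  case (orth_sum_null ps qs t)
  let ?ps = "ps @ (0, t) # qs"
  have i: "inst (snd (?ps ! i)) \<sigma>'" if "i < length ?ps" for i
    by (rule inst_sub(7)[OF orth_sum_null.prems(5)]) (use that nth_mem in blast)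
  \<comment> \<open>Only the weighted product can be claimed to vanish: at the inserted summand
    \<open>t\<close> itself it is the weight that is 0, while the inner product may be
    nonzero.\<close>
  have "fst (?ps ! i) * innr (tsem M t \<sigma>) (tsem M (snd (?ps ! i)) \<sigma>') = 0"
    "finite (supp (tsem M (snd (?ps ! i)) \<sigma>'))" if "i < length ?ps" for i
  proof -
    have p: "?ps ! i \<in> set ?ps" using that nth_mem by blast
    then have g: "\<forall>s\<in>subterms t \<union> subterms (snd (?ps ! i)). isometric_term M s" "good_unis M (snd (?ps ! i))"
      using orth_sum_null.prems(1,3) unfolding sum_simps good_unis_simps by blast+
    then show "finite (supp (tsem M (snd (?ps ! i)) \<sigma>'))"
      using i[OF that] by (blast intro: finite_supp_tsem)
    show "fst (?ps ! i) * innr (tsem M t \<sigma>) (tsem M (snd (?ps ! i)) \<sigma>') = 0"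
    proof (cases "?ps ! i \<in> set (ps @ qs)")
      case True
      with orth_sum_null i[OF that] g show ?thesis by simp
    next
      case False
      with p have "?ps ! i = (0, t)" by auto
      then show ?thesis by simp
    qed
  qed
  then show ?case unfolding tsem_sum_nth
    by (subst innr_sum_right) (auto simp del: sum.lessThan_Suc intro!: sum.neutral)
next
  case (orth_sum_sum I t js ks \<alpha> \<beta>)
  let ?J = "TSum (map (\<lambda>j. (\<alpha> j, t j)) js)" and ?K = "TSum (map (\<lambda>k. (\<beta> k, t k)) ks)"
  \<comment> \<open>All summands share the free variables of the sum, so the inner products of the
    common family under the two environments form this scalar times the identity matrix. The scalar
    then factors out of the side condition of the rule.\<close>
  let ?\<kappa> = "if \<forall>x\<in>fv ?J. \<sigma> x = \<sigma>' x then 1 else 0 :: complex"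
  have J: "inst (t j) \<sigma>" "fv (t j) = fv ?J" "good_unis M (t j)" "subterms (t j) \<subseteq> subterms ?J"
    if "j \<in> set js" for j
  proof -
    have *: "(\<alpha> j, t j) \<in> set (map (\<lambda>j. (\<alpha> j, t j)) js)" using that by simp
    show "inst (t j) \<sigma>" "fv (t j) = fv ?J"
      using inst_sub(7)[OF orth_sum_sum.prems(4) *] inst_sum_fv[OF orth_sum_sum.prems(4) *] by simp_all
    show "good_unis M (t j)" "subterms (t j) \<subseteq> subterms ?J"
      using orth_sum_sum.prems(2) that by auto
  qed
  have K: "inst (t j) \<sigma>'" "good_unis M (t j)" "subterms (t j) \<subseteq> subterms ?K" if "j \<in> set ks" for j
  proof -
    have *: "(\<beta> j, t j) \<in> set (map (\<lambda>j. (\<beta> j, t j)) ks)" using that by simp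
    show "inst (t j) \<sigma>'"
      using inst_sub(7)[OF orth_sum_sum.prems(5) *] by simp
    show "good_unis M (t j)" "subterms (t j) \<subseteq> subterms ?K"
      using orth_sum_sum.prems(3) that by auto
  qed
  have ip: "innr (tsem M (t j) \<sigma>) (tsem M (t k) \<sigma>') = (if j = k then ?\<kappa> else 0)"
    if "j \<in> set js" "k \<in> set ks" for j k
  proof (cases "j = k")
    case True
    have "isometric_term M (t j)" using orth_sum_sum.prems(1) J(4)[OF that(1)] self_in_subterms by blast
    from isoD[OF this J(1)[OF that(1)] K(1)[OF that(2)[folded True]]]
    show ?thesis using True J(2)[OF that(1)] by simp
  next
    case False
    have "\<forall>s\<in>subterms (t j) \<union> subterms (t k). isometric_term M s"
      using orth_sum_sum.prems(1) J(4)[OF that(1)] K(3)[OF that(2)] by blast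
    moreover have "j \<in> I" "k \<in> I" using that orth_sum_sum.hyps by auto
    ultimately have "innr (tsem M (t j) \<sigma>) (tsem M (t k) \<sigma>') = 0"
      using orth_sum_sum.IH False J[OF that(1)] K[OF that(2)] by blast
    then show ?thesis using False by simp
  qed
  have "innr (tsem M ?J \<sigma>) (tsem M ?K \<sigma>') =
      (\<Sum>j\<in>set js. \<Sum>k\<in>set ks. cnj (\<alpha> j) * \<beta> k * innr (tsem M (t j) \<sigma>) (tsem M (t k) \<sigma>'))"
    unfolding tsem_sum_distinct[OF \<open>distinct js\<close>] tsem_sum_distinct[OF \<open>distinct ks\<close>]
    by (rule innr_sum_sum) (use J K in \<open>auto intro!: finite_supp_tsem\<close>)
  also have "\<dots> = (\<Sum>j\<in>set js. \<Sum>k\<in>set ks. if j = k then cnj (\<alpha> j) * \<beta> k * ?\<kappa> else 0)"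
    by (intro sum.cong refl) (simp add: ip)
  also have "\<dots> = (\<Sum>j\<in>set js. if j \<in> set ks then cnj (\<alpha> j) * \<beta> j * ?\<kappa> else 0)"
    by (intro sum.cong refl) (simp add: sum.delta)
  also have "\<dots> = (\<Sum>j\<in>set js \<inter> set ks. cnj (\<alpha> j) * \<beta> j * ?\<kappa>)"
    by (rule sum.inter_restrict[symmetric]) simp
  also have "\<dots> = 0"
    using orth_sum_sum.hyps by (simp add: sum_distrib_right[symmetric])
  finally show ?case .
qed

text \<open>Isometry of a sum uses orthogonality of its summands, whose soundness in turn uses
  isometry of all their subterms. Proving isometry for all subterms at once lets the induction
  hypothesis supply exactly that.\<close>

lemma iso_subterms: "good_unis M t \<Longrightarrow> s \<in> subterms t \<Longrightarrow> isometric_term M s"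
proof (induction t arbitrary: s rule: trm_induct)
  case TUnit
  then show ?case by (simp add: isometric_term_def innr_ket)
next
  case TZero
  then show ?case by (simp add: isometric_term_def innr_ket)
next
  case (TVar x)
  then show ?case by (auto simp add: isometric_term_def innr_ket)
next
  case (TInl t)
  then have "isometric_term M t" by simp
  then have "isometric_term M (TInl t)"
    using TInl.prems(1) by (auto simp: isometric_term_def innr_inlv finite_supp_tsem dest!: inst_sub)
  with TInl show ?case by auto
next
  case (TInr t)
  then have "isometric_term M t" by simp
  then have "isometric_term M (TInr t)"
    using TInr.prems(1) by (auto simp: isometric_term_def innr_inrv finite_supp_tsem dest!: inst_sub)
  with TInr show ?case by auto
next
  case (TSuc t)
  then have "isometric_term M t" by simp
  then have "isometric_term M (TSuc t)"
    using TSuc.prems(1) by (auto simp: isometric_term_def innr_sucv finite_supp_tsem dest!: inst_sub)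
  with TSuc show ?case by auto
next
  case (TTens t1 t2)
  then have i: "isometric_term M t1" "isometric_term M t2" by simp_all
  have "isometric_term M (TTens t1 t2)"
    unfolding isometric_term_def
  proof (intro allI impI)
    fix \<sigma> \<sigma>' assume "inst (TTens t1 t2) \<sigma>" "inst (TTens t1 t2) \<sigma>'"
    then have *: "inst t1 \<sigma>" "inst t2 \<sigma>" "inst t1 \<sigma>'" "inst t2 \<sigma>'" by (auto dest: inst_sub)
    then have "finite (supp (tsem M t1 \<sigma>))" "finite (supp (tsem M t2 \<sigma>))"
      using TTens.prems by (auto intro: finite_supp_tsem)
    then show "innr (tsem M (TTens t1 t2) \<sigma>) (tsem M (TTens t1 t2) \<sigma>') =
        (if \<forall>x\<in>fv (TTens t1 t2). \<sigma> x = \<sigma>' x then 1 else 0)"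
      by (auto simp: innr_tensv isoD[OF i(1) *(1,3)] isoD[OF i(2) *(2,4)])
  qed
  with TTens show ?case by auto
next
  case (TApp u t)
  then have i: "isometric_term M t" by simp
  have "isometric_term M (TApp u t)"
    unfolding isometric_term_def
  proof (intro allI impI)
    fix \<sigma> \<sigma>' assume *: "inst (TApp u t) \<sigma>" "inst (TApp u t) \<sigma>'"
    show "innr (tsem M (TApp u t) \<sigma>) (tsem M (TApp u t) \<sigma>') =
        (if \<forall>x\<in>fv (TApp u t). \<sigma> x = \<sigma>' x then 1 else 0)"
      unfolding innr_appv_tsem[OF TApp.prems(1) TApp.prems(1) *]
      using isoD[OF i] * by (auto dest!: inst_sub)
  qed
  with TApp show ?case by auto
next
  case (TSum ps)
  have sub: "isometric_term M s" if "p \<in> set ps" "s \<in> subterms (snd p)" for p s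
    using TSum.IH[OF that(1) _ that(2)] TSum.prems(1) that(1) by auto
  have "isometric_term M (TSum ps)"
    unfolding isometric_term_def
  proof (intro allI impI)
    fix \<sigma> \<sigma>' assume *: "inst (TSum ps) \<sigma>" "inst (TSum ps) \<sigma>'"
    let ?\<kappa> = "if \<forall>x\<in>fv (TSum ps). \<sigma> x = \<sigma>' x then 1 else 0 :: complex"
    let ?t = "\<lambda>i. snd (ps ! i)" and ?a = "\<lambda>i. fst (ps ! i)"
    from * obtain \<Gamma> Q where w: "wt \<Gamma> (TSum ps) Q" by (auto simp: inst_def)
    have p: "inst (?t i) \<sigma>" "inst (?t i) \<sigma>'" "good_unis M (?t i)" "fv (?t i) = fv (TSum ps)"
      if "i < length ps" for i
      using that inst_sub(7)[OF *(1)] inst_sub(7)[OF *(2)] inst_sum_fv[OF *(1)] TSum.prems(1)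
      by (auto simp del: sum_simps)
    have ip: "innr (tsem M (?t i) \<sigma>) (tsem M (?t j) \<sigma>') = (if i = j then ?\<kappa> else 0)"
      if "i < length ps" "j < length ps" for i j
    proof (cases "i = j")
      case True
      have "isometric_term M (?t i)" using sub[of "ps ! i" "?t i"] that by simp
      from isoD[OF this p(1,2)[OF that(1)]] show ?thesis
        unfolding p(4)[OF that(1)] True[symmetric] by simp
    next
      case False
      with w that have "orth (?t i) (?t j)" by (auto elim: wt_sumE)
      moreover have "\<forall>s\<in>subterms (?t i) \<union> subterms (?t j). isometric_term M s"
        using sub that nth_mem by blast
      ultimately show ?thesis using orth_sound_aux p that False by auto
    qed
    have "innr (tsem M (TSum ps) \<sigma>) (tsem M (TSum ps) \<sigma>') =
       (\<Sum>i<length ps. \<Sum>j<length ps.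
          cnj (?a i) * ?a j * innr (tsem M (?t i) \<sigma>) (tsem M (?t j) \<sigma>'))"
      unfolding tsem_sum_nth
      by (rule innr_sum_sum) (use p in \<open>auto intro!: finite_supp_tsem\<close>)
    also have "\<dots> = (\<Sum>i<length ps. \<Sum>j<length ps. if i = j then cnj (?a i) * ?a j * ?\<kappa> else 0)"
      by (intro sum.cong refl) (simp add: ip)
    also have "\<dots> = (\<Sum>i<length ps. cnj (?a i) * ?a i * ?\<kappa>)"
      by (intro sum.cong refl) (simp add: sum.delta)
    also have "\<dots> = of_real (\<Sum>i<length ps. (cmod (?a i))\<^sup>2) * ?\<kappa>"
      by (simp only: sum_distrib_right[symmetric] of_real_sum complex_norm_square mult.commute)
    also have "(\<Sum>i<length ps. (cmod (?a i))\<^sup>2) = 1"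
      using w by (auto elim!: wt_sumE simp: sum_list_sum_nth atLeast0LessThan)
    finally show "innr (tsem M (TSum ps) \<sigma>) (tsem M (TSum ps) \<sigma>') = ?\<kappa>" by simp
  qed
  with TSum sub show ?case by auto
qed

lemma iso_trm: "good_unis M t \<Longrightarrow> isometric_term M t"
  using iso_subterms self_in_subterms by blast

lemma orth_sound:
  assumes "orth t1 t2" "good_unis M t1" "good_unis M t2" "inst t1 \<sigma>" "inst t2 \<sigma>'"
  shows "innr (tsem M t1 \<sigma>) (tsem M t2 \<sigma>') = 0"
  using assms iso_subterms by (intro orth_sound_aux) blast+

section \<open>Orthonormal bases\<close>

lemma tensv_linear:
  "tensv (\<lambda>b. f b + c * v b) g = (\<lambda>b. tensv f g b + c * tensv v g b)"
  "tensv g (\<lambda>b. f b + c * v b) = (\<lambda>b. tensv g f b + c * tensv g v b)"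
  "tensv (\<lambda>_. 0) g = (\<lambda>_. 0)" "tensv g (\<lambda>_. 0) = (\<lambda>_. 0)"
  by (auto simp: fun_eq_iff tensv_def algebra_simps split: bval.splits)

lemma constructor_linear:
  "inlv (\<lambda>b. f b + c * v b) = (\<lambda>b. inlv f b + c * inlv v b)" "inlv (\<lambda>_. 0) = (\<lambda>_. 0)"
  "inrv (\<lambda>b. f b + c * v b) = (\<lambda>b. inrv f b + c * inrv v b)" "inrv (\<lambda>_. 0) = (\<lambda>_. 0)"
  "sucv (\<lambda>b. f b + c * v b) = (\<lambda>b. sucv f b + c * sucv v b)" "sucv (\<lambda>_. 0) = (\<lambda>_. 0)"
  by (auto simp: fun_eq_iff inlv_def inrv_def sucv_def split: bval.splits)

lemma lspan_tensv:
  assumes "f \<in> lspan V" "\<And>v. v \<in> V \<Longrightarrow> tensv v g \<in> lspan W"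
  shows "tensv f g \<in> lspan W"
  by (rule lspan_map[OF assms(1), where h = "\<lambda>f. tensv f g"]) (simp_all add: tensv_linear assms(2))

lemma lspan_tensv_right:
  assumes "f \<in> lspan V" "\<And>v. v \<in> V \<Longrightarrow> tensv g v \<in> lspan W"
  shows "tensv g f \<in> lspan W"
  by (rule lspan_map[OF assms(1), where h = "tensv g"]) (simp_all add: tensv_linear assms(2))

lemma lspan_inlv:
  assumes "f \<in> lspan V" "\<And>v. v \<in> V \<Longrightarrow> inlv v \<in> lspan W"
  shows "inlv f \<in> lspan W"
  by (rule lspan_map[OF assms(1), where h = inlv]) (simp_all add: constructor_linear assms(2))

lemma lspan_inrv:
  assumes "f \<in> lspan V" "\<And>v. v \<in> V \<Longrightarrow> inrv v \<in> lspan W"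
  shows "inrv f \<in> lspan W"
  by (rule lspan_map[OF assms(1), where h = inrv]) (simp_all add: constructor_linear assms(2))

lemma lspan_sucv:
  assumes "f \<in> lspan V" "\<And>v. v \<in> V \<Longrightarrow> sucv v \<in> lspan W"
  shows "sucv f \<in> lspan W"
  by (rule lspan_map[OF assms(1), where h = sucv]) (simp_all add: constructor_linear assms(2))

text \<open>The elements of one basis are typed in different contexts, so the context is quantified
  away.\<close>

definition typable :: "trm \<Rightarrow> qty \<Rightarrow> bool" where
  "typable t Q \<longleftrightarrow> (\<exists>\<Gamma>. wt \<Gamma> t Q)"

lemma typable_sub:
  "typable (TInl t) (QSum Q1 Q2) \<Longrightarrow> typable t Q1" "typable (TInr t) (QSum Q1 Q2) \<Longrightarrow> typable t Q2"
  "typable (TSuc t) QNat \<Longrightarrow> typable t QNat"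
  "typable (TTens s t) (QTens Q1 Q2) \<Longrightarrow> typable s Q1"
  "typable (TTens s t) (QTens Q1 Q2) \<Longrightarrow> typable t Q2"
  "typable (TSum ps) Q \<Longrightarrow> p \<in> set ps \<Longrightarrow> typable (snd p) Q"
  unfolding typable_def by (auto elim!: wt_inlE wt_inrE wt_sucE wt_tensE wt_sumE; blast)+

lemma typable_tens_fv: "typable (TTens s t) Q \<Longrightarrow> fv s \<inter> fv t = {}"
  unfolding typable_def by (metis dom_eq_fv wt_tensE)

section \<open>Disjointness and exhaustiveness of patterns\<close>

lemma bt_elims:
  "bt b QUnit \<Longrightarrow> (b = BUnit \<Longrightarrow> P) \<Longrightarrow> P"
  "bt b (QSum Q1 Q2) \<Longrightarrow> (\<And>c. b = BInl c \<Longrightarrow> bt c Q1 \<Longrightarrow> P) \<Longrightarrow> (\<And>c. b = BInr c \<Longrightarrow> bt c Q2 \<Longrightarrow> P) \<Longrightarrow> P"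
  "bt b (QTens Q1 Q2) \<Longrightarrow> (\<And>c d. b = BTens c d \<Longrightarrow> bt c Q1 \<Longrightarrow> bt d Q2 \<Longrightarrow> P) \<Longrightarrow> P"
  "bt b QNat \<Longrightarrow> (b = BZero \<Longrightarrow> P) \<Longrightarrow> (\<And>c. b = BSuc c \<Longrightarrow> bt c QNat \<Longrightarrow> P) \<Longrightarrow> P"
  by (cases b; auto)+

text \<open>Linear typing keeps the variables of two tensor factors apart, so environments found
  separately for the factors can be glued into one.\<close>

lemma combine_env:
  assumes "fv s \<inter> fv t = {}"
  obtains \<sigma> where "tsem M s \<sigma> = tsem M s \<sigma>1" "tsem M t \<sigma> = tsem M t \<sigma>2"
proof
  let ?\<sigma> = "\<lambda>x. if x \<in> fv s then \<sigma>1 x else \<sigma>2 x"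
  show "tsem M s ?\<sigma> = tsem M s \<sigma>1" by (rule tsem_cong_fv) simp
  show "tsem M t ?\<sigma> = tsem M t \<sigma>2" by (rule tsem_cong_fv) (use assms in auto)
qed

lemma combine_env_bval:
  assumes "fv (trm_of_bval p) \<inter> fv (trm_of_bval q) = {}"
  obtains \<sigma> where "binst \<sigma> p = binst \<sigma>1 p" "binst \<sigma> q = binst \<sigma>2 q"
proof
  let ?\<sigma> = "\<lambda>x. if x \<in> fv (trm_of_bval p) then \<sigma>1 x else \<sigma>2 x"
  show "binst ?\<sigma> p = binst \<sigma>1 p" "binst ?\<sigma> q = binst \<sigma>2 q"
    using assms by (auto simp: binst_eq_iff)
qed

text \<open>At a tensor the outer component is determined first; both patterns then lie in the same
  slice, which determines the other component. Two environments are allowed, because each pattern is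
  matched on its own.\<close>

lemma ONB_unique:
  "ONB Q S \<Longrightarrow> p \<in> S \<Longrightarrow> q \<in> S \<Longrightarrow> binst \<sigma> p = binst \<sigma>' q \<Longrightarrow> p = q"
proof (induction arbitrary: p q \<sigma> \<sigma>' rule: ONB.induct)
  case (ONB_tens2 S Q2 Q1)
  from ONB_tens2.hyps(1) ONB_tens2.prems(1,2) obtain p1 p2 q1 q2
    where "p = BTens p1 p2" "q = BTens q1 q2" by blast
  with ONB_tens2 show ?case unfolding pi2_def slice2_def by simp blast
next
  case (ONB_tens1 S Q1 Q2)
  from ONB_tens1.hyps(1) ONB_tens1.prems(1,2) obtain p1 p2 q1 q2
    where "p = BTens p1 p2" "q = BTens q1 q2" by blast
  with ONB_tens1 show ?case unfolding pi1_def slice1_def by simp blast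
qed auto

text \<open>In the tensor rules one component is matched first and selects the slice that has to
  cover the other one; gluing the two environments gives one for the pair.\<close>

lemma ONB_matches:
  "ONB Q S \<Longrightarrow> \<forall>p\<in>S. typable (trm_of_bval p) Q \<Longrightarrow> bt b Q \<Longrightarrow> \<exists>p\<in>S. \<exists>\<sigma>. b = binst \<sigma> p"
proof (induction arbitrary: b rule: ONB.induct)
  case (ONB_var Q x)
  have "b = binst (\<lambda>_. b) (BVar x)" by simp
  then show ?case by blast
next
  case ONB_unit
  then show ?case by (auto elim: bt_elims)
next
  case (ONB_sum Q1 S Q2 T)
  have S: "\<forall>p\<in>S. typable (trm_of_bval p) Q1" "\<forall>p\<in>T. typable (trm_of_bval p) Q2"
    using ONB_sum.prems(1) by (auto dest!: bspec dest: typable_sub)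
  from ONB_sum.prems(2) show ?case
  proof (rule bt_elims)
    fix c assume c: "b = BInl c" "bt c Q1"
    from ONB_sum.IH(1)[OF S(1) c(2)] obtain p \<sigma> where "p \<in> S" "c = binst \<sigma> p" by blast
    with c show ?thesis by (intro bexI[of _ "BInl p"] exI[of _ \<sigma>]) auto
  next
    fix c assume c: "b = BInr c" "bt c Q2"
    from ONB_sum.IH(2)[OF S(2) c(2)] obtain p \<sigma> where "p \<in> T" "c = binst \<sigma> p" by blast
    with c show ?thesis by (intro bexI[of _ "BInr p"] exI[of _ \<sigma>]) auto
  qed
next
  case (ONB_nat S)
  have S: "\<forall>p\<in>S. typable (trm_of_bval p) QNat"
    using ONB_nat.prems(1) by (auto dest!: bspec dest: typable_sub)
  from ONB_nat.prems(2) show ?case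
  proof (rule bt_elims)
    fix c assume c: "b = BSuc c" "bt c QNat"
    from ONB_nat.IH[OF S(1) c(2)] obtain p \<sigma> where "p \<in> S" "c = binst \<sigma> p" by blast
    with c show ?thesis by (intro bexI[of _ "BSuc p"] exI[of _ \<sigma>]) auto
  qed auto
next
  case (ONB_tens2 S Q2 Q1)
  have ty: "typable (TTens (trm_of_bval p) (trm_of_bval q)) (QTens Q1 Q2)" if "BTens p q \<in> S" for p q
    using ONB_tens2.prems(1) that by (metis trm_of_bval_simps(5))
  from ONB_tens2.prems(2) obtain b1 b2 where b: "b = BTens b1 b2" "bt b1 Q1" "bt b2 Q2"
    by (rule bt_elims)
  have "\<forall>q\<in>pi2 BTens S. typable (trm_of_bval q) Q2"
    using ty by (auto simp: pi2_def intro: typable_sub)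
  with ONB_tens2.IH(1) b(3) obtain q \<sigma>2 where q: "q \<in> pi2 BTens S" "b2 = binst \<sigma>2 q" by blast
  have "\<forall>p\<in>slice2 BTens S q. typable (trm_of_bval p) Q1"
    using ty by (auto simp: slice2_def intro: typable_sub)
  with ONB_tens2.IH(2) q(1) b(2) obtain p \<sigma>1 where p: "p \<in> slice2 BTens S q" "b1 = binst \<sigma>1 p" by blast
  then have pq: "BTens p q \<in> S" by (simp add: slice2_def)
  from combine_env_bval[OF typable_tens_fv[OF ty[OF pq]]] obtain \<sigma>
    where "binst \<sigma> p = binst \<sigma>1 p" "binst \<sigma> q = binst \<sigma>2 q" .
  with b p q pq show ?case by (intro bexI[of _ "BTens p q"] exI[of _ \<sigma>]) auto
next
  case (ONB_tens1 S Q1 Q2)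
  have ty: "typable (TTens (trm_of_bval p) (trm_of_bval q)) (QTens Q1 Q2)" if "BTens p q \<in> S" for p q
    using ONB_tens1.prems(1) that by (metis trm_of_bval_simps(5))
  from ONB_tens1.prems(2) obtain b1 b2 where b: "b = BTens b1 b2" "bt b1 Q1" "bt b2 Q2"
    by (rule bt_elims)
  have "\<forall>q\<in>pi1 BTens S. typable (trm_of_bval q) Q1"
    using ty by (auto simp: pi1_def intro: typable_sub)
  with ONB_tens1.IH(1) b(2) obtain p \<sigma>1 where p: "p \<in> pi1 BTens S" "b1 = binst \<sigma>1 p" by blast
  have "\<forall>q\<in>slice1 BTens S p. typable (trm_of_bval q) Q2"
    using ty by (auto simp: slice1_def intro: typable_sub)
  with ONB_tens1.IH(2) p(1) b(3) obtain q \<sigma>2 where q: "q \<in> slice1 BTens S p" "b2 = binst \<sigma>2 q" by blast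
  then have pq: "BTens p q \<in> S" by (simp add: slice1_def)
  from combine_env_bval[OF typable_tens_fv[OF ty[OF pq]]] obtain \<sigma>
    where "binst \<sigma> p = binst \<sigma>1 p" "binst \<sigma> q = binst \<sigma>2 q" .
  with b p q pq show ?case by (intro bexI[of _ "BTens p q"] exI[of _ \<sigma>]) auto
qed

section \<open>Orthogonality and span of expression bases\<close>

lemma ONBe_finite: "ONBe Q S \<Longrightarrow> finite S"
proof (induction rule: ONBe.induct)
  case (ONBe_tens2 S Q2 Q1)
  have "S \<subseteq> (\<Union>e'\<in>pi2 ETens S. (\<lambda>e. ETens e e') ` slice2 ETens S e')"
    using ONBe_tens2.hyps(1) by (fastforce simp: pi2_def slice2_def)
  moreover have "finite (\<Union>e'\<in>pi2 ETens S. (\<lambda>e. ETens e e') ` slice2 ETens S e')"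
    using ONBe_tens2.IH by blast
  ultimately show ?case by (rule finite_subset)
next
  case (ONBe_tens1 S Q1 Q2)
  have "S \<subseteq> (\<Union>e\<in>pi1 ETens S. (\<lambda>e'. ETens e e') ` slice1 ETens S e)"
    using ONBe_tens1.hyps(1) by (fastforce simp: pi1_def slice1_def)
  moreover have "finite (\<Union>e\<in>pi1 ETens S. (\<lambda>e'. ETens e e') ` slice1 ETens S e)"
    using ONBe_tens1.IH by blast
  ultimately show ?case by (rule finite_subset)
qed auto

lemma finite_supp_esem: "inst (trm_of_expr e) \<sigma> \<Longrightarrow> finite (supp (esem e \<sigma>))"
  by (rule finite_supp_tsem) simp_all

lemma esem_iso:
  "inst (trm_of_expr e) \<sigma> \<Longrightarrow> inst (trm_of_expr e) \<sigma>' \<Longrightarrow>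
    innr (esem e \<sigma>) (esem e \<sigma>') = (if \<forall>x\<in>fv (trm_of_expr e). \<sigma> x = \<sigma>' x then 1 else 0)"
  by (rule isoD[OF iso_trm]) simp_all

lemma esem_row:
  assumes "distinct xs"
  shows "esem (ESum (map (\<lambda>e'. (\<alpha> e', e')) xs)) \<sigma> = (\<lambda>b. \<Sum>e'\<in>set xs. \<alpha> e' * esem e' \<sigma> b)"
  using tsem_sum_distinct[OF assms, of "\<lambda>_ _ _. 0" \<alpha> trm_of_expr \<sigma>] by (simp add: comp_def)

text \<open>For tensors one factor of the product of inner products vanishes: the outer one if the
  outer components differ, and otherwise the inner one, both inner components lying in the same
  slice. For the unitary rule the inner product is, up to a scalar, that of two rows of the unitary
  matrix.\<close>

lemma ONBe_orth:
  "\<lbrakk>ONBe Q S; e \<in> S; f \<in> S; e \<noteq> f; inst (trm_of_expr e) \<sigma>; inst (trm_of_expr f) \<sigma>'\<rbrakk>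
    \<Longrightarrow> innr (esem e \<sigma>) (esem f \<sigma>') = 0"
proof (induction arbitrary: e f \<sigma> \<sigma>' rule: ONBe.induct)
  case (ONBe_sum Q1 S Q2 T)
  from ONBe_sum.prems(1,2) consider
    e1 f1 where "e = EInl e1" "f = EInl f1" "e1 \<in> S" "f1 \<in> S" |
    e1 f1 where "e = EInr e1" "f = EInr f1" "e1 \<in> T" "f1 \<in> T" |
    e1 f1 where "e = EInl e1" "f = EInr f1" | e1 f1 where "e = EInr e1" "f = EInl f1"
    by auto
  then show ?case
  proof cases
    case 1
    then have "finite (supp (esem e1 \<sigma>))" "inst (trm_of_expr e1) \<sigma>" "inst (trm_of_expr f1) \<sigma>'"
      using ONBe_sum.prems by (auto intro!: finite_supp_esem dest!: inst_sub)
    then show ?thesis using 1 ONBe_sum by (simp add: innr_inlv)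
  next
    case 2
    then have "finite (supp (esem e1 \<sigma>))" "inst (trm_of_expr e1) \<sigma>" "inst (trm_of_expr f1) \<sigma>'"
      using ONBe_sum.prems by (auto intro!: finite_supp_esem dest!: inst_sub)
    then show ?thesis using 2 ONBe_sum by (simp add: innr_inrv)
  qed (auto intro!: innr_disjoint)
next
  case (ONBe_nat S)
  from ONBe_nat.prems(1-3) consider
    e1 f1 where "e = ESuc e1" "f = ESuc f1" "e1 \<in> S" "f1 \<in> S" |
    f1 where "e = EZero" "f = ESuc f1" | e1 where "e = ESuc e1" "f = EZero"
    by auto
  then show ?case
  proof cases
    case 1
    then have "finite (supp (esem e1 \<sigma>))" "inst (trm_of_expr e1) \<sigma>" "inst (trm_of_expr f1) \<sigma>'"
      using ONBe_nat.prems by (auto intro!: finite_supp_esem dest!: inst_sub)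
    then show ?thesis using 1 ONBe_nat by (simp add: innr_sucv)
  qed (auto intro!: innr_disjoint)
next
  case (ONBe_tens2 S Q2 Q1)
  from ONBe_tens2.hyps(1) ONBe_tens2.prems(1,2) obtain e1 e2 f1 f2
    where ef: "e = ETens e1 e2" "f = ETens f1 f2" by blast
  have i: "inst (trm_of_expr e1) \<sigma>" "inst (trm_of_expr e2) \<sigma>"
    "inst (trm_of_expr f1) \<sigma>'" "inst (trm_of_expr f2) \<sigma>'"
    using ONBe_tens2.prems(4,5) unfolding ef by (auto dest: inst_sub)
  have m: "e2 \<in> pi2 ETens S" "f2 \<in> pi2 ETens S" "e1 \<in> slice2 ETens S e2" "f1 \<in> slice2 ETens S f2"
    using ONBe_tens2.prems(1,2) unfolding ef by (auto simp: pi2_def slice2_def)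
  have "innr (esem e1 \<sigma>) (esem f1 \<sigma>') * innr (esem e2 \<sigma>) (esem f2 \<sigma>') = 0"
  proof (cases "e2 = f2")
    case True
    then have "innr (esem e1 \<sigma>) (esem f1 \<sigma>') = 0"
      using ONBe_tens2.IH(2) m i ONBe_tens2.prems(3) ef by blast
    then show ?thesis by simp
  next
    case False
    then show ?thesis using ONBe_tens2.IH(1) m i by simp
  qed
  then show ?case using finite_supp_esem[OF i(1)] finite_supp_esem[OF i(2)]
    by (simp add: ef innr_tensv)
next
  case (ONBe_tens1 S Q1 Q2)
  from ONBe_tens1.hyps(1) ONBe_tens1.prems(1,2) obtain e1 e2 f1 f2
    where ef: "e = ETens e1 e2" "f = ETens f1 f2" by blast
  have i: "inst (trm_of_expr e1) \<sigma>" "inst (trm_of_expr e2) \<sigma>"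
    "inst (trm_of_expr f1) \<sigma>'" "inst (trm_of_expr f2) \<sigma>'"
    using ONBe_tens1.prems(4,5) unfolding ef by (auto dest: inst_sub)
  have m: "e1 \<in> pi1 ETens S" "f1 \<in> pi1 ETens S" "e2 \<in> slice1 ETens S e1" "f2 \<in> slice1 ETens S f1"
    using ONBe_tens1.prems(1,2) unfolding ef by (auto simp: pi1_def slice1_def)
  have "innr (esem e1 \<sigma>) (esem f1 \<sigma>') * innr (esem e2 \<sigma>) (esem f2 \<sigma>') = 0"
  proof (cases "e1 = f1")
    case True
    then have "innr (esem e2 \<sigma>) (esem f2 \<sigma>') = 0"
      using ONBe_tens1.IH(2) m i ONBe_tens1.prems(3) ef by blast
    then show ?thesis by simp
  next
    case False
    then show ?thesis using ONBe_tens1.IH(1) m i by simp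
  qed
  then show ?case using finite_supp_esem[OF i(1)] finite_supp_esem[OF i(2)]
    by (simp add: ef innr_tensv)
next
  case (ONBe_unitary Q S \<alpha> enum)
  let ?row = "\<lambda>e. ESum (map (\<lambda>e'. (\<alpha> e e', e')) (enum e))"
  from ONBe_unitary.prems(1-3) obtain g h where gh: "g \<in> S" "h \<in> S" "e = ?row g" "f = ?row h" "g \<noteq> h"
    by blast
  have enum: "distinct (enum g)" "set (enum g) = S" "distinct (enum h)" "set (enum h) = S"
    using ONBe_unitary.hyps(3) gh by auto
  have e: "trm_of_expr e = TSum (map (\<lambda>e'. (\<alpha> g e', trm_of_expr e')) (enum g))"
    and f: "trm_of_expr f = TSum (map (\<lambda>e'. (\<alpha> h e', trm_of_expr e')) (enum h))"
    unfolding gh by (simp_all add: comp_def)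
  \<comment> \<open>As for sums of terms, the elements of \<open>S\<close> occur in one typed sum
    and so share their free variables; the inner products under the two environments are this scalar
    times the identity.\<close>
  let ?\<kappa> = "if \<forall>x\<in>fv (trm_of_expr e). \<sigma> x = \<sigma>' x then 1 else 0 :: complex"
  have i: "inst (trm_of_expr k) \<sigma>" "inst (trm_of_expr k) \<sigma>'" "fv (trm_of_expr k) = fv (trm_of_expr e)"
    if "k \<in> S" for k
  proof -
    \<comment> \<open>Every row lists the whole of \<open>S\<close>, zero coefficients included, so
      each \<open>k\<close> is a summand of both rows and is instantiated by both
      environments.\<close>
    have k: "(\<alpha> g k, trm_of_expr k) \<in> set (map (\<lambda>e'. (\<alpha> g e', trm_of_expr e')) (enum g))"
      "(\<alpha> h k, trm_of_expr k) \<in> set (map (\<lambda>e'. (\<alpha> h e', trm_of_expr e')) (enum h))"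
      using that enum by auto
    show "inst (trm_of_expr k) \<sigma>"
      using inst_sub(7)[OF ONBe_unitary.prems(4)[unfolded e] k(1)] by simp
    show "inst (trm_of_expr k) \<sigma>'"
      using inst_sub(7)[OF ONBe_unitary.prems(5)[unfolded f] k(2)] by simp
    show "fv (trm_of_expr k) = fv (trm_of_expr e)"
      using inst_sum_fv[OF ONBe_unitary.prems(4)[unfolded e] k(1)] e by simp
  qed
  have ip: "innr (esem k \<sigma>) (esem l \<sigma>') = (if k = l then ?\<kappa> else 0)" if "k \<in> S" "l \<in> S" for k l
  proof (cases "k = l")
    case True
    then show ?thesis using esem_iso[OF i(1,2)] i(3) that by simp
  next
    case False
    then show ?thesis using ONBe_unitary.IH i that by simp
  qed
  have fin: "finite S" using ONBe_unitary.hyps(1) by (rule ONBe_finite)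
  have ef: "esem e \<sigma> = (\<lambda>b. \<Sum>k\<in>S. \<alpha> g k * esem k \<sigma> b)"
    "esem f \<sigma>' = (\<lambda>b. \<Sum>k\<in>S. \<alpha> h k * esem k \<sigma>' b)"
    unfolding gh(3,4) using esem_row[of _ "\<alpha> g"] esem_row[of _ "\<alpha> h"] enum by simp_all
  have "innr (esem e \<sigma>) (esem f \<sigma>') =
      (\<Sum>k\<in>S. \<Sum>l\<in>S. cnj (\<alpha> g k) * \<alpha> h l * innr (esem k \<sigma>) (esem l \<sigma>'))"
    unfolding ef by (rule innr_sum_sum) (use fin i finite_supp_esem in auto)
  also have "\<dots> = (\<Sum>k\<in>S. \<Sum>l\<in>S. if k = l then cnj (\<alpha> g k) * \<alpha> h l * ?\<kappa> else 0)"
    by (intro sum.cong refl) (simp add: ip)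
  also have "\<dots> = (\<Sum>k\<in>S. cnj (\<alpha> g k) * \<alpha> h k * ?\<kappa>)"
    using fin by (intro sum.cong refl) (simp add: sum.delta)
  also have "\<dots> = cnj (\<Sum>k\<in>S. \<alpha> g k * cnj (\<alpha> h k)) * ?\<kappa>"
    by (simp add: sum_distrib_right)
  also have "\<dots> = 0"
    using ONBe_unitary.hyps(2) gh(1,2,5) by (simp add: unitary_on_def)
  finally show ?case .
qed auto

text \<open>The environments are unrestricted, which lets the induction ignore contexts; instances
  that do not fit their context are removed later by \<open>lspan_restrict\<close>. For tensors the
  ket of the outer factor is expanded first, and then, for each of its generators, the other ket
  within the corresponding slice.\<close>

lemma ONBe_span:
  "\<lbrakk>ONBe Q S; \<forall>e\<in>S. typable (trm_of_expr e) Q; bt b Q\<rbrakk>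
    \<Longrightarrow> ket b \<in> lspan {esem e \<sigma> |e \<sigma>. e \<in> S}"
proof (induction arbitrary: b rule: ONBe.induct)
  case (ONBe_var Q x)
  have "ket b = esem (EVar x) (\<lambda>_. b)" by simp
  then show ?case by (intro lspan_base) blast
next
  case ONBe_unit
  then have "ket b = esem EUnit \<sigma>" for \<sigma> by (auto elim: bt_elims)
  then show ?case by (intro lspan_base) blast
next
  case (ONBe_sum Q1 S Q2 T)
  let ?W = "{esem e \<sigma> |e \<sigma>. e \<in> EInl ` S \<union> EInr ` T}"
  have S: "\<forall>p\<in>S. typable (trm_of_expr p) Q1" "\<forall>p\<in>T. typable (trm_of_expr p) Q2"
    using ONBe_sum.prems(1) by (auto dest!: bspec dest: typable_sub)
  have "inlv (esem e \<sigma>) = esem (EInl e) \<sigma>" "inrv (esem e \<sigma>) = esem (EInr e) \<sigma>" for e \<sigma>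
    by simp_all
  then have W: "e \<in> S \<Longrightarrow> inlv (esem e \<sigma>) \<in> lspan ?W" "e \<in> T \<Longrightarrow> inrv (esem e \<sigma>) \<in> lspan ?W" for e \<sigma>
    by (blast intro: lspan_base)+
  from ONBe_sum.prems(2) show ?case
  proof (rule bt_elims)
    fix c assume c: "b = BInl c" "bt c Q1"
    show ?thesis unfolding c(1) ket_constructor[symmetric]
      using ONBe_sum.IH(1)[OF S(1) c(2)] by (rule lspan_inlv) (elim CollectE exE conjE, hypsubst, rule W, assumption)
  next
    fix c assume c: "b = BInr c" "bt c Q2"
    show ?thesis unfolding c(1) ket_constructor[symmetric]
      using ONBe_sum.IH(2)[OF S(2) c(2)] by (rule lspan_inrv) (elim CollectE exE conjE, hypsubst, rule W, assumption)
  qed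
next
  case (ONBe_nat S)
  let ?W = "{esem e \<sigma> |e \<sigma>. e \<in> {EZero} \<union> ESuc ` S}"
  have S: "\<forall>p\<in>S. typable (trm_of_expr p) QNat"
    using ONBe_nat.prems(1) by (auto dest!: bspec dest: typable_sub)
  have "sucv (esem e \<sigma>) = esem (ESuc e) \<sigma>" "ket BZero = esem EZero \<sigma>" for e \<sigma>
    by simp_all
  then have W: "e \<in> S \<Longrightarrow> sucv (esem e \<sigma>) \<in> lspan ?W" "ket BZero \<in> lspan ?W" for e \<sigma>
    by (blast intro: lspan_base)+
  from ONBe_nat.prems(2) show ?case
  proof (rule bt_elims)
    fix c assume c: "b = BSuc c" "bt c QNat"
    show ?thesis unfolding c(1) ket_constructor[symmetric]
      using ONBe_nat.IH(1)[OF S(1) c(2)] by (rule lspan_sucv) (elim CollectE exE conjE, hypsubst, rule W, assumption)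
  qed (use W in simp)
next
  case (ONBe_tens2 S Q2 Q1)
  let ?W = "{esem e \<sigma> |e \<sigma>. e \<in> S}"
  have ty: "typable (TTens (trm_of_expr p) (trm_of_expr q)) (QTens Q1 Q2)" if "ETens p q \<in> S" for p q
    using ONBe_tens2.prems(1) that by (metis trm_of_expr.simps(5))
  have W: "tensv (esem p \<sigma>1) (esem q \<sigma>2) \<in> lspan ?W" if pq: "ETens p q \<in> S" for p q \<sigma>1 \<sigma>2
  proof -
    from combine_env[OF typable_tens_fv[OF ty[OF pq]]] obtain \<sigma>
      where "esem p \<sigma> = esem p \<sigma>1" "esem q \<sigma> = esem q \<sigma>2" .
    then have "tensv (esem p \<sigma>1) (esem q \<sigma>2) = esem (ETens p q) \<sigma>" by simp
    then show ?thesis using pq by (intro lspan_base) blast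
  qed
  from ONBe_tens2.prems(2) obtain b1 b2 where b: "b = BTens b1 b2" "bt b1 Q1" "bt b2 Q2"
    by (rule bt_elims)
  have "\<forall>q\<in>pi2 ETens S. typable (trm_of_expr q) Q2"
    using ty by (auto simp: pi2_def intro: typable_sub)
  then have 2: "ket b2 \<in> lspan {esem e \<sigma> |e \<sigma>. e \<in> pi2 ETens S}"
    using ONBe_tens2.IH(1) b(3) by blast
  have "tensv (ket b1) (esem q \<sigma>2) \<in> lspan ?W" if q: "q \<in> pi2 ETens S" for q \<sigma>2
  proof -
    have "\<forall>p\<in>slice2 ETens S q. typable (trm_of_expr p) Q1"
      using ty by (auto simp: slice2_def intro: typable_sub)
    then have "ket b1 \<in> lspan {esem e \<sigma> |e \<sigma>. e \<in> slice2 ETens S q}"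
      using ONBe_tens2.IH(2) b(2) q by blast
    then show ?thesis by (rule lspan_tensv) (use W in \<open>auto simp: slice2_def\<close>)
  qed
  then show ?case unfolding b(1) ket_constructor[symmetric]
    by (intro lspan_tensv_right[OF 2]) auto
next
  case (ONBe_tens1 S Q1 Q2)
  let ?W = "{esem e \<sigma> |e \<sigma>. e \<in> S}"
  have ty: "typable (TTens (trm_of_expr p) (trm_of_expr q)) (QTens Q1 Q2)" if "ETens p q \<in> S" for p q
    using ONBe_tens1.prems(1) that by (metis trm_of_expr.simps(5))
  have W: "tensv (esem p \<sigma>1) (esem q \<sigma>2) \<in> lspan ?W" if pq: "ETens p q \<in> S" for p q \<sigma>1 \<sigma>2
  proof -
    from combine_env[OF typable_tens_fv[OF ty[OF pq]]] obtain \<sigma>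
      where "esem p \<sigma> = esem p \<sigma>1" "esem q \<sigma> = esem q \<sigma>2" .
    then have "tensv (esem p \<sigma>1) (esem q \<sigma>2) = esem (ETens p q) \<sigma>" by simp
    then show ?thesis using pq by (intro lspan_base) blast
  qed
  from ONBe_tens1.prems(2) obtain b1 b2 where b: "b = BTens b1 b2" "bt b1 Q1" "bt b2 Q2"
    by (rule bt_elims)
  have "\<forall>p\<in>pi1 ETens S. typable (trm_of_expr p) Q1"
    using ty by (auto simp: pi1_def intro: typable_sub)
  then have 1: "ket b1 \<in> lspan {esem e \<sigma> |e \<sigma>. e \<in> pi1 ETens S}"
    using ONBe_tens1.IH(1) b(2) by blast
  have "tensv (esem p \<sigma>1) (ket b2) \<in> lspan ?W" if p: "p \<in> pi1 ETens S" for p \<sigma>1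
  proof -
    have "\<forall>q\<in>slice1 ETens S p. typable (trm_of_expr q) Q2"
      using ty by (auto simp: slice1_def intro: typable_sub)
    then have "ket b2 \<in> lspan {esem e \<sigma> |e \<sigma>. e \<in> slice1 ETens S p}"
      using ONBe_tens1.IH(2) b(3) p by blast
    then show ?thesis by (rule lspan_tensv_right) (use W in \<open>auto simp: slice1_def\<close>)
  qed
  then show ?case unfolding b(1) ket_constructor[symmetric]
    by (intro lspan_tensv[OF 1]) auto
next
  case (ONBe_unitary Q S \<alpha> enum)
  let ?row = "\<lambda>e. ESum (map (\<lambda>e'. (\<alpha> e e', e')) (enum e))"
  have fin: "finite S" using ONBe_unitary.hyps(1) by (rule ONBe_finite)
  have ty: "\<forall>e\<in>S. typable (trm_of_expr e) Q"
  proof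
    fix e assume e: "e \<in> S"
    then have "typable (trm_of_expr (?row e)) Q" using ONBe_unitary.prems(1) by blast
    then have "typable (TSum (map (\<lambda>e'. (\<alpha> e e', trm_of_expr e')) (enum e))) Q"
      by (simp add: comp_def)
    \<comment> \<open>Typability of \<open>e\<close> is read off its own row, in which
      \<open>e\<close> is one of the summands.\<close>
    moreover have "(\<alpha> e e, trm_of_expr e) \<in> set (map (\<lambda>e'. (\<alpha> e e', trm_of_expr e')) (enum e))"
      using e ONBe_unitary.hyps(3) by auto
    ultimately show "typable (trm_of_expr e) Q" using typable_sub(6) by fastforce
  qed
  have row: "esem (?row e) \<sigma> = (\<lambda>b. \<Sum>k\<in>S. \<alpha> e k * esem k \<sigma> b)" if "e \<in> S" for e \<sigma>
    using esem_row[of "enum e" "\<alpha> e"] that ONBe_unitary.hyps(3) by simp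
  \<comment> \<open>The conjugate transpose inverts the change of basis: this is the column half of
    \<open>unitary_on\<close>. It recovers the old vectors from the rows, under the same
    environment.\<close>
  have inv: "esem k \<sigma> = (\<lambda>b. \<Sum>e\<in>S. cnj (\<alpha> e k) * esem (?row e) \<sigma> b)" if "k \<in> S" for k \<sigma>
  proof
    fix b
    have "(\<Sum>e\<in>S. cnj (\<alpha> e k) * esem (?row e) \<sigma> b) =
        (\<Sum>e\<in>S. cnj (\<alpha> e k) * (\<Sum>l\<in>S. \<alpha> e l * esem l \<sigma> b))"
      by (intro sum.cong refl) (simp only: row)
    also have "\<dots> = (\<Sum>l\<in>S. (\<Sum>e\<in>S. cnj (\<alpha> e k) * \<alpha> e l) * esem l \<sigma> b)"
      unfolding sum_distrib_left sum_distrib_right by (subst sum.swap) (simp add: mult_ac)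
    also have "\<dots> = (\<Sum>l\<in>S. if k = l then esem l \<sigma> b else 0)"
      using ONBe_unitary.hyps(2) that by (intro sum.cong refl) (simp add: unitary_on_def)
    also have "\<dots> = esem k \<sigma> b" using that fin by (simp add: sum.delta)
    finally show "esem k \<sigma> b = (\<Sum>e\<in>S. cnj (\<alpha> e k) * esem (?row e) \<sigma> b)" ..
  qed
  have span: "esem k \<sigma> \<in> lspan {esem e \<sigma> |e \<sigma>. e \<in> ?row ` S}" if "k \<in> S" for k \<sigma>
    by (subst inv[OF that], rule lspan_sum[OF fin]) (blast intro: lspan_base)
  show ?case
    by (rule lspan_trans[OF ONBe_unitary.IH[OF ty ONBe_unitary.prems(2)]])
       (elim CollectE exE conjE, hypsubst, rule span, assumption)
qed

section \<open>Denotation of unitaries\<close>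

text \<open>For well-typed clauses the choice is immaterial: the orthonormal basis of patterns makes the
  matching clause unique.\<close>

definition clause_mat :: "(bval \<times> expr) list \<Rightarrow> bval \<Rightarrow> vec" where
  "clause_mat cs b =
     (if \<exists>p e \<sigma>. (p, e) \<in> set cs \<and> b = binst \<sigma> p
      then (case SOME (p, e, \<sigma>). (p, e) \<in> set cs \<and> b = binst \<sigma> p of (p, e, \<sigma>) \<Rightarrow> esem e \<sigma>)
      else (\<lambda>_. 0))"

definition tens_mat :: "(bval \<Rightarrow> vec) \<Rightarrow> (bval \<Rightarrow> vec) \<Rightarrow> bval \<Rightarrow> vec" where
  "tens_mat M N b = (case b of BTens b1 b2 \<Rightarrow> tensv (M b1) (N b2) | _ \<Rightarrow> (\<lambda>_. 0))"

definition plus_mat :: "(bval \<Rightarrow> vec) \<Rightarrow> (bval \<Rightarrow> vec) \<Rightarrow> bval \<Rightarrow> vec" where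
  "plus_mat M N b = (case b of BInl c \<Rightarrow> inlv (M c) | BInr c \<Rightarrow> inrv (N c) | _ \<Rightarrow> (\<lambda>_. 0))"

definition ctrl_mat :: "(bval \<Rightarrow> vec) \<Rightarrow> bval \<Rightarrow> vec" where
  "ctrl_mat M b =
     (case b of
        BTens c d \<Rightarrow>
          if c = BInl BUnit then tensv (ket c) (ket d)
          else if c = BInr BUnit then tensv (ket c) (M d) else (\<lambda>_. 0)
      | _ \<Rightarrow> (\<lambda>_. 0))"

primrec semu :: "uni \<Rightarrow> bval \<Rightarrow> vec" where
  "semu (Clauses cs) = clause_mat cs"
| "semu (UTens u v) = tens_mat (semu u) (semu v)"
| "semu (UPlus u v) = plus_mat (semu u) (semu v)"
| "semu (UComp u v) = (\<lambda>b. appv (semu u) (semu v b))"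
| "semu (UStar u) = adj (semu u)"
| "semu (UCtrl u) = ctrl_mat (semu u)"

section \<open>Adjoints and isometries under the unitary constructors\<close>

lemma adj_adj [simp]: "adj (adj M) = M"
  by (simp add: adj_def)

text \<open>True for arbitrary matrices: both sides sum conjugate terms over the same set of
  indices, so the default value for infinite sums agrees as well.\<close>

lemma adj_comp: "adj (\<lambda>b. appv M (N b)) = (\<lambda>b. appv (adj N) (adj M b))"
proof (intro ext)
  fix b c
  have s: "{d. N c d * M d b \<noteq> 0} = {d. cnj (M d b) * cnj (N c d) \<noteq> 0}" by auto
  show "adj (\<lambda>b. appv M (N b)) b c = appv (adj N) (adj M b) c"
    unfolding adj_def appv_def Sum_any.expand_set s by (simp add: mult.commute)
qed

lemma adj_tens: "adj (tens_mat M N) = tens_mat (adj M) (adj N)"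
  by (auto simp: fun_eq_iff adj_def tens_mat_def tensv_def split: bval.splits)

lemma adj_plus: "adj (plus_mat M N) = plus_mat (adj M) (adj N)"
  by (auto simp: fun_eq_iff adj_def plus_mat_def inlv_def inrv_def split: bval.splits)

lemma adj_ctrl: "adj (ctrl_mat M) = ctrl_mat (adj M)"
proof (intro ext)
  fix b c show "adj (ctrl_mat M) b c = ctrl_mat (adj M) b c"
    by (cases b; cases c) (auto simp: adj_def ctrl_mat_def ket_def)
qed

lemma isom_comp:
  assumes "isom N Q1 Q2" "isom M Q2 Q3"
  shows "isom (\<lambda>b. appv M (N b)) Q1 Q3"
  unfolding isom_def
proof (intro conjI allI impI)
  fix b c assume "appv M (N b) c \<noteq> 0"
  then obtain d where "N b d \<noteq> 0" "M d c \<noteq> 0" using supp_appv[of c M "N b"] by (auto simp: supp_def)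
  then show "bt b Q1 \<longleftrightarrow> bt c Q3" using isomD(1)[OF assms(1)] isomD(1)[OF assms(2)] by blast
next
  fix b assume b: "bt b Q1"
  have "bt d Q2" if "d \<in> supp (N b)" for d
    using isomD(1)[OF assms(1)] that b by (auto simp: supp_def)
  then show "finite (supp (appv M (N b)))"
    using isomD(2)[OF assms(1) b] isomD(2)[OF assms(2)] by (intro finite_supp_appv) auto
next
  fix b c assume bc: "bt b Q1" "bt c Q1"
  have "innr (appv M (N b)) (appv M (N c)) = innr (N b) (N c)"
  proof (rule innr_appv[OF assms(2) assms(2)])
    show "finite (supp (N b))" "finite (supp (N c))" using bc isomD(2)[OF assms(1)] by auto
    show "d \<in> supp (N b) \<Longrightarrow> bt d Q2" "d \<in> supp (N c) \<Longrightarrow> bt d Q2" for d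
      using isomD(1)[OF assms(1)] bc by (auto simp: supp_def)
  qed
  then show "innr (appv M (N b)) (appv M (N c)) = (if b = c then 1 else 0)"
    using isomD(3)[OF assms(1) bc] by simp
qed

lemma isom_tens:
  assumes "isom M Q1 Q2" "isom N Q3 Q4"
  shows "isom (tens_mat M N) (QTens Q1 Q3) (QTens Q2 Q4)"
  unfolding isom_def
proof (intro conjI allI impI)
  fix b c assume "tens_mat M N b c \<noteq> 0"
  then show "bt b (QTens Q1 Q3) \<longleftrightarrow> bt c (QTens Q2 Q4)"
    using isomD(1)[OF assms(1)] isomD(1)[OF assms(2)]
    by (cases b; cases c) (auto simp: tens_mat_def)
next
  fix b assume "bt b (QTens Q1 Q3)"
  then show "finite (supp (tens_mat M N b))"
    by (rule bt_elims) (auto simp: tens_mat_def isomD(2)[OF assms(1)] isomD(2)[OF assms(2)])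
next
  fix b c assume "bt b (QTens Q1 Q3)" "bt c (QTens Q1 Q3)"
  then show "innr (tens_mat M N b) (tens_mat M N c) = (if b = c then 1 else 0)"
    by (elim bt_elims) (auto simp: tens_mat_def innr_tensv
        isomD(2,3)[OF assms(1)] isomD(2,3)[OF assms(2)])
qed

lemma isom_plus:
  assumes "isom M Q1 Q2" "isom N Q3 Q4"
  shows "isom (plus_mat M N) (QSum Q1 Q3) (QSum Q2 Q4)"
  unfolding isom_def
proof (intro conjI allI impI)
  fix b c assume "plus_mat M N b c \<noteq> 0"
  then show "bt b (QSum Q1 Q3) \<longleftrightarrow> bt c (QSum Q2 Q4)"
    using isomD(1)[OF assms(1)] isomD(1)[OF assms(2)]
    by (cases b; cases c) (auto simp: plus_mat_def)
next
  fix b assume "bt b (QSum Q1 Q3)"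
  then show "finite (supp (plus_mat M N b))"
    by (rule bt_elims) (auto simp: plus_mat_def isomD(2)[OF assms(1)] isomD(2)[OF assms(2)])
next
  fix b c assume "bt b (QSum Q1 Q3)" "bt c (QSum Q1 Q3)"
  then show "innr (plus_mat M N b) (plus_mat M N c) = (if b = c then 1 else 0)"
    by (elim bt_elims) (auto simp: plus_mat_def innr_inlv innr_inrv
        isomD(2,3)[OF assms(1)] isomD(2,3)[OF assms(2)] intro!: innr_disjoint)
qed

lemma bt_qbit: "bt b qbit \<longleftrightarrow> b = BInl BUnit \<or> b = BInr BUnit"
  by (auto elim!: bt_elims)

lemma isom_ctrl:
  assumes "isom M Q Q"
  shows "isom (ctrl_mat M) (QTens qbit Q) (QTens qbit Q)"
  unfolding isom_def
proof (intro conjI allI impI)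
  fix b c assume "ctrl_mat M b c \<noteq> 0"
  then show "bt b (QTens qbit Q) \<longleftrightarrow> bt c (QTens qbit Q)"
    using isomD(1)[OF assms]
    by (cases b; cases c) (auto simp: ctrl_mat_def ket_def bt_qbit split: if_splits)
next
  fix b assume "bt b (QTens qbit Q)"
  then show "finite (supp (ctrl_mat M b))"
    by (rule bt_elims) (auto simp: ctrl_mat_def bt_qbit isomD(2)[OF assms])
next
  fix b c assume "bt b (QTens qbit Q)" "bt c (QTens qbit Q)"
  then show "innr (ctrl_mat M b) (ctrl_mat M c) = (if b = c then 1 else 0)"
    by (elim bt_elims) (auto simp: ctrl_mat_def bt_qbit innr_tensv innr_ket isomD(2,3)[OF assms])
qed

text \<open>The rows of a matrix are orthonormal and finitely supported because its columns are orthonormal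
  and span: the coefficients in a finite expansion of a basis vector are the entries of its row.\<close>

lemma isom_adj:
  assumes M: "isom M Q1 Q2" and span: "\<And>c. bt c Q2 \<Longrightarrow> ket c \<in> lspan (M ` {b. bt b Q1})"
  shows "isom (adj M) Q2 Q1"
proof -
  have rows: "\<exists>A. finite A \<and> supp (adj M c) \<subseteq> A \<and> ket c = (\<lambda>x. \<Sum>b\<in>A. cnj (M b c) * M b x)"
    if c: "bt c Q2" for c
  proof -
    from lspan_image_sum[OF span[OF c]] obtain A k
      where A: "finite A" "A \<subseteq> {b. bt b Q1}" "ket c = (\<lambda>x. \<Sum>b\<in>A. k b * M b x)" by blast
    \<comment> \<open>Pairing the expansion of \<open>ket c\<close> with the column
      \<open>M b\<close> isolates the coefficient of \<open>b\<close>, by orthonormality of the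
      columns. As the expansion is finite, so is the row.\<close>
    have *: "cnj (M b c) = (if b \<in> A then k b else 0)" if b: "bt b Q1" for b
    proof -
      have "cnj (M b c) = innr (M b) (\<lambda>x. \<Sum>d\<in>A. k d * M d x)"
        unfolding A(3)[symmetric] by (simp add: innr_ket_right)
      also have "\<dots> = (\<Sum>d\<in>A. k d * innr (M b) (M d))"
        by (rule innr_sum_right) (use A isomD(2)[OF M] in auto)
      also have "\<dots> = (\<Sum>d\<in>A. if b = d then k d else 0)"
        using A(2) b by (intro sum.cong refl) (auto simp: isomD(3)[OF M])
      finally show ?thesis using A(1) by (simp add: sum.delta)
    qed
    have "supp (adj M c) \<subseteq> A"
    proof
      fix b assume "b \<in> supp (adj M c)"
      then have b: "M b c \<noteq> 0" by (simp add: supp_def adj_def)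
      then have "bt b Q1" using isomD(1)[OF M b] c by simp
      then show "b \<in> A" using *[of b] b by (auto split: if_splits)
    qed
    moreover have "ket c = (\<lambda>x. \<Sum>b\<in>A. cnj (M b c) * M b x)"
    proof -
      have "(\<Sum>b\<in>A. k b * M b x) = (\<Sum>b\<in>A. cnj (M b c) * M b x)" for x
        using A(2) by (intro sum.cong refl) (auto simp: *)
      then show ?thesis using A(3) by simp
    qed
    ultimately show ?thesis using A(1) by blast
  qed
  show ?thesis
    unfolding isom_def
  proof (intro conjI allI impI)
    fix b c assume "adj M b c \<noteq> 0"
    then show "bt b Q2 \<longleftrightarrow> bt c Q1" using isomD(1)[OF M, of c b] by (auto simp: adj_def)
  next
    fix b assume "bt b Q2"
    then show "finite (supp (adj M b))" using rows[of b] finite_subset by blast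
  next
    fix b c assume "bt b Q2" "bt c Q2"
    from rows[OF \<open>bt b Q2\<close>] obtain A where A: "finite A" "supp (adj M b) \<subseteq> A"
      "ket b = (\<lambda>x. \<Sum>d\<in>A. cnj (M d b) * M d x)" by blast
    \<comment> \<open>The expansion of \<open>ket b\<close> along its row, evaluated at
      \<open>c\<close>, is the conjugate of the inner product of the rows at \<open>b\<close> and
      \<open>c\<close>.\<close>
    have "innr (adj M b) (adj M c) = cnj (\<Sum>d\<in>A. cnj (M d b) * M d c)"
      by (subst innr_left[OF A(1,2)]) (simp add: adj_def)
    also have "\<dots> = cnj (ket b c)" by (subst A(3)) simp
    finally show "innr (adj M b) (adj M c) = (if b = c then 1 else 0)" by (auto simp: ket_def)
  qed
qed

section \<open>The matrix of a set of clauses\<close>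

context
  fixes cs Q1 Q2
  assumes cs: "wtu (Clauses cs) Q1 Q2"
begin

text \<open>Pattern and expression are typed in one common context, so the condition
  \<open>sat\<close> links the type of an instantiated pattern to the type of the basis values in
  the instantiated expression.\<close>

lemma clause_typing:
  assumes "(p, e) \<in> set cs"
  shows "\<exists>\<Gamma>. wt \<Gamma> (trm_of_bval p) Q1 \<and> wt \<Gamma> (trm_of_expr e) Q2 \<and>
    (\<forall>\<sigma>. bt (binst \<sigma> p) Q1 \<longleftrightarrow> sat \<Gamma> \<sigma>) \<and>
    (\<forall>\<sigma> b. esem e \<sigma> b \<noteq> 0 \<longrightarrow> (bt b Q2 \<longleftrightarrow> sat \<Gamma> \<sigma>)) \<and>
    fv (trm_of_bval p) = fv (trm_of_expr e)"
proof -
  from cs assms obtain \<Gamma> where \<Gamma>: "wt \<Gamma> (trm_of_bval p) Q1" "wt \<Gamma> (trm_of_expr e) Q2"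
    by (auto elim!: wtu_clausesE)
  have "bt (binst \<sigma> p) Q1 \<longleftrightarrow> sat \<Gamma> \<sigma>" for \<sigma>
    using tsem_typed[OF \<Gamma>(1), of "\<lambda>_ _ _. 0" \<sigma> "binst \<sigma> p"] by (simp add: tsem_bval ket_def)
  moreover have "esem e \<sigma> b \<noteq> 0 \<Longrightarrow> bt b Q2 \<longleftrightarrow> sat \<Gamma> \<sigma>" for \<sigma> b
    using tsem_typed[OF \<Gamma>(2)] by simp
  moreover have "fv (trm_of_bval p) = fv (trm_of_expr e)"
    using dom_eq_fv[OF \<Gamma>(1)] dom_eq_fv[OF \<Gamma>(2)] by simp
  ultimately show ?thesis using \<Gamma> by blast
qed

lemma clause_unique:
  assumes "(p, e) \<in> set cs" "(q, f) \<in> set cs" "binst \<sigma> p = binst \<sigma>' q"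
  shows "p = q" "e = f"
proof -
  from cs have *: "ONB Q1 (set (map fst cs))" "distinct (map fst cs)" by (auto elim!: wtu_clausesE)
  have "p \<in> set (map fst cs)" "q \<in> set (map fst cs)" using assms by force+
  from ONB_unique[OF *(1) this assms(3)] show "p = q" .
  then show "e = f" using assms *(2) by (meson eq_key_imp_eq_value)
qed

lemma clause_mat_eq:
  assumes "(p, e) \<in> set cs"
  shows "clause_mat cs (binst \<sigma> p) = esem e \<sigma>"
proof -
  obtain q f \<sigma>' where s: "(SOME (q, f, \<sigma>'). (q, f) \<in> set cs \<and> binst \<sigma> p = binst \<sigma>' q) = (q, f, \<sigma>')"
    using prod_cases3 by blast
  have "case SOME (q, f, \<sigma>'). (q, f) \<in> set cs \<and> binst \<sigma> p = binst \<sigma>' q of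
      (q, f, \<sigma>') \<Rightarrow> (q, f) \<in> set cs \<and> binst \<sigma> p = binst \<sigma>' q"
    by (rule someI[of _ "(p, e, \<sigma>)"]) (use assms in simp)
  then have q: "(q, f) \<in> set cs" "binst \<sigma> p = binst \<sigma>' q" unfolding s by simp_all
  with clause_unique[OF assms q] have [simp]: "q = p" "f = e" by simp_all
  obtain \<Gamma> where "fv (trm_of_bval p) = fv (trm_of_expr e)" using clause_typing[OF assms] by blast
  \<comment> \<open>The chosen environment may differ from \<open>\<sigma>\<close>, but not on the
    variables of the pattern, and these are the variables of the expression.\<close>
  with q(2) have "esem e \<sigma> = esem e \<sigma>'" by (intro tsem_cong_fv) (auto simp: binst_eq_iff)
  then show ?thesis using assms s by (auto simp: clause_mat_def)
qed

lemma clause_mat_zero: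
  "\<nexists>p e \<sigma>. (p, e) \<in> set cs \<and> b = binst \<sigma> p \<Longrightarrow> clause_mat cs b = (\<lambda>_. 0)"
  by (auto simp: clause_mat_def)

lemma clause_match:
  assumes "bt b Q1"
  obtains p e \<sigma> where "(p, e) \<in> set cs" "b = binst \<sigma> p"
proof -
  from cs have *: "ONB Q1 (set (map fst cs))" "\<forall>p\<in>set (map fst cs). typable (trm_of_bval p) Q1"
    by (auto elim!: wtu_clausesE simp: typable_def)
  from ONB_matches[OF this assms] show thesis using that by auto
qed

text \<open>Two basis values matching one clause are compared by isometry of its expression: the
  environments agree on the variables exactly when the instances of the pattern coincide. If they
  match different clauses, the expressions are orthogonal and the patterns do not overlap.\<close>

lemma isom_clauses: "isom (clause_mat cs) Q1 Q2"
  unfolding isom_def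
proof (intro conjI allI impI)
  fix b c assume nz: "clause_mat cs b c \<noteq> 0"
  then obtain p e \<sigma> where p: "(p, e) \<in> set cs" "b = binst \<sigma> p"
    by (metis clause_mat_zero)
  from clause_typing[OF p(1)] obtain \<Gamma> where \<Gamma>: "\<forall>\<sigma>. bt (binst \<sigma> p) Q1 \<longleftrightarrow> sat \<Gamma> \<sigma>"
    "\<forall>\<sigma> b. esem e \<sigma> b \<noteq> 0 \<longrightarrow> (bt b Q2 \<longleftrightarrow> sat \<Gamma> \<sigma>)"
    by (elim exE conjE)
  have "esem e \<sigma> c \<noteq> 0" using nz unfolding p(2) clause_mat_eq[OF p(1)] .
  then show "bt b Q1 \<longleftrightarrow> bt c Q2" using \<Gamma> p(2) by blast
next
  fix b assume b: "bt b Q1"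
  then obtain p e \<sigma> where p: "(p, e) \<in> set cs" "b = binst \<sigma> p" by (rule clause_match)
  obtain \<Gamma> where "wt \<Gamma> (trm_of_expr e) Q2" "sat \<Gamma> \<sigma>"
    using clause_typing[OF p(1)] b p(2) by metis
  then show "finite (supp (clause_mat cs b))"
    using p clause_mat_eq[OF p(1)] finite_supp_esem[OF instI] by simp
next
  fix b c assume bc: "bt b Q1" "bt c Q1"
  obtain p e \<sigma> where p: "(p, e) \<in> set cs" "b = binst \<sigma> p" using bc(1) by (rule clause_match)
  obtain q f \<sigma>' where q: "(q, f) \<in> set cs" "c = binst \<sigma>' q" using bc(2) by (rule clause_match)
  have ie: "inst (trm_of_expr e) \<sigma>" "fv (trm_of_bval p) = fv (trm_of_expr e)"
    using clause_typing[OF p(1)] bc(1) p(2) by (metis instI)+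
  have fi: "inst (trm_of_expr f) \<sigma>'"
    using clause_typing[OF q(1)] bc(2) q(2) by (metis instI)
  have "innr (esem e \<sigma>) (esem f \<sigma>') = (if b = c then 1 else 0)"
  proof (cases "p = q")
    case True
    from cs have "distinct (map fst cs)" by (auto elim!: wtu_clausesE)
    with True p q have "e = f" by (meson eq_key_imp_eq_value)
    then show ?thesis using esem_iso[OF ie(1)] fi ie(2) True p(2) q(2) by (simp add: binst_eq_iff)
  next
    case False
    from cs have *: "ONBe Q2 (set (map snd cs))" "distinct (map snd cs)" by (auto elim!: wtu_clausesE)
    have "e \<noteq> f"
    proof
      assume "e = f"
      with False p q *(2) show False
        by (metis distinct_map inj_onD prod.inject snd_conv)
    qed
    moreover have "e \<in> set (map snd cs)" "f \<in> set (map snd cs)" using p q by force+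
    ultimately have "innr (esem e \<sigma>) (esem f \<sigma>') = 0" using ONBe_orth[OF *(1)] ie fi by blast
    moreover have "b \<noteq> c" using clause_unique(1)[OF p(1) q(1)] False p q by blast
    ultimately show ?thesis by simp
  qed
  then show "innr (clause_mat cs b) (clause_mat cs c) = (if b = c then 1 else 0)"
    using clause_mat_eq[OF p(1)] clause_mat_eq[OF q(1)] p q by simp
qed

text \<open>Spanning of the expression basis may use columns at basis values outside
  \<open>Q1\<close>. Such columns live outside \<open>Q2\<close>, so restricting the expansion to
  \<open>Q2\<close> leaves \<open>ket c\<close> unchanged and keeps only usable columns.\<close>

lemma clauses_span:
  assumes "bt c Q2"
  shows "ket c \<in> lspan (clause_mat cs ` {b. bt b Q1})"
proof -
  from cs have *: "ONBe Q2 (set (map snd cs))" "\<forall>e\<in>set (map snd cs). typable (trm_of_expr e) Q2"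
    by (auto elim!: wtu_clausesE simp: typable_def)
  let ?V = "{esem e \<sigma> |e \<sigma>. e \<in> set (map snd cs)}" and ?A = "{b. bt b Q2}"
  have V: "\<exists>b. v = clause_mat cs b" if "v \<in> ?V" for v
  proof -
    from that obtain p e \<sigma> where "(p, e) \<in> set cs" "v = esem e \<sigma>" by auto
    then show ?thesis using clause_mat_eq by metis
  qed
  have supp: "supp (clause_mat cs b) \<subseteq> ?A" if "bt b Q1" for b
    using isomD(1)[OF isom_clauses] that by (auto simp: supp_def)
  have supp': "supp (clause_mat cs b) \<inter> ?A = {}" if "\<not> bt b Q1" for b
    using isomD(1)[OF isom_clauses] that by (auto simp: supp_def)
  have "(\<lambda>b. if b \<in> ?A then ket c b else 0) \<in> lspan {v \<in> ?V. supp v \<subseteq> ?A}"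
  proof (rule lspan_restrict[OF ONBe_span[OF * assms]])
    fix v assume "v \<in> ?V"
    then obtain b where "v = clause_mat cs b" using V by blast
    then show "supp v \<subseteq> ?A \<or> supp v \<inter> ?A = {}"
      by (cases "bt b Q1") (simp_all only: supp supp' simp_thms)
  qed
  also have "(\<lambda>b. if b \<in> ?A then ket c b else 0) = ket c"
    using assms by (auto simp: ket_def)
  finally show ?thesis
  proof (rule lspan_trans)
    fix v assume that: "v \<in> {v \<in> ?V. supp v \<subseteq> ?A}"
    from that V obtain b where b: "v = clause_mat cs b" "supp v \<subseteq> ?A" by blast
    show "v \<in> lspan (clause_mat cs ` {b. bt b Q1})"
    proof (cases "bt b Q1")
      case True
      then show ?thesis using b(1) by (intro lspan_base) blast
    next
      case False
      \<comment> \<open>The support lies inside \<open>Q2\<close> by the restriction and outside it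
        because the matrix reflects types.\<close>
      then have "supp v = {}" using supp'[OF False] b by blast
      then have "v = (\<lambda>_. 0)" by (auto simp: supp_def)
      then show ?thesis by (simp add: lspan_zero)
    qed
  qed
qed

end

text \<open>The adjoint has to be part of the claim, because \<open>UStar\<close> exchanges the two
  halves. It commutes with the other constructors, up to the order of a composition, so spanning is
  needed for clauses only.\<close>

lemma isom_semu: "wtu u Q1 Q2 \<Longrightarrow> isom (semu u) Q1 Q2 \<and> isom (adj (semu u)) Q2 Q1"
proof (induction u arbitrary: Q1 Q2)
  case (Clauses cs)
  then show ?case using isom_clauses clauses_span isom_adj by simp
next
  case (UTens u v)
  then show ?case by (auto elim!: wtu_tensE simp: adj_tens intro!: isom_tens)
next
  case (UPlus u v)
  then show ?case by (auto elim!: wtu_plusE simp: adj_plus intro!: isom_plus)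
next
  case (UComp u v)
  from UComp.prems obtain Q where "wtu v Q1 Q" "wtu u Q Q2" by (auto elim: wtu_compE)
  with UComp.IH show ?case
    by (auto simp: adj_comp intro: isom_comp[of _ Q1 Q _ Q2] isom_comp[of _ Q2 Q _ Q1])
next
  case (UStar u)
  then show ?case by (auto elim!: wtu_starE)
next
  case (UCtrl u)
  then show ?case by (auto elim!: wtu_ctrlE simp: adj_ctrl intro!: isom_ctrl)
qed

lemma good_unis_semu [simp]: "good_unis semu t"
  by (simp add: good_unis_def isom_semu)

section \<open>Normal forms\<close>

text \<open>Closed values of one type can differ only through a clash of the two injections or of
  zero and successor, possibly below common constructors; each constructor on the way has a
  congruence rule. Variables are excluded by \<open>bt\<close>.\<close>

lemma orth_bval:
  "bt b Q \<Longrightarrow> bt c Q \<Longrightarrow> b \<noteq> c \<Longrightarrow> orth (trm_of_bval b) (trm_of_bval c)"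
proof (induction b arbitrary: c Q)
  case BUnit
  then show ?case by (cases c) auto
next
  case (BInl b)
  then show ?case by (cases c) (auto intro: orth.intros)
next
  case (BInr b)
  then show ?case by (cases c) (auto intro: orth_inr orth_sym[OF orth_inl_inr])
next
  case (BTens b1 b2)
  then obtain Q1 Q2 c1 c2 where c: "c = BTens c1 c2" "bt b1 Q1" "bt b2 Q2" "bt c1 Q1" "bt c2 Q2"
    by (cases c) auto
  show ?case
  proof (cases "b1 = c1")
    case True
    then have "orth (trm_of_bval b2) (trm_of_bval c2)" using BTens.IH(2) BTens.prems(3) c by blast
    then show ?thesis by (simp add: c(1) orth_tens_right)
  next
    case False
    then have "orth (trm_of_bval b1) (trm_of_bval c1)" using BTens.IH(1) c by blast
    then show ?thesis by (simp add: c(1) orth_tens_left)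
  qed
next
  case BZero
  then show ?case by (cases c) (auto intro: orth_zero_suc)
next
  case (BSuc b)
  then show ?case by (cases c) (auto intro: orth_suc orth_sym[OF orth_zero_suc])
qed auto

section \<open>Formal sums of basis values along a list\<close>

definition basis_sum :: "vec \<Rightarrow> bval list \<Rightarrow> trm" where
  "basis_sum f bs = TSum (map (\<lambda>b. (f b, trm_of_bval b)) bs)"

text \<open>The list may exceed the support. Zero coefficients allow several vectors to be written
  over one list, which \<open>teq_sum_sum_shared\<close> demands.\<close>

definition basis_list :: "qty \<Rightarrow> vec \<Rightarrow> bval list \<Rightarrow> bool" where
  "basis_list Q f bs \<longleftrightarrow> distinct bs \<and> (\<forall>b\<in>set bs. bt b Q) \<and> supp f \<subseteq> set bs"

definition unit_vec :: "qty \<Rightarrow> vec \<Rightarrow> bool" where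
  "unit_vec Q f \<longleftrightarrow> finite (supp f) \<and> (\<forall>b\<in>supp f. bt b Q) \<and> innr f f = 1"

lemma unit_vec_basis_list: "unit_vec Q f \<Longrightarrow> \<exists>bs. basis_list Q f bs"
  unfolding unit_vec_def basis_list_def by (metis finite_distinct_list subset_refl)

lemma cmod_sum_basis_list:
  assumes "unit_vec Q f" "basis_list Q f bs"
  shows "(\<Sum>b\<in>set bs. (cmod (f b))\<^sup>2) = 1"
proof -
  have "(\<Sum>b\<in>set bs. complex_of_real ((cmod (f b))\<^sup>2)) = innr f f"
    using assms(2) by (subst innr_left[of "set bs"])
      (auto simp: basis_list_def complex_norm_square mult.commute simp del: of_real_power)
  then have "complex_of_real (\<Sum>b\<in>set bs. (cmod (f b))\<^sup>2) = 1"
    using assms(1) by (simp add: unit_vec_def)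
  then show ?thesis using of_real_eq_1_iff by blast
qed

lemma wt_sum_distinct:
  assumes "distinct xs" "(\<Sum>x\<in>set xs. (cmod (a x))\<^sup>2) = 1"
    and "\<And>x. x \<in> set xs \<Longrightarrow> wt \<Gamma> (t x) Q"
    and "\<And>x y. x \<in> set xs \<Longrightarrow> y \<in> set xs \<Longrightarrow> x \<noteq> y \<Longrightarrow> orth (t x) (t y)"
  shows "wt \<Gamma> (TSum (map (\<lambda>x. (a x, t x)) xs)) Q"
proof (rule wt_sum)
  show "(\<Sum>p\<leftarrow>map (\<lambda>x. (a x, t x)) xs. (cmod (fst p))\<^sup>2) = 1"
    using assms(1,2) by (simp add: comp_def sum_list_distinct_conv_sum_set)
qed (use assms in \<open>auto simp: nth_eq_iff_index_eq\<close>)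

lemma wt_map_basis_list:
  assumes "unit_vec Q f" "basis_list Q f bs"
    and "\<And>b. bt b Q \<Longrightarrow> wt \<Gamma> (C (trm_of_bval b)) Q'"
    and "\<And>s t. orth s t \<Longrightarrow> orth (C s) (C t)"
  shows "wt \<Gamma> (TSum (map (\<lambda>b. (f b, C (trm_of_bval b))) bs)) Q'"
  using assms(2) cmod_sum_basis_list[OF assms(1,2)]
  by (intro wt_sum_distinct) (auto simp: basis_list_def intro!: assms(3,4) orth_bval)

lemma wt_basis_sum: "unit_vec Q f \<Longrightarrow> basis_list Q f bs \<Longrightarrow> wt Map.empty (basis_sum f bs) Q"
  unfolding basis_sum_def using wt_map_basis_list[of Q f bs Map.empty "\<lambda>t. t" Q] by (simp add: bt_imp_wt)

lemma teq_mset: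
  assumes "wt \<Gamma> (TSum ps) Q" "mset ps = mset qs"
  shows "teq ord \<Gamma> (TSum ps) (TSum qs) Q"
proof -
  from assms(2) obtain l where "l permutes {..<length ps}" "permute_list l ps = qs"
    by (metis mset_eq_permutation)
  then show ?thesis using teq_perm[OF assms(1)] by blast
qed

text \<open>Induction from the right end, because the rule for null summands removes the last one
  only.\<close>

lemma basis_sum_drop:
  assumes "unit_vec Q f" "basis_list Q f (bs @ zs)" "supp f \<subseteq> set bs"
  shows "teq ord Map.empty (basis_sum f (bs @ zs)) (basis_sum f bs) Q"
  using assms(2)
proof (induction zs rule: rev_induct)
  case Nil
  then show ?case using wt_basis_sum[OF assms(1)] by (auto intro: teq_refl)
next
  case (snoc z zs)
  have basis_list: "basis_list Q f (bs @ zs)" using snoc.prems assms(3) by (auto simp: basis_list_def)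
  have "f z = 0" using snoc.prems assms(3) by (auto simp: basis_list_def not_in_supp[symmetric])
  then have *: "basis_sum f (bs @ zs @ [z]) =
      TSum (map (\<lambda>b. (f b, trm_of_bval b)) (bs @ zs) @ [(0, trm_of_bval z)])"
    by (simp add: basis_sum_def)
  have "teq ord Map.empty (basis_sum f (bs @ zs @ [z])) (basis_sum f (bs @ zs)) Q"
    unfolding * basis_sum_def[of f "bs @ zs"]
    by (rule teq_drop_null) (use wt_basis_sum[OF assms(1) snoc.prems] in \<open>simp only: *\<close>)
  then show ?case using snoc.IH[OF basis_list] by (rule teq_trans)
qed

text \<open>Zero entries are permuted to the end and dropped; what remains of either list enumerates
  the support, so the two remainders are permutations of each other.\<close>

lemma basis_sum_eq:
  assumes "unit_vec Q f" "basis_list Q f bs" "basis_list Q f cs"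
  shows "teq ord Map.empty (basis_sum f bs) (basis_sum f cs) Q"
proof -
  let ?nz = "filter (\<lambda>b. b \<in> supp f)" and ?z = "filter (\<lambda>b. b \<notin> supp f)"
  have 1: "teq ord Map.empty (basis_sum f bs) (basis_sum f (?nz bs)) Q" if "basis_list Q f bs" for bs
  proof (rule teq_trans)
    show "teq ord Map.empty (basis_sum f bs) (basis_sum f (?nz bs @ ?z bs)) Q"
      unfolding basis_sum_def
    proof (rule teq_mset)
      show "wt Map.empty (TSum (map (\<lambda>b. (f b, trm_of_bval b)) bs)) Q"
        using wt_basis_sum[OF assms(1) that] by (simp add: basis_sum_def)
      have "mset bs = mset (?nz bs @ ?z bs)" by simp
      then show "mset (map (\<lambda>b. (f b, trm_of_bval b)) bs) =
          mset (map (\<lambda>b. (f b, trm_of_bval b)) (?nz bs @ ?z bs))"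
        by (simp only: mset_map)
    qed
    show "teq ord Map.empty (basis_sum f (?nz bs @ ?z bs)) (basis_sum f (?nz bs)) Q"
      by (rule basis_sum_drop[OF assms(1)]) (use that in \<open>auto simp: basis_list_def\<close>)
  qed
  have nz: "basis_list Q f (?nz bs)" using assms(2) by (auto simp: basis_list_def)
  have "mset (?nz bs) = mset (?nz cs)"
    using assms(2,3) by (subst set_eq_iff_mset_eq_distinct[symmetric]) (auto simp: basis_list_def)
  then have "mset (map (\<lambda>b. (f b, trm_of_bval b)) (?nz bs)) =
      mset (map (\<lambda>b. (f b, trm_of_bval b)) (?nz cs))"
    by (simp only: mset_map)
  then have "teq ord Map.empty (basis_sum f (?nz bs)) (basis_sum f (?nz cs)) Q"
    using wt_basis_sum[OF assms(1) nz] unfolding basis_sum_def by (intro teq_mset)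
  then show ?thesis using 1[OF assms(2)] teq_sym[OF 1[OF assms(3)]] by (blast intro: teq_trans)
qed

text \<open>Quantifying over all lists leaves the choice to each use: a list common to several
  summands, or a sorted one for a value. By \<open>nfI\<close> a single list is enough to establish
  it.\<close>

definition nf :: "bval rel \<Rightarrow> qty \<Rightarrow> vec \<Rightarrow> trm \<Rightarrow> bool" where
  "nf ord Q f t \<longleftrightarrow>
     unit_vec Q f \<and> (\<forall>bs. basis_list Q f bs \<longrightarrow> teq ord Map.empty t (basis_sum f bs) Q)"

lemma nfI:
  "unit_vec Q f \<Longrightarrow> basis_list Q f bs \<Longrightarrow> teq ord Map.empty t (basis_sum f bs) Q \<Longrightarrow> nf ord Q f t"
  unfolding nf_def using basis_sum_eq teq_trans by blast

lemma nfD: "nf ord Q f t \<Longrightarrow> unit_vec Q f" "nf ord Q f t \<Longrightarrow> basis_list Q f bs \<Longrightarrow> teq ord Map.empty t (basis_sum f bs) Q"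
  unfolding nf_def by blast+

lemma nf_basis_list:
  assumes "nf ord Q f t"
  obtains bs where "basis_list Q f bs" "teq ord Map.empty t (basis_sum f bs) Q"
  using assms unit_vec_basis_list unfolding nf_def by blast

lemma nf_teq: "teq ord Map.empty t s Q \<Longrightarrow> nf ord Q f s \<Longrightarrow> nf ord Q f t"
  unfolding nf_def using teq_trans by blast

lemma nf_basis_sum: "unit_vec Q f \<Longrightarrow> basis_list Q f bs \<Longrightarrow> nf ord Q f (basis_sum f bs)"
  by (rule nfI) (auto intro: teq_refl wt_basis_sum)

lemma nf_bval: "bt b Q \<Longrightarrow> nf ord Q (ket b) (trm_of_bval b)"
proof (rule nfI[where bs = "[b]"])
  assume b: "bt b Q"
  then show "unit_vec Q (ket b)" "basis_list Q (ket b) [b]" by (auto simp: unit_vec_def basis_list_def innr_ket)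
  have "basis_sum (ket b) [b] = TSum [(1, trm_of_bval b)]" by (simp add: basis_sum_def ket_def)
  then show "teq ord Map.empty (trm_of_bval b) (basis_sum (ket b) [b]) Q"
    using teq_sym[OF teq_single[OF bt_imp_wt[OF b]]] by simp
qed

text \<open>The basis values of both lists form one pairwise orthogonal family, and the vanishing
  inner product is then the side condition of \<open>orth_sum_sum\<close>. That rule is indexed by
  natural numbers, hence the numbering \<open>h\<close>.\<close>

lemma orth_basis_sum:
  assumes "basis_list Q f bs" "basis_list Q g cs" "innr f g = 0"
  shows "orth (basis_sum f bs) (basis_sum g cs)"
proof -
  have "finite (set bs \<union> set cs)" by simp
  then obtain h :: "bval \<Rightarrow> nat" where h: "inj_on h (set bs \<union> set cs)"
    using finite_imp_inj_to_nat_seg by blast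
  let ?S = "set bs \<union> set cs" and ?k = "the_inv_into (set bs \<union> set cs) h"
  have k: "b \<in> ?S \<Longrightarrow> ?k (h b) = b" for b by (rule the_inv_into_f_f[OF h])
  have inj: "inj_on h (set bs)" "inj_on h (set cs)" using h by (auto intro: inj_on_subset)
  have e: "basis_sum f bs = TSum (map (\<lambda>j. (f (?k j), trm_of_bval (?k j))) (map h bs))"
    "basis_sum g cs = TSum (map (\<lambda>j. (g (?k j), trm_of_bval (?k j))) (map h cs))"
    by (auto simp: basis_sum_def k)
  show ?thesis
    unfolding e
  proof (rule orth_sum_sum[where I = "h ` ?S"])
    show "\<forall>i\<in>h ` ?S. \<forall>j\<in>h ` ?S. i \<noteq> j \<longrightarrow> orth (trm_of_bval (?k i)) (trm_of_bval (?k j))"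
      using assms(1,2) by (auto simp: basis_list_def k intro!: orth_bval)
    have "set (map h bs) \<inter> set (map h cs) = h ` (set bs \<inter> set cs)"
      using h by (auto simp: inj_on_def)
    then have "(\<Sum>i\<in>set (map h bs) \<inter> set (map h cs). cnj (f (?k i)) * g (?k i)) =
        (\<Sum>b\<in>set bs \<inter> set cs. cnj (f b) * g b)"
      using inj(1) by (simp add: sum.reindex inj_on_subset[OF inj(1)] k)
    also have "\<dots> = innr f g"
      unfolding innr_def using assms(1,2)
      by (subst Sum_any_superset[of "set bs \<inter> set cs"]) (auto simp: basis_list_def supp_def)
    finally show "(\<Sum>i\<in>set (map h bs) \<inter> set (map h cs). cnj (f (?k i)) * g (?k i)) = 0"
      using assms(3) by simp
  qed (use assms(1,2) inj in \<open>auto simp: basis_list_def distinct_map\<close>)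
qed

lemma unit_vec_sum:
  fixes n :: nat
  assumes "\<And>i. i < n \<Longrightarrow> unit_vec Q (f i)" "(\<Sum>i<n. (cmod (a i))\<^sup>2) = 1"
    and "\<And>i j. i < n \<Longrightarrow> j < n \<Longrightarrow> i \<noteq> j \<Longrightarrow> innr (f i) (f j) = 0"
  shows "unit_vec Q (\<lambda>b. \<Sum>i<n. a i * f i b)"
proof -
  let ?F = "\<lambda>b. \<Sum>i<n. a i * f i b"
  have sub: "supp ?F \<subseteq> (\<Union>i<n. supp (f i))" by (rule supp_sum)
  have fin: "\<And>i. i \<in> {..<n} \<Longrightarrow> finite (supp (f i))" using assms(1) by (auto simp: unit_vec_def)
  have "innr ?F ?F = (\<Sum>i<n. \<Sum>j<n. cnj (a i) * a j * innr (f i) (f j))"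
    by (rule innr_sum_sum) (use fin in auto)
  also have "\<dots> = (\<Sum>i<n. \<Sum>j<n. if i = j then cnj (a i) * a j else 0)"
    using assms(1,3) by (intro sum.cong refl) (auto simp: unit_vec_def)
  also have "\<dots> = (\<Sum>i<n. cnj (a i) * a i)"
    by (intro sum.cong refl) (simp add: sum.delta)
  also have "\<dots> = of_real (\<Sum>i<n. (cmod (a i))\<^sup>2)"
    by (simp only: of_real_sum complex_norm_square mult.commute)
  finally have "innr ?F ?F = 1" using assms(2) by simp
  moreover have "finite (supp ?F)" using sub fin finite_subset by blast
  moreover have "\<forall>b\<in>supp ?F. bt b Q" using sub assms(1) by (fastforce simp: unit_vec_def)
  ultimately show ?thesis by (simp add: unit_vec_def)
qed

text \<open>All summands are first rewritten over one list covering every support; the rule for sums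
  over a shared family then adds up the coefficients.\<close>

lemma nf_sum:
  assumes w: "wt Map.empty (TSum (map (\<lambda>i. (a i, t i)) [0..<n])) Q"
    and t: "\<And>i. i < n \<Longrightarrow> nf ord Q (f i) (t i)"
    and o: "\<And>i j. i < n \<Longrightarrow> j < n \<Longrightarrow> i \<noteq> j \<Longrightarrow> innr (f i) (f j) = 0"
  shows "nf ord Q (\<lambda>b. \<Sum>i<n. a i * f i b) (TSum (map (\<lambda>i. (a i, t i)) [0..<n]))"
proof -
  let ?F = "\<lambda>b. \<Sum>i<n. a i * f i b"
  have a: "(\<Sum>i<n. (cmod (a i))\<^sup>2) = 1"
    using w by (auto elim!: wt_sumE simp: comp_def sum_list_distinct_conv_sum_set atLeast0LessThan)
  have v: "unit_vec Q (f i)" if "i < n" for i using t[OF that] by (rule nfD)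
  have "finite (\<Union>i<n. supp (f i))" using v by (auto simp: unit_vec_def)
  then obtain bs where bs: "distinct bs" "set bs = (\<Union>i<n. supp (f i))"
    using finite_distinct_list by metis
  have basis_list: "basis_list Q (f i) bs" if "i < n" for i
    using that bs v by (fastforce simp: basis_list_def unit_vec_def)
  have F: "unit_vec Q ?F" by (rule unit_vec_sum) (use v a o in auto)
  have admF: "basis_list Q ?F bs"
    using supp_sum[of a f "{..<n}"] bs v by (fastforce simp: basis_list_def unit_vec_def)
  have nth: "basis_sum g bs = TSum (map (\<lambda>j. (g (bs ! j), trm_of_bval (bs ! j))) [0..<length bs])" for g
    unfolding basis_sum_def by (rule arg_cong[of _ _ TSum], rule nth_equalityI) auto
  have "teq ord Map.empty (TSum (map (\<lambda>i. (a i, t i)) [0..<n]))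
      (TSum (map (\<lambda>i. (a i, basis_sum (f i) bs)) [0..<n])) Q"
    by (rule teq_cong_sum[OF w]) (use nfD(2)[OF t basis_list] in auto)
  \<comment> \<open>The summands have been replaced, so their syntactic orthogonality must be
    derived afresh. It comes from orthogonality of the vectors, the reason for assumption
    \<open>o\<close>.\<close>
  moreover have "wt Map.empty (TSum (map (\<lambda>i. (a i, basis_sum (f i) bs)) [0..<n])) Q"
    by (rule wt_sum_distinct)
       (use a in \<open>auto simp: atLeast0LessThan intro!: wt_basis_sum[OF v basis_list] orth_basis_sum[OF basis_list basis_list] o\<close>)
  then have "teq ord Map.empty (TSum (map (\<lambda>i. (a i, basis_sum (f i) bs)) [0..<n])) (basis_sum ?F bs) Q"
    unfolding nth by (rule teq_sum_sum_shared)
  ultimately show ?thesis by (intro nfI[OF F admF]) (rule teq_trans)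
qed

lemma sum_set_nth: "distinct xs \<Longrightarrow> sum g (set xs) = (\<Sum>i<length xs. g (xs ! i))"
  by (simp add: sum_list_distinct_conv_sum_set[symmetric] sum_list_sum_nth atLeast0LessThan)

lemma map_nth_upt: "map h xs = map (\<lambda>i. h (xs ! i)) [0..<length xs]"
  by (rule nth_equalityI) auto

lemma teq_cong_sum_map:
  assumes "wt \<Gamma> (TSum (map (\<lambda>x. (a x, t x)) xs)) Q"
    and "\<And>x. x \<in> set xs \<Longrightarrow> teq ord \<Gamma> (t x) (t' x) Q"
  shows "teq ord \<Gamma> (TSum (map (\<lambda>x. (a x, t x)) xs)) (TSum (map (\<lambda>x. (a x, t' x)) xs)) Q"
  using assms unfolding map_nth_upt[of _ xs] by (intro teq_cong_sum) auto

lemma nf_sum_distinct: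
  assumes "distinct xs" "wt Map.empty (TSum (map (\<lambda>x. (a x, t x)) xs)) Q"
    and "\<And>x. x \<in> set xs \<Longrightarrow> nf ord Q (f x) (t x)"
    and "\<And>x y. x \<in> set xs \<Longrightarrow> y \<in> set xs \<Longrightarrow> x \<noteq> y \<Longrightarrow> innr (f x) (f y) = 0"
  shows "nf ord Q (\<lambda>b. \<Sum>x\<in>set xs. a x * f x b) (TSum (map (\<lambda>x. (a x, t x)) xs))"
  unfolding sum_set_nth[OF assms(1)] map_nth_upt[of _ xs]
  by (rule nf_sum) (use assms in \<open>auto simp: map_nth_upt[of _ xs] nth_eq_iff_index_eq\<close>)

section \<open>Normal forms under the term constructors\<close>

lemma teq_linear_basis_sum:
  assumes "C \<in> lin_contexts" "wt \<Gamma> (C (basis_sum f bs)) Q"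
  shows "teq ord \<Gamma> (C (basis_sum f bs)) (TSum (map (\<lambda>b. (f b, C (trm_of_bval b))) bs)) Q"
  using teq_linear[OF assms(1), of \<Gamma> "map (\<lambda>b. (f b, trm_of_bval b)) bs"] assms(2)
  by (simp add: basis_sum_def comp_def)

lemma lin_contexts [simp]:
  "TInl \<in> lin_contexts" "TInr \<in> lin_contexts" "TSuc \<in> lin_contexts" "TApp u \<in> lin_contexts"
  "TTens t \<in> lin_contexts" "(\<lambda>s. TTens s t) \<in> lin_contexts"
  by (auto simp: lin_contexts_def)

lemma nf_inl: "nf ord Q1 f t \<Longrightarrow> nf ord (QSum Q1 Q2) (inlv f) (TInl t)"
proof -
  assume f: "nf ord Q1 f t"
  then obtain bs where bs: "basis_list Q1 f bs" "teq ord Map.empty t (basis_sum f bs) Q1" by (rule nf_basis_list)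
  have v: "unit_vec Q1 f" using f by (rule nfD)
  have "teq ord Map.empty (TInl (basis_sum f bs)) (TSum (map (\<lambda>b. (f b, TInl (trm_of_bval b))) bs))
      (QSum Q1 Q2)"
    by (rule teq_linear_basis_sum) (auto intro!: wt_inl wt_basis_sum v bs)
  moreover have "TSum (map (\<lambda>b. (f b, TInl (trm_of_bval b))) bs) = basis_sum (inlv f) (map BInl bs)"
    by (simp add: basis_sum_def)
  ultimately have "teq ord Map.empty (TInl t) (basis_sum (inlv f) (map BInl bs)) (QSum Q1 Q2)"
    using teq_cong_inl[OF bs(2)] by (metis teq_trans)
  then show ?thesis
    by (rule nfI[rotated 2]) (use v bs in \<open>auto simp: unit_vec_def basis_list_def innr_inlv distinct_map inj_on_def\<close>)
qed

lemma nf_inr: "nf ord Q2 f t \<Longrightarrow> nf ord (QSum Q1 Q2) (inrv f) (TInr t)"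
proof -
  assume f: "nf ord Q2 f t"
  then obtain bs where bs: "basis_list Q2 f bs" "teq ord Map.empty t (basis_sum f bs) Q2" by (rule nf_basis_list)
  have v: "unit_vec Q2 f" using f by (rule nfD)
  have "teq ord Map.empty (TInr (basis_sum f bs)) (TSum (map (\<lambda>b. (f b, TInr (trm_of_bval b))) bs))
      (QSum Q1 Q2)"
    by (rule teq_linear_basis_sum) (auto intro!: wt_inr wt_basis_sum v bs)
  moreover have "TSum (map (\<lambda>b. (f b, TInr (trm_of_bval b))) bs) = basis_sum (inrv f) (map BInr bs)"
    by (simp add: basis_sum_def)
  ultimately have "teq ord Map.empty (TInr t) (basis_sum (inrv f) (map BInr bs)) (QSum Q1 Q2)"
    using teq_cong_inr[OF bs(2)] by (metis teq_trans)
  then show ?thesis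
    by (rule nfI[rotated 2]) (use v bs in \<open>auto simp: unit_vec_def basis_list_def innr_inrv distinct_map inj_on_def\<close>)
qed

lemma nf_suc: "nf ord QNat f t \<Longrightarrow> nf ord QNat (sucv f) (TSuc t)"
proof -
  assume f: "nf ord QNat f t"
  then obtain bs where bs: "basis_list QNat f bs" "teq ord Map.empty t (basis_sum f bs) QNat" by (rule nf_basis_list)
  have v: "unit_vec QNat f" using f by (rule nfD)
  have "teq ord Map.empty (TSuc (basis_sum f bs)) (TSum (map (\<lambda>b. (f b, TSuc (trm_of_bval b))) bs)) QNat"
    by (rule teq_linear_basis_sum) (auto intro!: wt_suc wt_basis_sum v bs)
  moreover have "TSum (map (\<lambda>b. (f b, TSuc (trm_of_bval b))) bs) = basis_sum (sucv f) (map BSuc bs)"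
    by (simp add: basis_sum_def)
  ultimately have "teq ord Map.empty (TSuc t) (basis_sum (sucv f) (map BSuc bs)) QNat"
    using teq_cong_suc[OF bs(2)] by (metis teq_trans)
  then show ?thesis
    by (rule nfI[rotated 2]) (use v bs in \<open>auto simp: unit_vec_def basis_list_def innr_sucv distinct_map inj_on_def\<close>)
qed

lemma wt_tens_closed:
  "wt Map.empty s Q1 \<Longrightarrow> wt Map.empty t Q2 \<Longrightarrow> wt Map.empty (TTens s t) (QTens Q1 Q2)"
  using wt_tens[of Map.empty s Q1 Map.empty t Q2] by simp

lemma teq_cong_tens_closed:
  "wt Map.empty t Q1 \<Longrightarrow> teq ord Map.empty t1 t2 Q2 \<Longrightarrow>
    teq ord Map.empty (TTens t t1) (TTens t t2) (QTens Q1 Q2)"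
  "teq ord Map.empty t1 t2 Q1 \<Longrightarrow> wt Map.empty t Q2 \<Longrightarrow>
    teq ord Map.empty (TTens t1 t) (TTens t2 t) (QTens Q1 Q2)"
  using teq_cong_tens_right[of Map.empty t Q1 ord Map.empty t1 t2 Q2]
    teq_cong_tens_left[of ord Map.empty t1 t2 Q1 Map.empty t Q2] by simp_all

lemma unit_vec_tensv: "unit_vec Q1 f \<Longrightarrow> unit_vec Q2 g \<Longrightarrow> unit_vec (QTens Q1 Q2) (tensv f g)"
  by (auto simp: unit_vec_def innr_tensv)

lemma nf_tens_ket:
  assumes b: "bt b Q1" and g: "nf ord Q2 g t"
  shows "nf ord (QTens Q1 Q2) (tensv (ket b) g) (TTens (trm_of_bval b) t)"
proof -
  from g obtain bs where bs: "basis_list Q2 g bs" "teq ord Map.empty t (basis_sum g bs) Q2" by (rule nf_basis_list)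
  have v: "unit_vec Q2 g" using g by (rule nfD)
  let ?C = "TTens (trm_of_bval b)"
  have "teq ord Map.empty (?C (basis_sum g bs)) (TSum (map (\<lambda>c. (g c, ?C (trm_of_bval c))) bs))
      (QTens Q1 Q2)"
    by (rule teq_linear_basis_sum) (auto intro!: wt_tens_closed wt_basis_sum v bs bt_imp_wt b)
  moreover have "TSum (map (\<lambda>c. (g c, ?C (trm_of_bval c))) bs) =
      basis_sum (tensv (ket b) g) (map (BTens b) bs)"
    by (simp add: basis_sum_def ket_def)
  ultimately have "teq ord Map.empty (?C t) (basis_sum (tensv (ket b) g) (map (BTens b) bs)) (QTens Q1 Q2)"
    using teq_cong_tens_closed(1)[OF bt_imp_wt[OF b] bs(2)] by (metis teq_trans)
  moreover have "unit_vec (QTens Q1 Q2) (tensv (ket b) g)"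
    using nfD(1)[OF nf_bval[OF b]] v by (rule unit_vec_tensv)
  moreover have "basis_list (QTens Q1 Q2) (tensv (ket b) g) (map (BTens b) bs)"
    using b bs by (auto simp: basis_list_def distinct_map inj_on_def)
  ultimately show ?thesis by (blast intro: nfI)
qed

text \<open>The left factor is expanded while \<open>t\<close> is left as it stands, so every
  summand has a basis value on the left and falls under \<open>nf_tens_ket\<close>. The basis values
  on the left also make these summands orthogonal.\<close>

lemma nf_tens:
  assumes f: "nf ord Q1 f s" and g: "nf ord Q2 g t" and w: "wt Map.empty t Q2"
  shows "nf ord (QTens Q1 Q2) (tensv f g) (TTens s t)"
proof -
  from f obtain bs where bs: "basis_list Q1 f bs" "teq ord Map.empty s (basis_sum f bs) Q1" by (rule nf_basis_list)
  have v: "unit_vec Q1 f" "unit_vec Q2 g" using f g by (auto dest: nfD)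
  have d: "distinct bs" "\<And>b. b \<in> set bs \<Longrightarrow> bt b Q1" "supp f \<subseteq> set bs" using bs(1) by (auto simp: basis_list_def)
  have "tensv f g c = (\<Sum>b\<in>set bs. f b * tensv (ket b) g c)" for c
  proof (cases c)
    case (BTens c1 c2)
    have "(\<Sum>b\<in>set bs. f b * tensv (ket b) g c) = (\<Sum>b\<in>set bs. if c1 = b then f b * g c2 else 0)"
      using BTens by (intro sum.cong) (auto simp: ket_def)
    also have "\<dots> = tensv f g c"
      using BTens d(3) by (auto simp: sum.delta supp_def)
    finally show ?thesis ..
  qed auto
  then have e: "tensv f g = (\<lambda>c. \<Sum>b\<in>set bs. f b * tensv (ket b) g c)" by blast
  have "nf ord (QTens Q1 Q2) (tensv f g) (TSum (map (\<lambda>b. (f b, TTens (trm_of_bval b) t)) bs))"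
    unfolding e
  proof (rule nf_sum_distinct[OF d(1)])
    show "wt Map.empty (TSum (map (\<lambda>b. (f b, TTens (trm_of_bval b) t)) bs)) (QTens Q1 Q2)"
      by (rule wt_map_basis_list[OF v(1) bs(1), where C = "\<lambda>s. TTens s t"])
         (auto intro: wt_tens_closed bt_imp_wt w orth_tens_left)
    show "nf ord (QTens Q1 Q2) (tensv (ket b) g) (TTens (trm_of_bval b) t)" if "b \<in> set bs" for b
      using nf_tens_ket d(2)[OF that] g by blast
    show "innr (tensv (ket b) g) (tensv (ket c) g) = 0" if "b \<noteq> c" for b c
      using that v(2) by (simp add: innr_tensv unit_vec_def innr_ket)
  qed
  moreover have "teq ord Map.empty (TTens (basis_sum f bs) t)
      (TSum (map (\<lambda>b. (f b, TTens (trm_of_bval b) t)) bs)) (QTens Q1 Q2)"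
    by (rule teq_linear_basis_sum[where C = "\<lambda>s. TTens s t"]) (auto intro!: wt_tens_closed wt_basis_sum v bs w)
  ultimately show ?thesis
    using teq_cong_tens_closed(2)[OF bs(2) w] nf_teq by blast
qed

lemma unit_vec_semu: "wtu u Q1 Q2 \<Longrightarrow> bt b Q1 \<Longrightarrow> unit_vec Q2 (semu u b)"
  using isom_semu[of u Q1 Q2] isomD[of "semu u" Q1 Q2] by (auto simp: unit_vec_def supp_def)

lemma unit_vec_adj: "wtu u Q1 Q2 \<Longrightarrow> bt b Q2 \<Longrightarrow> unit_vec Q1 (adj (semu u) b)"
  using unit_vec_semu[OF wtu_star] by simp

text \<open>Linearity reduces an arbitrary argument to basis values: the sum of the applied basis
  values is well formed by \<open>orth_app\<close>, and its vectors are orthogonal because the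
  columns of \<open>u\<close> are.\<close>

lemma nf_app:
  assumes u: "wtu u Q1 Q2" and b: "\<And>b. bt b Q1 \<Longrightarrow> nf ord Q2 (semu u b) (TApp u (trm_of_bval b))"
    and f: "nf ord Q1 f t"
  shows "nf ord Q2 (appv (semu u) f) (TApp u t)"
proof -
  from f obtain bs where bs: "basis_list Q1 f bs" "teq ord Map.empty t (basis_sum f bs) Q1" by (rule nf_basis_list)
  have v: "unit_vec Q1 f" using f by (rule nfD)
  have d: "distinct bs" "\<And>b. b \<in> set bs \<Longrightarrow> bt b Q1" "supp f \<subseteq> set bs" using bs(1) by (auto simp: basis_list_def)
  have e: "appv (semu u) f = (\<lambda>c. \<Sum>b\<in>set bs. f b * semu u b c)"
    using d(3) by (auto simp: appv_eq[of "set bs"])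
  have "nf ord Q2 (appv (semu u) f) (TSum (map (\<lambda>b. (f b, TApp u (trm_of_bval b))) bs))"
    unfolding e
  proof (rule nf_sum_distinct[OF d(1)])
    show "wt Map.empty (TSum (map (\<lambda>b. (f b, TApp u (trm_of_bval b))) bs)) Q2"
      by (rule wt_map_basis_list[OF v(1) bs(1)]) (auto intro: wt_app u bt_imp_wt orth_app)
    show "innr (semu u b) (semu u c) = 0" if "b \<in> set bs" "c \<in> set bs" "b \<noteq> c" for b c
      using isom_semu[OF u] isomD(3)[of "semu u" Q1 Q2 b c] d(2) that by simp
  qed (use b d in blast)
  moreover have "teq ord Map.empty (TApp u (basis_sum f bs))
      (TSum (map (\<lambda>b. (f b, TApp u (trm_of_bval b))) bs)) Q2"
    by (rule teq_linear_basis_sum) (auto intro!: wt_app[OF u] wt_basis_sum v bs)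
  ultimately show ?thesis using teq_cong_app[OF u bs(2)] nf_teq by blast
qed

text \<open>Only the unitaries occurring in \<open>t\<close> are assumed to evaluate on basis
  values. This makes the result applicable to clause right-hand sides inside the induction on
  unitaries, where no such assumption is available yet.\<close>

lemma nf_term:
  assumes "\<And>u Q1 Q2 b. u \<in> unis t \<Longrightarrow> wtu u Q1 Q2 \<Longrightarrow> bt b Q1 \<Longrightarrow>
      nf ord Q2 (semu u b) (TApp u (trm_of_bval b))"
    and "wt Map.empty t Q"
  shows "nf ord Q (tsem semu t \<sigma>) t"
  using assms
proof (induction t arbitrary: Q rule: trm_induct)
  case TUnit
  then have "Q = QUnit" by (auto elim: wt_unitE)
  then show ?case using nf_bval[of BUnit QUnit ord] by simp
next
  case (TVar x)
  then show ?case by (metis map_upd_nonempty wt_varE)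
next
  case TZero
  then have "Q = QNat" by (auto elim: wt_zeroE)
  then show ?case using nf_bval[of BZero QNat ord] by simp
next
  case (TInl t)
  from TInl.prems(2) obtain Q1 Q2 where "Q = QSum Q1 Q2" "wt Map.empty t Q1" by (auto elim: wt_inlE)
  then show ?case using TInl by (auto intro: nf_inl)
next
  case (TInr t)
  from TInr.prems(2) obtain Q1 Q2 where "Q = QSum Q1 Q2" "wt Map.empty t Q2" by (auto elim: wt_inrE)
  then show ?case using TInr by (auto intro: nf_inr)
next
  case (TSuc t)
  from TSuc.prems(2) have "Q = QNat" "wt Map.empty t QNat" by (auto elim: wt_sucE)
  then show ?case using TSuc by (auto intro: nf_suc)
next
  case (TTens s t)
  from TTens.prems(2) obtain \<Gamma>1 \<Gamma>2 Q1 Q2 where *: "Map.empty = \<Gamma>1 ++ \<Gamma>2" "Q = QTens Q1 Q2"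
    "wt \<Gamma>1 s Q1" "wt \<Gamma>2 t Q2"
    by (rule wt_tensE) (rule that; assumption)
  from *(1)[symmetric] have "\<Gamma>1 = Map.empty" "\<Gamma>2 = Map.empty"
    unfolding map_add_empty_iff by blast+
  with * show ?case using TTens by (auto intro: nf_tens)
next
  case (TApp u t)
  from TApp.prems(2) obtain Q1 where u: "wtu u Q1 Q" "wt Map.empty t Q1" by (auto elim: wt_appE)
  have "nf ord Q (appv (semu u) (tsem semu t \<sigma>)) (TApp u t)"
  proof (rule nf_app[OF u(1)])
    show "nf ord Q1 (tsem semu t \<sigma>) t" using TApp u(2) by simp
  qed (use TApp.prems(1) u(1) in simp)
  then show ?case by simp
next
  case (TSum ps)
  have e: "ps = map (\<lambda>i. (fst (ps ! i), snd (ps ! i))) [0..<length ps]"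
    by (rule nth_equalityI) auto
  have w: "wt Map.empty (snd (ps ! i)) Q" if "i < length ps" for i
    using TSum.prems(2) that by (auto elim: wt_sumE)
  have "nf ord Q (tsem semu (TSum ps) \<sigma>) (TSum (map (\<lambda>i. (fst (ps ! i), snd (ps ! i))) [0..<length ps]))"
    unfolding tsem_sum_nth
  proof (rule nf_sum)
    show "wt Map.empty (TSum (map (\<lambda>i. (fst (ps ! i), snd (ps ! i))) [0..<length ps])) Q"
      using TSum.prems(2) e by simp
    show "nf ord Q (tsem semu (snd (ps ! i)) \<sigma>) (snd (ps ! i))" if "i < length ps" for i
    proof (rule TSum.IH)
      show "ps ! i \<in> set ps" using that by simp
      show "nf ord Q2 (semu u b) (TApp u (trm_of_bval b))"
        if "u \<in> unis (snd (ps ! i))" "wtu u Q1 Q2" "bt b Q1" for u Q1 Q2 b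
        using TSum.prems(1)[OF _ that(2,3)] that(1) \<open>ps ! i \<in> set ps\<close> by auto
    qed (rule w[OF that])
    \<comment> \<open>Here soundness of orthogonality pays off: the syntactic side condition of the
      typing rule becomes orthogonality of the denotations.\<close>
    show "innr (tsem semu (snd (ps ! i)) \<sigma>) (tsem semu (snd (ps ! j)) \<sigma>) = 0"
      if "i < length ps" "j < length ps" "i \<noteq> j" for i j
    proof (rule orth_sound)
      show "orth (snd (ps ! i)) (snd (ps ! j))" using TSum.prems(2) that by (auto elim: wt_sumE)
    qed (use w that in \<open>auto intro!: instI\<close>)
  qed
  then show ?case using e by simp
qed

section \<open>Matching and substitution for clauses\<close>

definition restrict_env :: "(var \<Rightarrow> bval) \<Rightarrow> var set \<Rightarrow> valuation" where
  "restrict_env \<sigma> V = (\<lambda>x. if x \<in> V then Some (expr_of_bval (\<sigma> x)) else None)"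

text \<open>Matching yields valuations defined exactly on the variables of the pattern, so the
  environment is cut down to these. Linear typing keeps the two domains at a tensor
  disjoint.\<close>

lemma matches_binst:
  "wt \<Gamma> (trm_of_bval p) Q \<Longrightarrow> matches (restrict_env \<sigma> (fv (trm_of_bval p))) p (binst \<sigma> p)"
proof (induction p arbitrary: \<Gamma> Q)
  case BUnit
  then show ?case using matches_unit by (simp add: restrict_env_def)
next
  case (BVar x)
  have "restrict_env \<sigma> (fv (trm_of_bval (BVar x))) = [x \<mapsto> expr_of_bval (\<sigma> x)]"
    by (auto simp: restrict_env_def)
  then show ?case using matches_var[of x "\<sigma> x"] by (simp only: binst.simps)
next
  case BZero
  then show ?case using matches_zero by (simp add: restrict_env_def)
next
  case (BTens p q)
  let ?V = "fv (trm_of_bval p)" and ?W = "fv (trm_of_bval q)"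
  have "typable (TTens (trm_of_bval p) (trm_of_bval q)) Q" using BTens.prems by (auto simp: typable_def)
  then have "?V \<inter> ?W = {}" by (rule typable_tens_fv)
  then have "dom (restrict_env \<sigma> ?V) \<inter> dom (restrict_env \<sigma> ?W) = {}"
    by (auto simp: restrict_env_def split: if_splits)
  moreover have "restrict_env \<sigma> (?V \<union> ?W) = restrict_env \<sigma> ?V ++ restrict_env \<sigma> ?W"
    by (auto simp: restrict_env_def map_add_def fun_eq_iff)
  ultimately show ?case using BTens by (auto elim!: wt_tensE intro!: matches_tens)
qed (auto elim!: wt_inlE wt_inrE wt_sucE intro: matches.intros)

lemma trm_of_expr_of_bval [simp]: "trm_of_expr (expr_of_bval b) = trm_of_bval b"
  by (simp add: trm_of_bval_def)

text \<open>None of the rules mentions a variable, so each is stable under substitution. This is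
  what keeps sums well typed in \<open>wt_subst\<close>.\<close>

lemma orth_subst: "orth s t \<Longrightarrow> orth (subst v s) (subst v t)"
proof (induction rule: orth.induct)
  case (orth_sum ps t)
  then have "\<forall>p\<in>set (map (map_prod id (subst v)) ps). orth (subst v t) (snd p)" by fastforce
  then show ?case using orth.orth_sum by simp
next
  case (orth_sum_null ps qs t)
  then have "\<forall>p\<in>set (map (map_prod id (subst v)) ps @ map (map_prod id (subst v)) qs).
      orth (subst v t) (snd p)" by (simp add: ball_Un)
  then show ?case
    using orth.orth_sum_null[of "map (map_prod id (subst v)) ps" "map (map_prod id (subst v)) qs" "subst v t"]
    by simp
next
  case (orth_sum_sum I t js ks \<alpha> \<beta>)
  then show ?case
    using orth.orth_sum_sum[of I "\<lambda>i. subst v (t i)" js ks \<alpha> \<beta>] by (simp add: comp_def)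
qed (auto intro: orth.intros)

lemma wt_subst:
  "wt \<Gamma> t Q \<Longrightarrow> sat \<Gamma> \<sigma> \<Longrightarrow> fv t \<subseteq> V \<Longrightarrow> wt Map.empty (subst (restrict_env \<sigma> V) t) Q"
proof (induction t arbitrary: \<Gamma> Q rule: trm_induct)
  case (TVar x)
  then show ?case by (auto elim!: wt_varE simp: restrict_env_def sat_def bt_imp_wt)
next
  case (TTens s t)
  from TTens.prems obtain \<Gamma>1 \<Gamma>2 Q1 Q2 where "\<Gamma> = \<Gamma>1 ++ \<Gamma>2" "Q = QTens Q1 Q2"
    "wt \<Gamma>1 s Q1" "wt \<Gamma>2 t Q2" "dom \<Gamma>1 \<inter> dom \<Gamma>2 = {}"
    by (auto elim!: wt_tensE)
  then show ?case using TTens by (auto simp: sat_add intro!: wt_tens_closed)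
next
  case (TSum ps)
  have "wt Map.empty (subst (restrict_env \<sigma> V) (snd p)) Q" if "p \<in> set ps" for p
    by (rule TSum.IH[OF that _ TSum.prems(2)]) (use TSum.prems(1,3) that in \<open>auto elim: wt_sumE\<close>)
  then show ?case using TSum.prems(1)
    by (auto elim!: wt_sumE intro!: wt_sum orth_subst simp: comp_def)
qed (auto elim!: wt_unitE wt_inlE wt_inrE wt_zeroE wt_sucE wt_appE intro: wt_wtu.intros)

lemma binst_BVar [simp]: "binst BVar b = b"
  by (induction b) auto

text \<open>\<open>BVar\<close> serves as the identity environment: by \<open>binst_BVar\<close> it
  evaluates every substituted basis value to its own ket, whether closed or not.\<close>

lemma tsem_subst: "fv t \<subseteq> V \<Longrightarrow> tsem M (subst (restrict_env \<sigma> V) t) BVar = tsem M t \<sigma>"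
proof (induction t rule: trm_induct)
  case (TVar x)
  then show ?case by (simp add: restrict_env_def tsem_bval)
next
  case (TSum ps)
  have "tsem M (subst (restrict_env \<sigma> V) (snd p)) BVar = tsem M (snd p) \<sigma>" if "p \<in> set ps" for p
    by (rule TSum.IH[OF that]) (use TSum.prems that in auto)
  then show ?case by (auto simp: comp_def intro!: ext arg_cong[of _ _ sum_list] cong: map_cong)
qed auto

lemma unis_subst: "unis (subst v t) = unis t"
  by (induction t rule: trm_induct) (auto split: option.splits)

lemma nf_clauses:
  assumes cs: "wtu (Clauses cs) Q1 Q2" and b: "bt b Q1"
  shows "nf ord Q2 (clause_mat cs b) (TApp (Clauses cs) (trm_of_bval b))"
proof -
  obtain p e \<sigma> where p: "(p, e) \<in> set cs" "b = binst \<sigma> p" using clause_match[OF cs b] .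
  from clause_typing[OF cs p(1)] obtain \<Gamma> where \<Gamma>: "wt \<Gamma> (trm_of_bval p) Q1" "wt \<Gamma> (trm_of_expr e) Q2"
    "\<forall>\<sigma>. bt (binst \<sigma> p) Q1 \<longleftrightarrow> sat \<Gamma> \<sigma>" "fv (trm_of_bval p) = fv (trm_of_expr e)"
    by (elim exE conjE)
  let ?v = "restrict_env \<sigma> (fv (trm_of_bval p))"
  let ?t = "subst ?v (trm_of_expr e)"
  have "sat \<Gamma> \<sigma>" using \<Gamma>(3) b p(2) by simp
  then have "wt Map.empty ?t Q2" using \<Gamma>(2,4) by (intro wt_subst) auto
  \<comment> \<open>The instantiated right-hand side applies no unitary, so the assumption of
    \<open>nf_term\<close> holds vacuously.\<close>
  then have "nf ord Q2 (tsem semu ?t BVar) ?t" by (intro nf_term) (auto simp: unis_subst)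
  moreover have "tsem semu ?t BVar = clause_mat cs b"
    using clause_mat_eq[OF cs p(1)] p(2) \<Gamma>(4) tsem_no_unis[OF unis_expr] by (metis order_refl tsem_subst)
  moreover have "teq ord Map.empty (TApp (Clauses cs) (trm_of_bval b)) ?t Q2"
    by (rule teq_clauses[OF cs bt_imp_wt[OF b] p(1)]) (simp add: p(2) matches_binst[OF \<Gamma>(1)])
  ultimately show ?thesis using nf_teq by metis
qed

section \<open>Values and the rule for adjoints\<close>

lemma sorted_list_ex:
  assumes "linear_order ord" "finite S"
  shows "\<exists>xs. set xs = S \<and> distinct xs \<and> sorted_wrt (\<lambda>b b'. (b, b') \<in> ord \<and> b \<noteq> b') xs"
  using assms(2)
proof (induction S)
  case (insert x S)
  then obtain xs where xs: "set xs = S" "distinct xs" "sorted_wrt (\<lambda>b b'. (b, b') \<in> ord \<and> b \<noteq> b') xs"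
    by blast
  let ?l = "filter (\<lambda>y. (y, x) \<in> ord) xs" and ?g = "filter (\<lambda>y. (y, x) \<notin> ord) xs"
  from assms(1) have ord: "trans ord" "antisym ord" "total ord"
    by (auto simp: order_on_defs)
  have l: "\<forall>y\<in>set ?l. (y, x) \<in> ord \<and> y \<noteq> x"
    using xs(1) insert.hyps(2) by auto
  have g: "\<forall>y\<in>set ?g. (x, y) \<in> ord \<and> x \<noteq> y"
    using xs(1) insert.hyps(2) ord(3) by (auto simp: total_on_def) metis
  have "\<forall>y\<in>set ?l. \<forall>z\<in>set ?g. (y, z) \<in> ord \<and> y \<noteq> z"
  proof (intro ballI)
    fix y z assume "y \<in> set ?l" "z \<in> set ?g"
    with l g have "(y, x) \<in> ord" "(x, z) \<in> ord" "y \<noteq> x" by blast+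
    then show "(y, z) \<in> ord \<and> y \<noteq> z" using transD[OF ord(1)] antisymD[OF ord(2)] by blast
  qed
  then have lg: "\<forall>y\<in>set ?l. \<forall>z\<in>set (x # ?g). (y, z) \<in> ord \<and> y \<noteq> z"
    unfolding list.set(2) using l by blast
  have "sorted_wrt (\<lambda>b b'. (b, b') \<in> ord \<and> b \<noteq> b') (?l @ x # ?g)"
    unfolding sorted_wrt_append sorted_wrt.simps by (intro conjI sorted_wrt_filter xs(3) g lg)
  moreover have "set (?l @ x # ?g) = insert x S" "distinct (?l @ x # ?g)"
    using xs insert.hyps(2) by auto
  ultimately show ?case by blast
qed simp

lemma value_ex:
  assumes "linear_order ord" "unit_vec Q f"
  shows "\<exists>bs. basis_list Q f bs \<and> is_value ord (basis_sum f bs)"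
proof -
  have "finite (supp f)" using assms(2) by (simp add: unit_vec_def)
  \<comment> \<open>Listing the support and nothing more makes every coefficient nonzero, as a value
    requires.\<close>
  from sorted_list_ex[OF assms(1) this] obtain bs where bs: "set bs = supp f" "distinct bs"
    "sorted_wrt (\<lambda>b b'. (b, b') \<in> ord \<and> b \<noteq> b') bs" by blast
  have "is_value ord (basis_sum f bs)"
    unfolding is_value_def basis_sum_def
    by (rule exI[of _ "map (\<lambda>b. (f b, b)) bs"]) (use bs in \<open>auto simp: comp_def supp_def\<close>)
  then show ?thesis using bs assms(2) by (auto simp: basis_list_def unit_vec_def)
qed

text \<open>At \<open>x\<close> of type \<open>Q2\<close> this is orthonormality of the rows at
  \<open>c\<close> and \<open>x\<close>, up to conjugation. At any other \<open>x\<close> both sides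
  vanish, the columns involved being supported in \<open>Q2\<close>.\<close>

lemma adj_expansion:
  assumes u: "wtu u Q1 Q2" and c: "bt c Q2"
  shows "ket c = (\<lambda>x. \<Sum>b\<in>supp (adj (semu u) c). adj (semu u) c b * semu u b x)"
proof
  fix x
  let ?R = "supp (adj (semu u) c)"
  have R: "finite ?R" "\<And>b. b \<in> ?R \<Longrightarrow> bt b Q1" using unit_vec_adj[OF u c] by (auto simp: unit_vec_def)
  show "ket c x = (\<Sum>b\<in>?R. adj (semu u) c b * semu u b x)"
  proof (cases "bt x Q2")
    case True
    have "innr (adj (semu u) c) (adj (semu u) x) = (if c = x then 1 else 0)"
      using isom_semu[OF u] c True isomD(3) by blast
    then have "cnj (\<Sum>b\<in>?R. cnj (adj (semu u) c b) * adj (semu u) x b) = (if c = x then 1 else 0)"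
      by (subst innr_left[OF R(1) subset_refl, symmetric]) simp
    then show ?thesis by (simp add: adj_def ket_def split: if_splits)
  next
    case False
    then have "semu u b x = 0" if "b \<in> ?R" for b
      using isom_semu[OF u] R(2)[OF that] isomD(1) by blast
    then show ?thesis using False c by (auto simp: ket_def)
  qed
qed

text \<open>The rule for \<open>u\<^sup>*\<close> only inverts the columns of \<open>u\<close>, so the argument \<open>c\<close> is first rewritten as a
  combination of columns, with the coefficients of its row.\<close>

lemma nf_star:
  assumes ord: "linear_order ord" and u: "wtu u Q1 Q2"
    and b: "\<And>b. bt b Q1 \<Longrightarrow> nf ord Q2 (semu u b) (TApp u (trm_of_bval b))"
    and c: "bt c Q2"
  shows "nf ord Q1 (adj (semu u) c) (TApp (UStar u) (trm_of_bval c))"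
proof -
  let ?c = "adj (semu u) c"
  have v: "unit_vec Q1 ?c" using u c by (rule unit_vec_adj)
  then obtain rs where rs: "distinct rs" "set rs = supp ?c"
    using finite_distinct_list[of "supp ?c"] by (auto simp: unit_vec_def)
  then have basis_list: "basis_list Q1 ?c rs" and ty: "\<And>b. b \<in> set rs \<Longrightarrow> bt b Q1"
    using v by (auto simp: basis_list_def unit_vec_def)
  \<comment> \<open>The rule for \<open>UStar\<close> accepts values only, so each column is written
    over a list that makes its formal sum a value.\<close>
  have "\<exists>bs. basis_list Q2 (semu u b) bs \<and> is_value ord (basis_sum (semu u b) bs)" if "b \<in> set rs" for b
    using value_ex[OF ord unit_vec_semu[OF u ty[OF that]]] .
  then obtain l where l: "\<And>b. b \<in> set rs \<Longrightarrow> basis_list Q2 (semu u b) (l b)"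
    "\<And>b. b \<in> set rs \<Longrightarrow> is_value ord (basis_sum (semu u b) (l b))" by metis
  let ?v = "\<lambda>b. basis_sum (semu u b) (l b)"
  let ?w = "TSum (map (\<lambda>b. (?c b, ?v b)) rs)"
  have vec: "unit_vec Q2 (semu u b)" if "b \<in> set rs" for b using unit_vec_semu[OF u ty[OF that]] .
  have ip: "innr (semu u b) (semu u b') = 0" if "b \<in> set rs" "b' \<in> set rs" "b \<noteq> b'" for b b'
    using isom_semu[OF u] isomD(3)[of "semu u" Q1 Q2 b b'] ty that by simp
  have wv: "wt Map.empty (?v b) Q2" if "b \<in> set rs" for b using wt_basis_sum[OF vec[OF that] l(1)[OF that]] .
  have ov: "orth (?v b) (?v b')" if "b \<in> set rs" "b' \<in> set rs" "b \<noteq> b'" for b b'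
    using orth_basis_sum[OF l(1)[OF that(1)] l(1)[OF that(2)] ip[OF that]] .
  have ww: "wt Map.empty ?w Q2"
    by (rule wt_sum_distinct[OF rs(1) cmod_sum_basis_list[OF v basis_list] wv ov])
  have "nf ord Q2 (\<lambda>x. \<Sum>b\<in>set rs. ?c b * semu u b x) ?w"
    by (rule nf_sum_distinct[OF rs(1) ww]) (use vec l ip in \<open>auto intro: nf_basis_sum\<close>)
  then have "nf ord Q2 (ket c) ?w" unfolding rs(2) adj_expansion[OF u c, symmetric] .
  moreover have "nf ord Q2 (ket c) (trm_of_bval c)" using c by (rule nf_bval)
  moreover have "basis_list Q2 (ket c) [c]" using c by (simp add: basis_list_def)
  \<comment> \<open>Both terms are equal to the one-summand normal form of \<open>ket c\<close>.
    Hence a basis value is rewritten backwards into a superposition of columns.\<close>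
  ultimately have "teq ord Map.empty (trm_of_bval c) ?w Q2"
    by (blast intro: teq_trans teq_sym dest: nfD(2))
  then have "teq ord Map.empty (TApp (UStar u) (trm_of_bval c)) (TApp (UStar u) ?w) Q1"
    by (rule teq_cong_app[OF wtu_star[OF u]])
  moreover have "teq ord Map.empty (TApp (UStar u) ?w)
      (TSum (map (\<lambda>b. (?c b, TApp (UStar u) (?v b))) rs)) Q1"
    using teq_linear[OF lin_contexts(4) wt_app[OF wtu_star[OF u] ww]] by (simp add: comp_def)
  moreover have "teq ord Map.empty (TSum (map (\<lambda>b. (?c b, TApp (UStar u) (?v b))) rs)) (basis_sum ?c rs) Q1"
    unfolding basis_sum_def[of ?c]
  proof (rule teq_cong_sum_map)
    show "wt Map.empty (TSum (map (\<lambda>b. (?c b, TApp (UStar u) (?v b))) rs)) Q1"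
      by (rule wt_sum_distinct[OF rs(1) cmod_sum_basis_list[OF v basis_list]])
         (auto intro: wt_app[OF wtu_star[OF u]] wv ov orth_app)
    show "teq ord Map.empty (TApp (UStar u) (?v b)) (trm_of_bval b) Q1" if b': "b \<in> set rs" for b
      by (rule teq_star[OF u bt_imp_wt[OF ty[OF b']] l(2)[OF b'] wv[OF b'] nfD(2)[OF b[OF ty[OF b']] l(1)[OF b']]])
  qed
  ultimately show ?thesis by (intro nfI[OF v basis_list]) (blast intro: teq_trans)
qed

text \<open>Structural induction on the unitary suffices although unitaries and terms depend on each
  other: general arguments are reached by \<open>nf_app\<close> from basis values, and the
  right-hand sides of clauses contain no unitaries.\<close>

lemma nf_uni:
  assumes "linear_order ord"
  shows "wtu u Q1 Q2 \<Longrightarrow> bt b Q1 \<Longrightarrow> nf ord Q2 (semu u b) (TApp u (trm_of_bval b))"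
proof (induction u arbitrary: Q1 Q2 b)
  case (Clauses cs)
  then show ?case using nf_clauses by simp
next
  case (UTens u v)
  from UTens.prems(1) obtain P1 P2 P3 P4 where u: "Q1 = QTens P1 P3" "Q2 = QTens P2 P4"
    "wtu u P1 P2" "wtu v P3 P4" by (auto elim: wtu_tensE)
  from UTens.prems(2)[unfolded u(1)] obtain c d where cd: "b = BTens c d" "bt c P1" "bt d P3"
    by (rule bt_elims)
  have "nf ord Q2 (tensv (semu u c) (semu v d)) (TTens (TApp u (trm_of_bval c)) (TApp v (trm_of_bval d)))"
    unfolding u(2)
    by (rule nf_tens[OF UTens.IH(1)[OF u(3) cd(2)] UTens.IH(2)[OF u(4) cd(3)] wt_app[OF u(4) bt_imp_wt[OF cd(3)]]])
  then show ?case
    using nf_teq[OF teq_tens[OF u(3,4) bt_imp_wt[OF cd(2)] bt_imp_wt[OF cd(3)]]]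
    by (simp add: cd(1) u(2) tens_mat_def)
next
  case (UPlus u v)
  from UPlus.prems(1) obtain P1 P2 P3 P4 where u: "Q1 = QSum P1 P3" "Q2 = QSum P2 P4"
    "wtu u P1 P2" "wtu v P3 P4" by (auto elim: wtu_plusE)
  from UPlus.prems(2)[unfolded u(1)] show ?case
  proof (rule bt_elims)
    fix c assume c: "b = BInl c" "bt c P1"
    show ?thesis
      using nf_teq[OF teq_plus_inl[OF u(3,4) bt_imp_wt[OF c(2)]] nf_inl[OF UPlus.IH(1)[OF u(3) c(2)]]]
      by (simp add: c(1) u(2) plus_mat_def)
  next
    fix c assume c: "b = BInr c" "bt c P3"
    show ?thesis
      using nf_teq[OF teq_plus_inr[OF u(3,4) bt_imp_wt[OF c(2)]] nf_inr[OF UPlus.IH(2)[OF u(4) c(2)]]]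
      by (simp add: c(1) u(2) plus_mat_def)
  qed
next
  case (UComp u v)
  from UComp.prems(1) obtain Q where u: "wtu v Q1 Q" "wtu u Q Q2" by (auto elim: wtu_compE)
  \<comment> \<open>The argument of \<open>u\<close> is now an application and no longer a basis
    value; its normal form comes from the hypothesis for \<open>v\<close>, and the hypothesis for
    \<open>u\<close> is extended linearly.\<close>
  have "nf ord Q2 (appv (semu u) (semu v b)) (TApp u (TApp v (trm_of_bval b)))"
    by (rule nf_app[OF u(2) UComp.IH(1)[OF u(2)] UComp.IH(2)[OF u(1) UComp.prems(2)]])
  then show ?case using nf_teq[OF teq_comp[OF u bt_imp_wt[OF UComp.prems(2)]]] by simp
next
  case (UStar u)
  then have "wtu u Q2 Q1" by (auto elim: wtu_starE)
  with UStar show ?case using nf_star[OF assms] by simp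
next
  case (UCtrl u)
  from UCtrl.prems(1) obtain Q where u: "Q1 = QTens qbit Q" "Q2 = QTens qbit Q" "wtu u Q Q"
    by (auto elim: wtu_ctrlE)
  from UCtrl.prems(2)[unfolded u(1)] obtain c d where cd: "b = BTens c d" "bt c qbit" "bt d Q"
    by (rule bt_elims)
  from cd(2) consider "c = BInl BUnit" | "c = BInr BUnit" by (auto simp: bt_qbit)
  then show ?case
  proof cases
    case 1
    have "nf ord (QTens qbit Q) (ket b) (trm_of_bval b)" using cd by (intro nf_bval) auto
    then show ?thesis
      using nf_teq[OF teq_ctrl_inl[OF u(3) bt_imp_wt[OF cd(3)]], of ord "ket b"]
      by (simp add: cd(1) 1 u(2) ctrl_mat_def ket_constructor)
  next
    case 2
    have "nf ord (QTens qbit Q) (tensv (ket c) (semu u d)) (TTens (trm_of_bval c) (TApp u (trm_of_bval d)))"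
      by (rule nf_tens_ket[OF cd(2) UCtrl.IH[OF u(3) cd(3)]])
    then show ?thesis
      using nf_teq[OF teq_ctrl_inr[OF u(3) bt_imp_wt[OF cd(3)]]]
      by (simp add: cd(1) 2 u(2) ctrl_mat_def)
  qed
qed

theorem lemma2p71:
  fixes ord :: "bval rel" and Q :: qty and t :: trm
  assumes "linear_order ord"
    and "wt Map.empty t Q"
  shows "\<exists>v. is_value ord v \<and> wt Map.empty v Q \<and> teq ord Map.empty t v Q"
proof -
  \<comment> \<open>The term is closed, so any environment would do; \<open>BVar\<close> is merely
    one at hand.\<close>
  have nf: "nf ord Q (tsem semu t BVar) t"
    using nf_uni[OF assms(1)] assms(2) by (rule nf_term)
  from value_ex[OF assms(1) nfD(1)[OF nf]] obtain bs
    where bs: "basis_list Q (tsem semu t BVar) bs" "is_value ord (basis_sum (tsem semu t BVar) bs)" by blast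
  then show ?thesis using wt_basis_sum[OF nfD(1)[OF nf] bs(1)] nfD(2)[OF nf bs(1)] by blast
qed

end
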